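(* Let $d\ge 2$ be an integer and let $0<r<1/2$ be fixed. Let $\mu$ be a (Borel) probability measure on $\mathbb{T}^d$ which is different from every Dirac measure $\delta_{t_0}$, $t_0\in\mathbb{T}^d$. Then $D_\mu^2(N)\approx N$; that is, there exist constants $c_1,c_2>0$ (which may depend on $d$, $r$ and $\mu$) such that for every positive integer $M$, with $N=M^d$, $$c_1 N\le D_\mu^2(N)\le c_2 N .$$
   Context: The torus $\mathbb{T}^d=\mathbb{R}^d/\mathbb{Z}^d$ is identified with the cube $Q=[-1/2,1/2)^d$; $B=\{t\in\mathbb{R}^d:|t|\le 1\}$ is the Euclidean unit ball, $|B|$ its volume, and $0<r<1/2$ is a fixed radius. For $t\in\mathbb{T}^d$, the set $rB-t$ is regarded as a subset of $\mathbb{T}^d$ (so $\chi_{rB-t}(v)=1$ if $v+t\in rB$ modulo $\mathbb{Z}^d$, and $0$ otherwise). For a positive integer $M$ put $N=M^d$ and let $T_N=\{t_j\}_{j=1}^N=\frac1M\mathbb{Z}^d\cap Q$. Given a probability measure $\mu$ on $\mathbb{T}^d$, let $\mu_j$ ($j=1,\dots,N$) be the translated measure defined by $\int_{\mathbb{T}^d} g(t)\,d\mu_j(t)=\int_{\mathbb{T}^d} g(t-t_j)\,d\mu(t)$ for every continuous $g$ on $\mathbb{T}^d$. For points $V_N=\{v_1,\dots,v_N\}$ in $\mathbb{T}^d$ (repetitions counted) define the discrepancy function $$D_{V_N}(t)=\sum_{j=1}^N\chi_{rB-t}(v_j)-Nr^d|B|,\qquad t\in\mathbb{T}^d,$$ and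 define the generalized discrepancy $$D_\mu(N)=\left\{\int_{\mathbb{T}^d}\cdots\int_{\mathbb{T}^d}\int_{\mathbb{T}^d}D_{V_N}^2(t)\,dt\,d\mu_1(v_1)\cdots d\mu_N(v_N)\right\}^{1/2}.$$ *)

theory Defs
  imports "HOL-Probability.Probability"
begin

definition torus_cube :: "(real^'n) set" where
  "torus_cube = {x. \<forall>i. - 1/2 \<le> x $ i \<and> x $ i < 1/2}"

definition int_lattice :: "(real^'n) set" where
  "int_lattice = {k. \<forall>i. k $ i \<in> \<int>}"

(* the point of the cube that is congruent to x modulo the integer lattice *)
definition torus_rep :: "real^'n \<Rightarrow> real^'n" where
  "torus_rep x = (\<chi> i. frac (x $ i + 1/2) - 1/2)"

definition periodic :: "(real^'n \<Rightarrow> 'b) \<Rightarrow> bool" where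
  "periodic g \<longleftrightarrow> (\<forall>x. \<forall>k\<in>int_lattice. g (x + k) = g x)"

(* The torus is identified with the cube.  Although the cube is half open, the trace of the
   Borel sets of Euclidean space is the Borel sigma-algebra of the quotient topology: see
   sets_torus_borel below. *)
definition torus_borel :: "(real^'n) measure" where
  "torus_borel = restrict_space borel torus_cube"

(* image of mu under the translation by - s of the torus; torus_translate_iff shows that it is
   characterised by the integrals of the continuous functions on the torus *)
definition torus_translate :: "real^'n \<Rightarrow> (real^'n) measure \<Rightarrow> (real^'n) measure" where
  "torus_translate s \<mu> = distr \<mu> torus_borel (\<lambda>t. torus_rep (t - s))"

(* the set rB - t, as a subset of the torus (given by its periodic preimage) *)
definition shifted_ball :: "real \<Rightarrow> real^'n \<Rightarrow> (real^'n) set" where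
  "shifted_ball r t = {v. \<exists>k\<in>int_lattice. v + t + k \<in> cball 0 r}"

definition grid :: "nat \<Rightarrow> (real^'n) set" where
  "grid M = {x \<in> torus_cube. \<exists>k\<in>int_lattice. x = (1 / real M) *\<^sub>R k}"

(* The points are a family v indexed by a finite set J, so that repetitions are counted;
   the number of points is card J. *)
definition discrepancy :: "real \<Rightarrow> 'j set \<Rightarrow> ('j \<Rightarrow> real^'n) \<Rightarrow> real^'n \<Rightarrow> real" where
  "discrepancy r J v t =
     (\<Sum>j\<in>J. indicator (shifted_ball r t) (v j))
       - real (card J) * r ^ CARD('n) * measure lborel (cball (0::real^'n) 1)"

(* The grid itself serves as the index set of its points t_j; its cardinality is
   M ^ CARD('n) by card_grid. *)
definition gen_discrepancy :: "real \<Rightarrow> (real^'n) measure \<Rightarrow> nat \<Rightarrow> real" where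
  "gen_discrepancy r \<mu> M =
     sqrt (LINT v|PiM (grid M) (\<lambda>s. torus_translate s \<mu>).
             (LINT t:torus_cube|lborel. (discrepancy r (grid M) v t)\<^sup>2))"


lemma torus_rep_in_cube: "torus_rep x \<in> torus_cube"
  unfolding torus_cube_def torus_rep_def
  by (auto simp: frac_lt_1 less_diff_eq diff_less_eq)

lemma torus_rep_diff: "torus_rep x - x \<in> int_lattice"
  unfolding torus_rep_def int_lattice_def by (simp add: frac_def)

lemma torus_rep_id:
  assumes "x \<in> torus_cube" shows "torus_rep x = x"
proof -
  have "frac (x $ i + 1/2) = x $ i + 1/2" for i
    using assms by (auto simp: torus_cube_def frac_eq dest: spec[of _ i])
  then show ?thesis by (simp add: torus_rep_def vec_eq_iff)
qed

lemma periodic_torus_rep: "periodic g \<Longrightarrow> g (torus_rep x) = g x"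
  using torus_rep_diff[of x] unfolding periodic_def by (metis add.commute diff_add_cancel)

lemma space_torus_borel: "space torus_borel = torus_cube"
  by (simp add: torus_borel_def space_restrict_space)

lemma torus_rep_measurable [measurable]: "torus_rep \<in> borel \<rightarrow>\<^sub>M (torus_borel :: (real^'n) measure)"
  unfolding torus_borel_def
proof (rule measurable_restrict_space2)
  show "torus_rep \<in> space borel \<rightarrow> torus_cube" using torus_rep_in_cube by auto
  have "(\<lambda>x :: real^'n. torus_rep x $ i) \<in> borel_measurable borel" for i
  proof -
    have "(\<lambda>x :: real^'n. x $ i) \<in> borel_measurable borel"
      by (intro borel_measurable_continuous_onI continuous_intros)
    then show ?thesis unfolding torus_rep_def frac_def by simp
  qed
  then show "torus_rep \<in> borel_measurable (borel :: (real^'n) measure)"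
    by (subst borel_measurable_euclidean_space) (auto simp: Basis_vec_def inner_axis)
qed

lemma sets_torus_borel:
  "sets (torus_borel :: (real^'n) measure)
     = sigma_sets torus_cube {U \<inter> torus_cube |U. open U \<and> periodic (\<lambda>x. x \<in> U)}"
  (is "_ = sigma_sets ?Q ?G")
proof
  have G: "?G \<subseteq> Pow ?Q" by auto
  have "?G \<subseteq> sets torus_borel" by (auto simp: torus_borel_def sets_restrict_space)
  then have "sigma_sets (space torus_borel) ?G \<subseteq> sets torus_borel"
    by (rule sets.sigma_sets_subset)
  then show "sigma_sets ?Q ?G \<subseteq> sets torus_borel" by (simp add: space_torus_borel)
  define S where "S = sigma ?Q ?G"
  have S: "sets S = sigma_sets ?Q ?G" "space S = ?Q"
    unfolding S_def using G by (auto simp: space_measure_of)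
  have coord: "(\<lambda>x. x $ i) \<in> borel_measurable S" for i
  proof (rule borel_measurableI_greater)
    fix a :: real
    show "{x \<in> space S. a < x $ i} \<in> sets S"
    proof (cases "a < -1/2")
      case True
      then have "{x \<in> space S. a < x $ i} = space S"
        by (auto simp: S torus_cube_def) (smt (verit) divide_minus_left)
      then show ?thesis by (metis sets.top)
    next
      case False
      define U where "U = {x :: real^'n. a < frac (x $ i + 1/2) - 1/2}"
      have eq: "{x \<in> space S. a < x $ i} = U \<inter> ?Q"
      proof -
        have "torus_rep x $ i = x $ i" if "x \<in> ?Q" for x :: "real^'n"
          using torus_rep_id[OF that] by simp
        then show ?thesis by (auto simp: S U_def torus_rep_def)
      qed
      have "open U"
      proof -
        have "U = (\<Union>m::int. {x. a + 1/2 + of_int m < x $ i + 1/2 \<and> x $ i + 1/2 < of_int m + 1})"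
        proof (intro set_eqI iffI)
          fix x assume "x \<in> U"
          then have "a + 1/2 + of_int \<lfloor>x $ i + 1/2\<rfloor> < x $ i + 1/2 \<and> x $ i + 1/2 < of_int \<lfloor>x $ i + 1/2\<rfloor> + 1"
            unfolding U_def frac_def mem_Collect_eq by linarith
          then show "x \<in> (\<Union>m::int. {x. a + 1/2 + of_int m < x $ i + 1/2 \<and> x $ i + 1/2 < of_int m + 1})"
            by blast
        next
          fix x :: "real^'n"
          assume "x \<in> (\<Union>m::int. {x. a + 1/2 + of_int m < x $ i + 1/2 \<and> x $ i + 1/2 < of_int m + 1})"
          then obtain m :: int where m: "a + 1/2 + of_int m < x $ i + 1/2" "x $ i + 1/2 < of_int m + 1"
            by blast
          then have "\<lfloor>x $ i + 1/2\<rfloor> = m" using False by (intro floor_unique) linarith+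
          then show "x \<in> U" using m by (simp add: U_def frac_def)
        qed
        moreover have "open {x :: real^'n. a + 1/2 + of_int m < x $ i + 1/2 \<and> x $ i + 1/2 < of_int m + 1}"
          for m :: int
          by (intro open_Collect_conj open_Collect_less continuous_intros)
        ultimately show ?thesis by auto
      qed
      moreover have "periodic (\<lambda>x. x \<in> U)"
      proof -
        have "frac ((x + k) $ i + 1/2) = frac (x $ i + 1/2)" if "k \<in> int_lattice" for x k :: "real^'n"
        proof -
          have "k $ i \<in> \<int>" using that by (simp add: int_lattice_def)
          then obtain m where "k $ i = of_int m" by (rule Ints_cases)
          then have "(x + k) $ i + 1/2 = (x $ i + 1/2) + of_int m" by simp
          moreover have "frac (y + of_int m) = frac y" for y :: real by (simp add: frac_def)
          ultimately show ?thesis by metis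
        qed
        then show ?thesis unfolding periodic_def U_def by simp
      qed
      ultimately have "U \<inter> ?Q \<in> ?G" by blast
      then show ?thesis unfolding eq S(1) by (rule sigma_sets.Basic)
    qed
  qed
  have "(\<lambda>x. x) \<in> borel_measurable S"
    using coord by (subst borel_measurable_euclidean_space) (auto simp: Basis_vec_def inner_axis)
  then have "(\<lambda>x. x) -` A \<inter> space S \<in> sets S" if "A \<in> sets borel" for A
    using that by (rule measurable_sets)
  then show "sets torus_borel \<subseteq> sigma_sets ?Q ?G"
    by (auto simp: torus_borel_def sets_restrict_space S Int_commute)
qed

lemma torus_translate_measurable:
  assumes "sets \<mu> = sets torus_borel"
  shows "(\<lambda>t. torus_rep (t - s)) \<in> \<mu> \<rightarrow>\<^sub>M torus_borel"
proof -
  have "(\<lambda>t. torus_rep (t - s)) \<in> borel \<rightarrow>\<^sub>M torus_borel" by measurable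
  then have "(\<lambda>t. torus_rep (t - s)) \<in> torus_borel \<rightarrow>\<^sub>M torus_borel"
    unfolding torus_borel_def by (rule measurable_restrict_space1)
  then show ?thesis by (subst measurable_cong_sets[OF assms refl])
qed

lemma continuous_measurable_torus:
  fixes g :: "real^'n \<Rightarrow> real"
  assumes "continuous_on UNIV g" shows "g \<in> borel_measurable torus_borel"
  unfolding torus_borel_def
  by (intro measurable_restrict_space1 borel_measurable_continuous_onI assms)

lemma finite_measure_eq_torus:
  fixes \<mu> \<nu> :: "(real^'n) measure"
  assumes fin: "finite_measure \<mu>" "finite_measure \<nu>"
    and sets: "sets \<mu> = sets torus_borel" "sets \<nu> = sets torus_borel"
    and eq: "\<And>g :: real^'n \<Rightarrow> real. continuous_on UNIV g \<Longrightarrow> periodic g \<Longrightarrow>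
               (LINT t|\<mu>. g t) = (LINT t|\<nu>. g t)"
  shows "\<mu> = \<nu>"
proof -
  let ?G = "{U \<inter> torus_cube |U. open U \<and> periodic (\<lambda>x :: real^'n. x \<in> U)}"
  have spc: "space \<mu> = torus_cube" "space \<nu> = torus_cube"
    using sets by (auto dest: sets_eq_imp_space_eq simp: space_torus_borel)
  have main: "emeasure \<mu> (U \<inter> torus_cube) = emeasure \<nu> (U \<inter> torus_cube)"
    if U: "open U" "periodic (\<lambda>x. x \<in> U)" for U
  proof (cases "U = UNIV")
    case True
    have "(LINT t|\<mu>. 1::real) = (LINT t|\<nu>. 1)" by (rule eq) (auto simp: periodic_def)
    then show ?thesis
      using True spc fin by (simp add: finite_measure.emeasure_eq_measure)
  next
    case False
    define h where "h n x = min 1 (real n * infdist x (- U))" for n x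
    have cont: "continuous_on UNIV (h n)" for n
      unfolding h_def by (intro continuous_intros)
    have per: "periodic (h n)" for n
    proof -
      have "infdist (x + k) (- U) = infdist x (- U)" if k: "k \<in> int_lattice" for x k :: "real^'n"
      proof -
        have "(\<lambda>y. y + k) ` (- U) = - U"
        proof (intro set_eqI iffI)
          fix y assume "y \<in> - U"
          moreover have "- k \<in> int_lattice" using k by (auto simp: int_lattice_def)
          ultimately have "y - k \<in> - U" using U(2)
            unfolding periodic_def by (metis ComplD ComplI diff_conv_add_uminus)
          then show "y \<in> (\<lambda>y. y + k) ` (- U)" by (intro image_eqI[of _ _ "y - k"]) auto
        qed (use U(2) k in \<open>auto simp: periodic_def\<close>)
        then have "infdist (x + k) (- U) = (INF y\<in>(\<lambda>y. y + k) ` (- U). dist (x + k) y)"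
          using False by (auto simp: infdist_def)
        also have "\<dots> = infdist x (- U)"
          using False by (auto simp: infdist_def image_image)
        finally show ?thesis .
      qed
      then show ?thesis by (simp add: periodic_def h_def)
    qed
    have lim: "(\<lambda>n. h n x) \<longlonglongrightarrow> indicator U x" for x
    proof (cases "x \<in> U")
      case True
      have "infdist x (- U) > 0"
        using True False U(1) by (intro infdist_pos_not_in_closed) auto
      then obtain n0 where n0: "1 < real n0 * infdist x (- U)"
        using reals_Archimedean3 by blast
      have "eventually (\<lambda>n. h n x = 1) sequentially"
        using eventually_ge_at_top[of n0]
      proof eventually_elim
        case (elim n)
        then have "real n0 * infdist x (- U) \<le> real n * infdist x (- U)"
          by (intro mult_right_mono) (auto simp: infdist_nonneg)
        then show ?case using n0 by (simp add: h_def)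
      qed
      then show ?thesis using True by (simp add: tendsto_eventually)
    qed (simp add: h_def)
    have conv: "(\<lambda>n. LINT t|M. h n t) \<longlonglongrightarrow> measure M (U \<inter> torus_cube)"
      if M: "finite_measure M" "sets M = sets torus_borel" "space M = torus_cube" for M
    proof -
      have "(\<lambda>n. LINT t|M. h n t) \<longlonglongrightarrow> (LINT t|M. indicator U t)"
      proof (rule integral_dominated_convergence)
        have "indicator U \<in> borel_measurable (torus_borel :: (real^'n) measure)"
          unfolding torus_borel_def using U(1) by (intro measurable_restrict_space1) simp
        then show "(indicator U :: _ \<Rightarrow> real) \<in> borel_measurable M"
          by (subst measurable_cong_sets[OF M(2) refl])
        show "h n \<in> borel_measurable M" for n
          using continuous_measurable_torus[OF cont] by (subst measurable_cong_sets[OF M(2) refl])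
        show "integrable M (\<lambda>_. 1 :: real)" by (simp add: finite_measure.integrable_const M(1))
        show "AE x in M. (\<lambda>n. h n x) \<longlonglongrightarrow> indicator U x" using lim by simp
        show "AE x in M. norm (h n x) \<le> 1" for n
          by (simp add: h_def infdist_nonneg abs_le_iff)
      qed
      also have "(LINT t|M. indicator U t) = measure M (U \<inter> torus_cube)"
        using M(3) by simp
      finally show ?thesis .
    qed
    have "(LINT t|\<mu>. h n t) = (LINT t|\<nu>. h n t)" for n by (rule eq[OF cont per])
    then have "measure \<mu> (U \<inter> torus_cube) = measure \<nu> (U \<inter> torus_cube)"
      using conv[OF fin(1) sets(1) spc(1)] conv[OF fin(2) sets(2) spc(2)]
      by (auto intro: LIMSEQ_unique)
    then show ?thesis using fin by (simp add: finite_measure.emeasure_eq_measure)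
  qed
  show ?thesis
  proof (rule measure_eqI_generator_eq[where A = "\<lambda>_. torus_cube"])
    show "Int_stable ?G"
    proof (rule Int_stableI)
      fix A B assume "A \<in> ?G" "B \<in> ?G"
      then obtain U V where "A = U \<inter> torus_cube" "B = V \<inter> torus_cube" "open U" "open V"
          "periodic (\<lambda>x. x \<in> U)" "periodic (\<lambda>x. x \<in> V)" by blast
      then show "A \<inter> B \<in> ?G"
        by (intro CollectI exI[of _ "U \<inter> V"]) (auto simp: periodic_def)
    qed
    show "?G \<subseteq> Pow torus_cube" by auto
    show "sets \<mu> = sigma_sets torus_cube ?G" "sets \<nu> = sigma_sets torus_cube ?G"
      using sets sets_torus_borel by auto
    show "range (\<lambda>_::nat. torus_cube) \<subseteq> ?G"
      by (auto intro!: exI[of _ UNIV] simp: periodic_def)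
    show "\<And>X. X \<in> ?G \<Longrightarrow> emeasure \<mu> X = emeasure \<nu> X" using main by blast
    show "(\<Union>i::nat. torus_cube) = torus_cube" by simp
    show "emeasure \<mu> torus_cube \<noteq> \<infinity>"
      using fin(1) by (simp add: finite_measure.emeasure_eq_measure)
  qed
qed

lemma torus_translate_iff:
  fixes \<mu> \<nu> :: "(real^'n) measure"
  assumes \<mu>: "prob_space \<mu>" "sets \<mu> = sets torus_borel"
    and \<nu>: "prob_space \<nu>" "sets \<nu> = sets torus_borel"
  shows "\<nu> = torus_translate s \<mu> \<longleftrightarrow>
    (\<forall>g :: real^'n \<Rightarrow> real. continuous_on UNIV g \<and> periodic g \<longrightarrow>
       (LINT t|\<nu>. g t) = (LINT t|\<mu>. g (t - s)))"
proof -
  have int: "(LINT t|torus_translate s \<mu>. g t) = (LINT t|\<mu>. g (t - s))"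
    if "continuous_on UNIV g" "periodic g" for g :: "real^'n \<Rightarrow> real"
    unfolding torus_translate_def
    using integral_distr[OF torus_translate_measurable[OF \<mu>(2)] continuous_measurable_torus[OF that(1)]]
    by (simp add: periodic_torus_rep[OF that(2)])
  have "prob_space (torus_translate s \<mu>)" unfolding torus_translate_def
    by (intro prob_space.prob_space_distr \<mu> torus_translate_measurable)
  moreover have "sets (torus_translate s \<mu>) = sets torus_borel"
    by (simp add: torus_translate_def)
  ultimately show ?thesis
    using int finite_measure_eq_torus[of \<nu> "torus_translate s \<mu>"] \<nu>
    by (auto simp: prob_space.finite_measure)
qed

lemma card_grid:
  assumes "M > 0" shows "card (grid M :: (real^'n) set) = M ^ CARD('n)"
proof -
  define I where "I = {m :: int. - real M / 2 \<le> of_int m \<and> of_int m < real M / 2}"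
  define f where "f k = (\<chi> i. real_of_int (k i) / real M)" for k :: "'n \<Rightarrow> int"
  have I: "I = {\<lceil>- real M / 2\<rceil>..<\<lceil>- real M / 2\<rceil> + int M}"
    unfolding I_def by (auto simp: ceiling_le_iff) linarith+
  have "bij_betw f (PiE UNIV (\<lambda>_. I)) (grid M)"
  proof (rule bij_betw_imageI)
    show "inj_on f (PiE UNIV (\<lambda>_. I))"
      using assms by (auto simp: inj_on_def f_def vec_eq_iff fun_eq_iff)
    show "f ` (PiE UNIV (\<lambda>_. I)) = grid M"
    proof (intro set_eqI iffI)
      fix x assume "x \<in> f ` (PiE UNIV (\<lambda>_. I))"
      then obtain k where "k \<in> PiE UNIV (\<lambda>_. I)" and xk: "x = f k" by blast
      then have k: "k i \<in> I" for i by auto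
      have "f k = (1 / real M) *\<^sub>R (\<chi> i. of_int (k i))"
        by (simp add: f_def vec_eq_iff)
      moreover have "(\<chi> i. of_int (k i)) \<in> int_lattice" by (simp add: int_lattice_def)
      moreover have "f k \<in> torus_cube"
        unfolding torus_cube_def
      proof (intro CollectI allI)
        fix i
        have "- real M / 2 \<le> of_int (k i)" "of_int (k i) < real M / 2"
          using k[of i] by (simp_all add: I_def)
        then show "- 1/2 \<le> f k $ i \<and> f k $ i < 1/2"
          using assms by (simp add: f_def field_simps)
      qed
      ultimately show "x \<in> grid M" using xk by (auto simp: grid_def)
    next
      fix x :: "real^'n" assume "x \<in> grid M"
      then obtain k where k: "k \<in> int_lattice" "x = (1 / real M) *\<^sub>R k" and x: "x \<in> torus_cube"
        by (auto simp: grid_def)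
      have fl: "of_int \<lfloor>k $ i\<rfloor> = k $ i" for i using k(1) by (simp add: int_lattice_def)
      have "x = f (\<lambda>i. \<lfloor>k $ i\<rfloor>)" unfolding k(2) by (simp only: f_def fl) (simp add: vec_eq_iff)
      moreover have "(\<lambda>i. \<lfloor>k $ i\<rfloor>) \<in> PiE UNIV (\<lambda>_. I)"
      proof -
        have "- 1/2 \<le> k $ i / real M \<and> k $ i / real M < 1/2" for i
          using x k(2) by (simp add: torus_cube_def)
        then have "- real M / 2 \<le> k $ i \<and> k $ i < real M / 2" for i
          using assms by (simp add: field_simps)
        then have "\<lfloor>k $ i\<rfloor> \<in> I" for i unfolding I_def mem_Collect_eq fl by blast
        then show ?thesis by auto
      qed
      ultimately show "x \<in> f ` (PiE UNIV (\<lambda>_. I))" by blast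
    qed
  qed
  then have "card (grid M :: (real^'n) set) = card (PiE (UNIV :: 'n set) (\<lambda>_. I))"
    by (metis bij_betw_same_card)
  also have "\<dots> = M ^ CARD('n)" by (simp add: card_PiE I)
  finally show ?thesis .
qed

end

theory Submission
  imports Defs
begin

text \<open>
  Write \<open>\<chi>\<close> for the periodic indicator of the ball (\<open>torus_ball r\<close>), \<open>F\<close> for its \<open>\<mu>\<close>-average
  \<open>F t = \<integral> \<chi> (u + t) d\<mu>(u)\<close> (\<open>mean_torus_ball\<close>), \<open>d\<close> for the dimension, \<open>N = M ^ d\<close> for the number of points and
  \<open>p\<close> for the volume of the ball. For fixed \<open>t\<close> the discrepancy is a sum of \<open>N\<close> independent
  variables with values in \<open>{0, 1}\<close> and means \<open>F (t - s)\<close>, \<open>s\<close> in the grid, shifted by the constant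
  \<open>N p\<close>. Its second moment is therefore the sum of the variances plus the square of the mean; after
  integration over \<open>t\<close>, where translation invariance makes all variances equal
  (\<open>gen_discrepancy_bias_variance\<close>), it becomes
  \<open>N \<integral> F (1 - F) + \<integral> (\<Sum>\<^sub>s F (t - s) - N p)\<^sup>2 dt\<close>.

  The lower bound comes from the first term alone. The integral of \<open>F (1 - F)\<close> is the average over
  independent \<open>u\<close>, \<open>u'\<close> of the measure of those \<open>t\<close> for which \<open>u + t\<close> lies in the ball and
  \<open>u' + t\<close> does not. This measure is positive as soon as \<open>u\<close> and \<open>u'\<close> are different points of the torus, so
  the average vanishes only if \<open>\<mu>\<close> is a point mass (\<open>mean_variance_pos\<close>).

  For the upper bound, Jensen's inequality reduces the second term to the case of a point mass, that is to the mean
  square of the number of grid points in a randomly shifted ball minus its expectation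
  (\<open>mean_bias_le\<close>). The trivial bound on this difference is of order \<open>M ^ (d - 1)\<close>, which is too weak when
  \<open>d > 2\<close>, so the curvature of the sphere has to be used. The Fourier coefficients of the
  grid discrepancy vanish except at the nonzero multiples \<open>M m\<close> of lattice vectors, where they are \<open>N\<close> times
  those of the ball (\<open>fourier_coeff_grid_discrepancy\<close>). The latter decay like
  \<open>|k| powr (-(d + 1)/2)\<close> (\<open>fourier_ball_decay\<close>), whence the mean square is at most a constant times
  \<open>N\<^sup>2 M powr (-(d + 1)) \<Sum>\<^sub>m |m| powr (-(d + 1))\<close>, which is at most a constant times \<open>N\<close>
  (\<open>grid_discrepancy_variance\<close>). Only the inequality "mean square at most the sum of the squared Fourier coefficients"
  is used; it follows from a Fejer kernel on the torus (\<open>torus_parseval_le\<close>).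
\<close>

section \<open>Oscillatory integrals with weights vanishing at the endpoints\<close>

lemma oscillatory_integration_by_parts:
  fixes f f' :: "real \<Rightarrow> real"
  assumes "a \<le> b" and "s > 0"
    and cf: "continuous_on {a..b} f" and cf': "continuous_on {a..b} f'"
    and deriv: "\<And>x. x \<in> {a<..<b} \<Longrightarrow> (f has_real_derivative f' x) (at x)"
  shows "norm (integral {a..b} (\<lambda>x. of_real (f x) * cis (s * x)))
    \<le> (\<bar>f a\<bar> + \<bar>f b\<bar> + norm (integral {a..b} (\<lambda>x. of_real (f' x) * cis (s * x)))) / s"
proof -
  let ?F = "\<lambda>x. of_real (f x) * cis (s * x)" and ?G = "\<lambda>x. of_real (f' x) * cis (s * x)"
  have cis_cont: "continuous_on S (\<lambda>x::real. cis (s * x))" for S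
    by (intro continuous_on_cis continuous_intros)
  have int: "?F integrable_on {a..b}" "?G integrable_on {a..b}"
    by (intro integrable_continuous_real continuous_on_mult continuous_on_of_real cf cf' cis_cont)+
  have "((\<lambda>x. ?G x + \<i> * s * ?F x) has_integral ?F b - ?F a) {a..b}"
  proof (rule fundamental_theorem_of_calculus_interior[OF \<open>a \<le> b\<close>])
    show "continuous_on {a..b} ?F"
      by (intro continuous_on_mult continuous_on_of_real cf cis_cont)
    fix x assume "x \<in> {a<..<b}"
    note d = deriv[OF this]
    have 1: "((\<lambda>x. of_real (f x) :: complex) has_vector_derivative of_real (f' x)) (at x)"
      using d by (intro has_vector_derivative_of_real) (simp add: has_real_derivative_iff_has_vector_derivative)
    have 2: "((\<lambda>x. cis (s * x)) has_vector_derivative (s *\<^sub>R (\<i> * cis (s * x)))) (at x)"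
    proof -
      have "((\<lambda>z. exp (\<i> * (of_real s * z))) has_field_derivative \<i> * s * exp (\<i> * (of_real s * of_real x)))
          (at (of_real x))"
        by (auto intro!: derivative_eq_intros)
      from has_vector_derivative_real_field[OF this] show ?thesis
        by (simp add: cis_conv_exp scaleR_conv_of_real mult_ac)
    qed
    show "(?F has_vector_derivative ?G x + \<i> * s * ?F x) (at x)"
      using has_vector_derivative_mult[OF 1 2] by (simp add: scaleR_conv_of_real algebra_simps)
  qed
  moreover have "((\<lambda>x. ?G x + \<i> * s * ?F x) has_integral
      integral {a..b} ?G + \<i> * s * integral {a..b} ?F) {a..b}"
    by (intro has_integral_add has_integral_mult_right integrable_integral int)
  ultimately have "integral {a..b} ?G + \<i> * s * integral {a..b} ?F = ?F b - ?F a"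
    by (rule has_integral_unique[symmetric])
  then have "\<i> * s * integral {a..b} ?F = ?F b - ?F a - integral {a..b} ?G"
    by (simp add: algebra_simps)
  then have "norm (\<i> * s * integral {a..b} ?F) = norm (?F b - ?F a - integral {a..b} ?G)"
    by simp
  also have "\<dots> \<le> norm (?F b) + norm (?F a) + norm (integral {a..b} ?G)"
    by (meson add_mono norm_triangle_ineq4 order_refl order_trans)
  finally have "s * norm (integral {a..b} ?F) \<le> \<bar>f a\<bar> + \<bar>f b\<bar> + norm (integral {a..b} ?G)"
    using \<open>s > 0\<close> by (simp add: norm_mult)
  then show ?thesis using \<open>s > 0\<close> by (simp add: field_simps)
qed

lemma norm_oscillatory_integral_le:
  fixes f :: "real \<Rightarrow> real"
  assumes "a \<le> b" "continuous_on {a..b} f" "\<And>x. x \<in> {a..b} \<Longrightarrow> \<bar>f x\<bar> \<le> B"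
  shows "norm (integral {a..b} (\<lambda>x. of_real (f x) * cis (s * x))) \<le> B * (b - a)"
proof (rule integral_bound[OF \<open>a \<le> b\<close>])
  show "continuous_on {a..b} (\<lambda>x. of_real (f x) * cis (s * x))"
    by (intro continuous_on_mult continuous_on_of_real assms continuous_on_cis continuous_intros)
qed (use assms(3) in \<open>auto simp: norm_mult\<close>)

lemma poly_bounded_Icc:
  fixes u :: "real poly"
  obtains A where "A \<ge> 0" "\<And>x. x \<in> {-1..1} \<Longrightarrow> \<bar>poly u x\<bar> \<le> A"
proof -
  have "compact ((\<lambda>x. poly u x) ` {-1..1})"
    by (intro compact_continuous_image continuous_intros) auto
  then obtain A where A: "\<forall>y \<in> (\<lambda>x. poly u x) ` {-1..1}. norm y \<le> A"
    using compact_imp_bounded bounded_iff by metis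
  show thesis by (rule that[of "max A 0"]) (use A in \<open>auto simp: le_max_iff_disj\<close>)
qed

lemma sqrt_one_minus_sq_deriv:
  fixes x :: real assumes "x\<^sup>2 < 1"
  shows "((\<lambda>x. sqrt (1 - x\<^sup>2)) has_real_derivative - x / sqrt (1 - x\<^sup>2)) (at x)"
  using assms by (auto intro!: derivative_eq_intros simp: divide_simps)

text \<open>
  The integrand vanishes like a square root at both ends, so one integration by parts is
  harmless but a second one meets a singularity. Cutting off an interval of length \<open>1/s\<close> at each end
  balances the two effects: on the pieces cut off the integrand is of size \<open>s powr (-1/2)\<close>, and in
  the middle two integrations by parts are possible, where the first derivative at the cuts and the
  integral of the second derivative are of order \<open>sqrt s\<close>.
\<close>

lemma semicircle_oscillation:
  fixes u :: "real poly"
  shows "\<exists>C. \<forall>s\<ge>2. norm (integral {-1..1} (\<lambda>x. of_real (poly u x * sqrt (1 - x\<^sup>2)) * cis (s * x)))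
     \<le> C / (s * sqrt s)"
proof -
  obtain A0 where A0: "A0 \<ge> 0" "\<And>x. x \<in> {-1..1} \<Longrightarrow> \<bar>poly u x\<bar> \<le> A0"
    using poly_bounded_Icc[of u] by blast
  obtain A1 where A1: "A1 \<ge> 0" "\<And>x. x \<in> {-1..1} \<Longrightarrow> \<bar>poly (pderiv u) x\<bar> \<le> A1"
    using poly_bounded_Icc[of "pderiv u"] by blast
  obtain A2 where A2: "A2 \<ge> 0" "\<And>x. x \<in> {-1..1} \<Longrightarrow> \<bar>poly (pderiv (pderiv u)) x\<bar> \<le> A2"
    using poly_bounded_Icc[of "pderiv (pderiv u)"] by blast
  define w where "w x = sqrt (1 - x\<^sup>2)" for x :: real
  define f where "f x = poly u x * w x" for x
  define f1 where "f1 x = poly (pderiv u) x * w x - poly u x * x / w x" for x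
  define f2 where "f2 x = poly (pderiv (pderiv u)) x * w x - 2 * poly (pderiv u) x * x / w x
    - poly u x / w x ^ 3" for x
  define C where "C = 6 * A0 * sqrt 2 + 2 * (A0 + A1) + (2 * A2 + 4 * A1 + 2 * A0)"
  have main: "norm (integral {-1..1} (\<lambda>x. of_real (f x) * cis (s * x))) \<le> C / (s * sqrt s)"
    if s: "s \<ge> 2" for s
  proof -
    let ?I = "\<lambda>f a b. integral {a..b} (\<lambda>x. of_real (f x) * cis (s * x))"
    \<comment> \<open>The cut: \<open>w\<close> is of order \<open>1 / sqrt s\<close> at \<open>c\<close>.\<close>
    define c where "c = 1 - 1 / s"
    have c: "1/2 \<le> c" "c < 1" using s by (auto simp: c_def field_simps)
    have sq: "sqrt s \<ge> 1" using s by simp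
    have wc: "x\<^sup>2 < 1" "1 / w x \<le> sqrt s" "0 < w x" if "x \<in> {-c..c}" for x
    proof -
      have "\<bar>x\<bar> \<le> c" using that by auto
      then have "x\<^sup>2 \<le> c\<^sup>2" by (metis abs_ge_zero power2_abs power_mono)
      also have "c\<^sup>2 \<le> c" using c by (simp add: power2_eq_square)
      finally have *: "x\<^sup>2 \<le> 1 - 1 / s" by (simp add: c_def)
      have "0 < 1 / s" using s by simp
      with * show "x\<^sup>2 < 1" by linarith
      have "sqrt (1 / s) \<le> w x" unfolding w_def using * by (intro real_sqrt_le_mono) linarith
      then have w: "1 / sqrt s \<le> w x" by (simp add: real_sqrt_divide)
      moreover have "0 < 1 / sqrt s" using s by simp
      ultimately show w0: "0 < w x" by linarith
      show "1 / w x \<le> sqrt s" using w w0 s by (simp add: field_simps)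
    qed
    have w1: "w x \<le> 1" "0 \<le> w x" if "x \<in> {-1..1}" for x
      using that abs_square_le_1[of x] by (auto simp: w_def)
    have wtail: "w x \<le> sqrt 2 / sqrt s" if "x \<in> {-1..1}" "\<bar>x\<bar> \<ge> c" for x
    proof -
      have "1 - x\<^sup>2 = (1 - \<bar>x\<bar>) * (1 + \<bar>x\<bar>)" by (simp add: algebra_simps power2_eq_square)
      also have "\<dots> \<le> (1 / s) * 2"
        using that s by (intro mult_mono) (auto simp: c_def)
      finally have "w x \<le> sqrt (2 / s)" unfolding w_def by (intro real_sqrt_le_mono) simp
      then show ?thesis by (simp add: real_sqrt_divide)
    qed
    have ftail: "\<bar>f x\<bar> \<le> A0 * (sqrt 2 / sqrt s)" if "x \<in> {-1..1}" "\<bar>x\<bar> \<ge> c" for x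
      unfolding f_def abs_mult using that w1[of x] A0 by (intro mult_mono A0 order.trans[OF _ wtail]) auto
    have cont_f: "continuous_on S f" for S
      unfolding f_def w_def by (intro continuous_intros)
    have tail: "norm (?I f a b) \<le> A0 * sqrt 2 / (s * sqrt s)"
      if "a = -1 \<and> b = -c \<or> a = c \<and> b = 1" for a b
    proof -
      have "norm (?I f a b) \<le> A0 * (sqrt 2 / sqrt s) * (b - a)"
        using that c by (intro norm_oscillatory_integral_le cont_f ftail) auto
      also have "b - a = 1 / s" using that by (auto simp: c_def)
      finally show ?thesis by (simp add: field_simps)
    qed
    have int: "(\<lambda>x. of_real (f x) * cis (s * x)) integrable_on {a..b}" for a b
      by (intro integrable_continuous_real continuous_on_mult continuous_on_of_real cont_f
          continuous_on_cis continuous_intros)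
    have split: "?I f (-1) 1 = ?I f (-1) (-c) + (?I f (-c) c + ?I f c 1)"
      using c by (simp add: Henstock_Kurzweil_Integration.integral_combine int)
    have wd: "(w has_real_derivative - x / w x) (at x)" if "x \<in> {-c..c}" for x
      using sqrt_one_minus_sq_deriv[OF wc(1)[OF that]] by (simp add: w_def[abs_def])
    have contw: "continuous_on {-c..c} w" unfolding w_def by (intro continuous_intros)
    have wne: "\<forall>x\<in>{-c..c}. w x \<noteq> 0" using wc(3) by fastforce
    have cont1: "continuous_on {-c..c} f1" unfolding f1_def
      by (intro continuous_intros contw) (use wne in auto)
    have cont2: "continuous_on {-c..c} f2" unfolding f2_def
      by (intro continuous_intros contw) (use wne in auto)
    have d1: "(f has_real_derivative f1 x) (at x)" if "x \<in> {-c..c}" for x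
      unfolding f_def f1_def by (rule derivative_eq_intros wd that poly_DERIV refl)+ simp
    have w2: "(w x)\<^sup>2 = 1 - x\<^sup>2" if "x \<in> {-c..c}" for x
      using wc(1)[OF that] by (simp add: w_def)
    have dxw: "((\<lambda>x. x / w x) has_real_derivative 1 / w x ^ 3) (at x)" if "x \<in> {-c..c}" for x
    proof -
      have "((\<lambda>x. x / w x) has_real_derivative (1 * w x - x * (- x / w x)) / (w x * w x)) (at x)"
        using wc(3)[OF that] by (intro derivative_intros wd that) auto
      moreover have "(1 * w x - x * (- x / w x)) / (w x * w x) = ((w x)\<^sup>2 + x\<^sup>2) / w x ^ 3"
        using wc(3)[OF that] by (simp add: field_simps power2_eq_square power3_eq_cube)
      ultimately show ?thesis using w2[OF that] by simp
    qed
    have d2: "(f1 has_real_derivative f2 x) (at x)" if "x \<in> {-c..c}" for x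
    proof -
      have "((\<lambda>x. poly (pderiv u) x * w x - poly u x * (x / w x)) has_real_derivative
        (poly (pderiv (pderiv u)) x * w x + (- x / w x) * poly (pderiv u) x)
        - (poly (pderiv u) x * (x / w x) + (1 / w x ^ 3) * poly u x)) (at x)"
        by (intro DERIV_diff DERIV_mult poly_DERIV wd dxw that)
      then show ?thesis unfolding f1_def[abs_def] f2_def by (simp add: algebra_simps)
    qed
    have f1c: "\<bar>f1 x\<bar> \<le> (A0 + A1) * sqrt s" if x: "x \<in> {-c..c}" for x
    proof -
      have x1: "x \<in> {-1..1}" using x c by auto
      have "\<bar>f1 x\<bar> \<le> \<bar>poly (pderiv u) x\<bar> * w x + \<bar>poly u x\<bar> * \<bar>x\<bar> * (1 / w x)"
        unfolding f1_def by (rule order.trans[OF abs_triangle_ineq4]) (use wc(3)[OF x] in \<open>simp add: abs_mult\<close>)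
      also have "\<dots> \<le> A1 * sqrt s + A0 * 1 * sqrt s"
        using x1 wc(2,3)[OF x] order.trans[OF w1(1)[OF x1] sq] A0(1) A1(1) A0(2)[OF x1] A1(2)[OF x1] abs_le_iff[of x 1] by (intro add_mono mult_mono) simp_all
      finally show ?thesis by (simp add: algebra_simps)
    qed
    \<comment> \<open>The only unbounded term of \<open>f2\<close> has an explicit antiderivative, so its integral is of order \<open>sqrt s\<close>
      and not of the order \<open>s powr (3/2)\<close> of its maximum.\<close>
    have int3: "((\<lambda>x. 1 / w x ^ 3) has_integral (c / w c - (-c) / w (-c))) {-c..c}"
      using c dxw by (intro fundamental_theorem_of_calculus)
        (auto simp: has_real_derivative_iff_has_vector_derivative[symmetric] has_field_derivative_at_within)
    have cw: "c / w c - (-c) / w (-c) \<le> 2 * sqrt s"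
    proof -
      have "c * (1 / w c) \<le> 1 * sqrt s" using c wc[of c] by (intro mult_mono) auto
      then show ?thesis by (simp add: w_def)
    qed
    have cw0: "0 \<le> c / w c - (-c) / w (-c)"
      using c less_imp_le[OF wc(3)[of c]] less_imp_le[OF wc(3)[of "-c"]] by simp
    have I2: "norm (?I f2 (-c) c) \<le> (2 * A2 + 4 * A1 + 2 * A0) * sqrt s"
    proof -
      let ?g = "\<lambda>x. (A2 + 2 * A1 * sqrt s) + A0 * (1 / w x ^ 3)"
      have gi: "(?g has_integral ((A2 + 2 * A1 * sqrt s) * (c - (-c)) + A0 * (c / w c - (-c) / w (-c)))) {-c..c}"
        using c has_integral_const_real[of "A2 + 2 * A1 * sqrt s" "-c" c]
        by (intro has_integral_add has_integral_mult_right int3) (simp add: mult.commute)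
      have "norm (?I f2 (-c) c) \<le> integral {-c..c} ?g"
      proof (rule integral_norm_bound_integral)
        show "(\<lambda>x. complex_of_real (f2 x) * cis (s * x)) integrable_on {- c..c}"
          by (intro integrable_continuous_real continuous_on_mult continuous_on_of_real cont2
            continuous_on_cis continuous_intros)
        show "?g integrable_on {-c..c}" using gi by blast
        fix x assume x: "x \<in> {-c..c}"
        have x1: "x \<in> {-1..1}" using x c by auto
        have "\<bar>f2 x\<bar> \<le> \<bar>poly (pderiv (pderiv u)) x\<bar> * w x + 2 * \<bar>poly (pderiv u) x\<bar> * \<bar>x\<bar> * (1 / w x)
            + \<bar>poly u x\<bar> * (1 / w x ^ 3)"
          unfolding f2_def using wc(3)[OF x]
          by (intro order.trans[OF abs_triangle_ineq4] add_mono) (auto simp: abs_mult)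
        also have "\<dots> \<le> A2 * 1 + 2 * A1 * 1 * sqrt s + A0 * (1 / w x ^ 3)"
          using x1 wc[OF x] w1[OF x1] sq A0 A1 A2 by (intro add_mono mult_mono) auto
        finally show "norm (of_real (f2 x) * cis (s * x)) \<le> ?g x" by (simp add: norm_mult)
      qed
      also have "\<dots> = (A2 + 2 * A1 * sqrt s) * (2 * c) + A0 * (c / w c - (-c) / w (-c))"
        using gi by (simp add: integral_unique)
      also have "\<dots> \<le> (A2 * sqrt s + 2 * A1 * sqrt s) * 2 + A0 * (2 * sqrt s)"
        using cw cw0 c A0 A1 A2 sq by (intro add_mono mult_mono) (auto simp: mult_le_cancel_left1)
      finally show ?thesis by (simp add: algebra_simps)
    qed
    have I1: "norm (?I f1 (-c) c) \<le> (2 * (A0 + A1) + (2 * A2 + 4 * A1 + 2 * A0)) / sqrt s"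
    proof -
      have "norm (?I f1 (-c) c) \<le> (\<bar>f1 (-c)\<bar> + \<bar>f1 c\<bar> + norm (?I f2 (-c) c)) / s"
        using c s d2 by (intro oscillatory_integration_by_parts cont1 cont2) auto
      also have "\<dots> \<le> ((A0 + A1) * sqrt s + (A0 + A1) * sqrt s + (2 * A2 + 4 * A1 + 2 * A0) * sqrt s) / s"
        using f1c[of c] f1c[of "-c"] I2 c s by (intro divide_right_mono add_mono) auto
      also have "\<dots> = (2 * (A0 + A1) + (2 * A2 + 4 * A1 + 2 * A0)) * (sqrt s / s)"
        by (simp add: algebra_simps add_divide_distrib)
      also have "sqrt s / s = 1 / sqrt s" using s by (simp add: real_div_sqrt field_simps)
      finally show ?thesis by simp
    qed
    have I0: "norm (?I f (-c) c) \<le> (4 * A0 * sqrt 2 + (2 * (A0 + A1) + (2 * A2 + 4 * A1 + 2 * A0))) / (s * sqrt s)"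
    proof -
      have "norm (?I f (-c) c) \<le> (\<bar>f (-c)\<bar> + \<bar>f c\<bar> + norm (?I f1 (-c) c)) / s"
        using c s d1 by (intro oscillatory_integration_by_parts cont1 cont_f) auto
      also have "\<dots> \<le> (A0 * (sqrt 2 / sqrt s) + A0 * (sqrt 2 / sqrt s) +
           (2 * (A0 + A1) + (2 * A2 + 4 * A1 + 2 * A0)) / sqrt s) / s"
        using ftail[of c] ftail[of "-c"] I1 c s by (intro divide_right_mono add_mono) auto
      also have "\<dots> = (2 * A0 * sqrt 2 + (2 * (A0 + A1) + (2 * A2 + 4 * A1 + 2 * A0))) / (s * sqrt s)"
        using s by (simp add: divide_simps)
      also have "\<dots> \<le> (4 * A0 * sqrt 2 + (2 * (A0 + A1) + (2 * A2 + 4 * A1 + 2 * A0))) / (s * sqrt s)"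
        using s A0 by (intro divide_right_mono add_right_mono mult_right_mono) auto
      finally show ?thesis .
    qed
    have "norm (?I f (-1) 1) \<le> A0 * sqrt 2 / (s * sqrt s) +
        ((4 * A0 * sqrt 2 + (2 * (A0 + A1) + (2 * A2 + 4 * A1 + 2 * A0))) / (s * sqrt s)
         + A0 * sqrt 2 / (s * sqrt s))"
      unfolding split by (intro norm_triangle_mono tail I0) auto
    also have "\<dots> = C / (s * sqrt s)"
      unfolding C_def by (simp add: add_divide_distrib[symmetric] algebra_simps)
    finally show ?thesis .
  qed
  then show ?thesis unfolding f_def w_def by blast
qed

text \<open>
  Integrating by parts with the weight \<open>sqrt (1 - x\<^sup>2) ^ (n + 2)\<close> gains a factor \<open>1/s\<close>, loses two
  powers of the weight, and turns the polynomial factor into another polynomial. Quantifying over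
  all polynomials therefore makes an induction in steps of two possible, starting from the exponents
  0 and 1. For small \<open>s\<close> the trivial bound suffices, since the right-hand side decreases in \<open>s\<close>.
\<close>

proposition ball_section_oscillation:
  fixes u :: "real poly"
  shows "\<exists>C. \<forall>s>0. norm (integral {-1..1} (\<lambda>x. of_real (poly u x * sqrt (1 - x\<^sup>2) ^ n) * cis (s * x)))
     \<le> C * s powr (- (real n / 2 + 1))"
proof -
  let ?I = "\<lambda>n u s. norm (integral {-1..1} (\<lambda>x. of_real (poly u x * sqrt (1 - x\<^sup>2) ^ n) * cis (s * x)))"
  let ?g = "\<lambda>n (s::real). s powr (- (real n / 2 + 1))"
  have w: "sqrt (1 - x\<^sup>2) \<le> 1" "0 \<le> sqrt (1 - x\<^sup>2)" if "x \<in> {-1..1}" for x :: real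
    using that abs_square_le_1[of x] by auto
  have cont: "continuous_on S (\<lambda>x. poly u x * sqrt (1 - x\<^sup>2) ^ n)" for u n and S :: "real set"
    by (intro continuous_intros)
  have small: "\<exists>C. \<forall>s>0. ?I n u s \<le> C * ?g n s" if large: "\<exists>C. \<forall>s\<ge>2. ?I n u s \<le> C * ?g n s" for n u
  proof -
    from large obtain C where C: "\<And>s. s \<ge> 2 \<Longrightarrow> ?I n u s \<le> C * ?g n s" by blast
    obtain A where A: "A \<ge> 0" "\<And>x. x \<in> {-1..1} \<Longrightarrow> \<bar>poly u x\<bar> \<le> A"
      using poly_bounded_Icc[of u] by blast
    have "?I n u s \<le> max C (2 * A / ?g n 2) * ?g n s" if "s > 0" for s
    proof (cases "s \<ge> 2")
      case True
      then show ?thesis by (intro order.trans[OF C] mult_right_mono) auto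
    next
      case False
      have "?I n u s \<le> A * (1 - (-1))"
      proof (intro norm_oscillatory_integral_le cont)
        fix x :: real assume x: "x \<in> {-1..1}"
        have "\<bar>poly u x * sqrt (1 - x\<^sup>2) ^ n\<bar> \<le> A * 1"
          unfolding abs_mult using w[OF x] A x by (intro mult_mono) (auto simp: power_le_one)
        then show "\<bar>poly u x * sqrt (1 - x\<^sup>2) ^ n\<bar> \<le> A" by simp
      qed simp
      also have "\<dots> = 2 * A / ?g n 2 * ?g n 2" by simp
      also have "\<dots> \<le> 2 * A / ?g n 2 * ?g n s"
        using False that A by (intro mult_left_mono powr_mono2') auto
      also have "\<dots> \<le> max C (2 * A / ?g n 2) * ?g n s" by (intro mult_right_mono) auto
      finally show ?thesis .
    qed
    then show ?thesis by blast
  qed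
  have "\<forall>u. \<exists>C. \<forall>s>0. ?I n u s \<le> C * ?g n s"
  proof (induction n rule: nat_induct2)
    case 0
    show ?case
    proof
      fix u :: "real poly"
      obtain A where A: "A \<ge> 0" "\<And>x. x \<in> {-1..1} \<Longrightarrow> \<bar>poly (pderiv u) x\<bar> \<le> A"
        using poly_bounded_Icc[of "pderiv u"] by blast
      have "?I 0 u s \<le> (\<bar>poly u (-1)\<bar> + \<bar>poly u 1\<bar> + 2 * A) * ?g 0 s" if s: "s > 0" for s
      proof -
        have "?I 0 u s \<le> (\<bar>poly u (-1)\<bar> + \<bar>poly u 1\<bar> +
           norm (integral {-1..1} (\<lambda>x. of_real (poly (pderiv u) x) * cis (s * x)))) / s"
          using oscillatory_integration_by_parts[OF _ s continuous_on_poly[OF continuous_on_id] continuous_on_poly[OF continuous_on_id]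
              poly_DERIV, of "-1" 1 u] by simp
        also have "\<dots> \<le> (\<bar>poly u (-1)\<bar> + \<bar>poly u 1\<bar> + A * (1 - (-1))) / s"
          using s A by (intro divide_right_mono add_left_mono norm_oscillatory_integral_le continuous_intros) auto
        also have "\<dots> = (\<bar>poly u (-1)\<bar> + \<bar>poly u 1\<bar> + 2 * A) * ?g 0 s"
        proof -
          have "?g 0 s = 1 / s" using s by (simp add: powr_minus_divide)
          then show ?thesis by simp
        qed
        finally show ?thesis .
      qed
      then show "\<exists>C. \<forall>s>0. ?I 0 u s \<le> C * ?g 0 s" by blast
    qed
  next
    case 1
    show ?case
    proof (intro allI small)
      fix u :: "real poly"
      obtain C where C: "\<And>s. s \<ge> 2 \<Longrightarrow> ?I 1 u s \<le> C / (s * sqrt s)"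
        using semicircle_oscillation[of u] by auto
      have eq: "C / (s * sqrt s) = C * ?g 1 s" if "s \<ge> 2" for s
      proof -
        have "s * sqrt s = s powr (1 + 1/2)"
          using that by (subst powr_add) (simp add: powr_half_sqrt)
        moreover have "?g 1 s = 1 / s powr (1 + 1/2)"
          using powr_minus_divide[of s "1 + 1/2"] by (simp add: add.commute)
        ultimately show ?thesis by simp
      qed
      have "?I 1 u s \<le> C * ?g 1 s" if "s \<ge> 2" for s
        using C[OF that] unfolding eq[OF that] .
      then show "\<exists>C. \<forall>s\<ge>2. ?I 1 u s \<le> C * ?g 1 s" by blast
    qed
  next
    case (step n)
    show ?case
    proof
      fix u :: "real poly"
      \<comment> \<open>The polynomial factor of the derivative of \<open>u\<close> times the weight with exponent \<open>n + 2\<close>.\<close>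
      define v where "v = pderiv u * [:1, 0, -1:] - smult (real n + 2) ([:0, 1:] * u)"
      obtain C where C: "\<And>s. s > 0 \<Longrightarrow> ?I n v s \<le> C * ?g n s" using step by blast
      have "?I (n + 2) u s \<le> C * ?g (n + 2) s" if s: "s > 0" for s
      proof -
        have "?I (n + 2) u s \<le> (\<bar>poly u (-1) * sqrt (1 - (-1)\<^sup>2) ^ (n+2)\<bar> + \<bar>poly u 1 * sqrt (1 - 1\<^sup>2) ^ (n+2)\<bar>
            + ?I n v s) / s"
        proof (rule oscillatory_integration_by_parts[OF _ s cont cont])
          fix x :: real assume x: "x \<in> {-1<..<1}"
          then have x2: "x\<^sup>2 < 1" by (simp add: abs_square_less_1 abs_less_iff)
          let ?w = "sqrt (1 - x\<^sup>2)"
          have "((\<lambda>x. poly u x * sqrt (1 - x\<^sup>2) ^ (n + 2)) has_real_derivative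
             poly (pderiv u) x * ?w ^ (n + 2) + (real (n + 2) * (?w ^ (n + 2 - 1) * (- x / ?w))) * poly u x) (at x)"
            by (rule derivative_eq_intros sqrt_one_minus_sq_deriv x2 refl poly_DERIV)+ simp
          moreover have e1: "?w ^ (n + 2 - 1) * (- x / ?w) = - x * ?w ^ n" using x2 by simp
          have e2: "?w ^ (n + 2) = (1 - x\<^sup>2) * ?w ^ n" using x2 by (simp add: power_add)
          have "poly (pderiv u) x * ?w ^ (n + 2) + (real (n + 2) * (?w ^ (n + 2 - 1) * (- x / ?w))) * poly u x
              = poly v x * ?w ^ n"
            unfolding e1 e2 by (simp add: v_def algebra_simps power2_eq_square)
          ultimately show "((\<lambda>x. poly u x * sqrt (1 - x\<^sup>2) ^ (n + 2)) has_real_derivative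
             poly v x * ?w ^ n) (at x)" by simp
        qed simp
        also have "\<dots> \<le> C * (?g n s / s)" using s C[OF s] by (simp add: divide_right_mono)
        also have "?g n s / s = ?g (n + 2) s"
        proof -
          have "- (real (n + 2) / 2 + 1) = - (real n / 2 + 1) + (-1)" by (simp add: field_simps)
          then have "?g (n + 2) s = s powr (- (real n / 2 + 1) + (-1))" by (simp only:)
          then show ?thesis using s by (subst (asm) powr_add) (simp add: powr_minus_divide)
        qed
        finally show ?thesis .
      qed
      then show "\<exists>C. \<forall>s>0. ?I (n + 2) u s \<le> C * ?g (n + 2) s" by blast
    qed
  qed
  then show ?thesis by blast
qed

section \<open>Decay of the Fourier transform of a ball\<close>

text \<open>
  Uniqueness of Haar measure: by invariance of both measures and Fubini, the product of the
  measures of \<open>A\<close> and of a fixed set \<open>E\<close> is the same whichever of the two measures is applied to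
  which set; the normalisation on \<open>E\<close> then cancels.
\<close>

lemma translation_invariant_eq_lborel:
  fixes M :: "'a::euclidean_space measure"
  assumes sets: "sets M = sets borel" and fin: "sigma_finite_measure M"
    and inv: "\<And>a. distr M borel (\<lambda>x. x + a) = M"
    and ball: "emeasure M (ball 0 1) = emeasure lborel (ball (0::'a) 1)"
  shows "M = lborel"
proof (rule measure_eqI)
  show "sets M = sets lborel" using sets by simp
next
  fix A assume "A \<in> sets M"
  then have A[measurable]: "A \<in> sets borel" using sets by simp
  interpret M: sigma_finite_measure M by fact
  interpret P: pair_sigma_finite M lborel by unfold_locales
  note [measurable_cong] = sets
  let ?E = "ball (0::'a) 1"
  have [measurable]: "?E \<in> sets borel" by simp
  let ?i = "\<lambda>A x. indicator A x :: ennreal"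
  have inv_M: "(\<integral>\<^sup>+x. f (x + a) \<partial>M) = (\<integral>\<^sup>+x. f x \<partial>M)" if [measurable]: "f \<in> borel_measurable borel"
    for f :: "'a \<Rightarrow> ennreal" and a
    by (subst (2) inv[of a, symmetric]) (subst nn_integral_distr, auto)
  have inv_L: "(\<integral>\<^sup>+x. f (x + a) \<partial>lborel) = (\<integral>\<^sup>+x. f x \<partial>lborel)" if [measurable]: "f \<in> borel_measurable borel"
    for f :: "'a \<Rightarrow> ennreal" and a
    by (subst (2) lborel_distr_plus[of a, symmetric]) (subst nn_integral_distr, auto simp: add.commute)
  have refl_L: "(\<integral>\<^sup>+y. f (x - y) \<partial>lborel) = (\<integral>\<^sup>+x. f x \<partial>lborel)" if [measurable]: "f \<in> borel_measurable borel"
    for f :: "'a \<Rightarrow> ennreal" and x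
    by (subst (2) lborel_affine[of "-1" x]) (auto simp: density_1 nn_integral_distr)
  have "emeasure M A * emeasure lborel ?E = (\<integral>\<^sup>+x. ?i A x * (\<integral>\<^sup>+y. ?i ?E y \<partial>lborel) \<partial>M)"
    by (simp add: nn_integral_multc sets)
  also have "\<dots> = (\<integral>\<^sup>+x. ?i A x * (\<integral>\<^sup>+y. ?i ?E (y + x) \<partial>lborel) \<partial>M)"
    by (subst inv_L) auto
  also have "\<dots> = (\<integral>\<^sup>+x. \<integral>\<^sup>+y. ?i A x * ?i ?E (y + x) \<partial>lborel \<partial>M)"
    by (intro nn_integral_cong nn_integral_cmult[symmetric]) measurable
  also have "\<dots> = (\<integral>\<^sup>+y. \<integral>\<^sup>+x. ?i A x * ?i ?E (y + x) \<partial>M \<partial>lborel)"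
    by (rule P.Fubini'[symmetric]) measurable
  also have "\<dots> = (\<integral>\<^sup>+y. \<integral>\<^sup>+x. ?i A (x - y) * ?i ?E x \<partial>M \<partial>lborel)"
  proof (rule nn_integral_cong)
    fix y
    show "(\<integral>\<^sup>+x. ?i A x * ?i ?E (y + x) \<partial>M) = (\<integral>\<^sup>+x. ?i A (x - y) * ?i ?E x \<partial>M)"
      using inv_M[of "\<lambda>x. ?i A (x - y) * ?i ?E x" y] by (simp add: add.commute)
  qed
  also have "\<dots> = (\<integral>\<^sup>+x. \<integral>\<^sup>+y. ?i A (x - y) * ?i ?E x \<partial>lborel \<partial>M)"
    by (rule P.Fubini') measurable
  also have "\<dots> = (\<integral>\<^sup>+x. emeasure lborel A * ?i ?E x \<partial>M)"
    by (intro nn_integral_cong) (simp add: nn_integral_multc refl_L[of "?i A"])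
  also have "\<dots> = emeasure lborel A * emeasure lborel ?E"
    by (simp add: nn_integral_cmult sets ball)
  finally have "emeasure lborel ?E * emeasure M A = emeasure lborel ?E * emeasure lborel A"
    by (simp add: mult.commute)
  moreover have "emeasure lborel ?E \<noteq> 0" "emeasure lborel ?E \<noteq> \<top>"
    by (auto simp: emeasure_ball ennreal_eq_0_iff not_le)
  ultimately show "emeasure M A = emeasure lborel A" by (simp add: ennreal_mult_cancel_left)
qed

text \<open>
  The image measure is translation invariant because the map is linear and onto, and the unit ball is its
  own preimage.
\<close>

lemma lborel_distr_orthogonal:
  fixes T :: "'a::euclidean_space \<Rightarrow> 'a"
  assumes T: "orthogonal_transformation T"
  shows "distr lborel borel T = lborel"
proof (rule translation_invariant_eq_lborel)
  have lin: "linear T" using T by (rule orthogonal_transformation_linear)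
  have cont: "continuous_on UNIV T"
    using linear_continuous_on[of T] lin by (simp add: linear_conv_bounded_linear)
  then have meas[measurable]: "T \<in> borel_measurable borel" by (rule borel_measurable_continuous_onI)
  have pre: "T -` ball 0 c = ball 0 c" for c
    by (auto simp: orthogonal_transformation_norm[OF T])
  show "emeasure (distr lborel borel T) (ball 0 1) = emeasure lborel (ball (0::'a) 1)"
    by (subst emeasure_distr) (auto simp: pre)
  show "sigma_finite_measure (distr lborel borel T)"
  proof
    show "\<exists>A. countable A \<and> A \<subseteq> sets (distr lborel borel T) \<and> \<Union> A = space (distr lborel borel T) \<and>
      (\<forall>a\<in>A. emeasure (distr lborel borel T) a \<noteq> \<infinity>)"
    proof (intro exI conjI ballI)
      show "countable (range (\<lambda>n. ball (0::'a) (real n)))" by simp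
      show "\<Union> (range (\<lambda>n. ball (0::'a) (real n))) = space (distr lborel borel T)"
        by (auto simp: reals_Archimedean2)
      fix a assume "a \<in> range (\<lambda>n. ball (0::'a) (real n))"
      then show "emeasure (distr lborel borel T) a \<noteq> \<infinity>"
        by (auto simp: emeasure_distr pre emeasure_ball)
    qed auto
  qed
  fix a
  obtain b where b: "T b = a" using orthogonal_transformation_surj[OF T] by (metis surjD)
  have "distr (distr lborel borel T) borel (\<lambda>x. x + a) = distr lborel borel (\<lambda>x. T x + a)"
    by (simp add: distr_distr o_def)
  also have "(\<lambda>x. T x + a) = T \<circ> (\<lambda>x. b + x)" using b lin by (auto simp: linear_add fun_eq_iff)
  also have "distr lborel borel \<dots> = distr (distr lborel borel ((+) b)) borel T"
    by (subst distr_distr) (auto intro!: meas)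
  finally show "distr (distr lborel borel T) borel (\<lambda>x. x + a) = distr lborel borel T"
    by (simp add: lborel_distr_plus)
qed simp

text \<open>
  Slicing the ball by hyperplanes orthogonal to a coordinate axis: the slice at height \<open>y\<close> is
  a ball of radius \<open>sqrt (r\<^sup>2 - y\<^sup>2)\<close> in one dimension less. Product measures over index sets are used
  because the lower dimension is not the dimension of a given type.
\<close>

lemma nn_integral_ball_section:
  fixes b :: "'a::euclidean_space"
  assumes b: "b \<in> Basis" and r: "r > 0" and [measurable]: "g \<in> borel_measurable borel"
  shows "(\<integral>\<^sup>+x. indicator (cball 0 r) x * g (x \<bullet> b) \<partial>lborel) =
    (\<integral>\<^sup>+y. (indicator {-r..r} y * ennreal (unit_ball_vol (DIM('a) - 1) * sqrt (r\<^sup>2 - y\<^sup>2) ^ (DIM('a) - 1))) * g y \<partial>lborel)"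
proof -
  interpret product_sigma_finite "\<lambda>_::'a. lborel :: real measure" by standard
  let ?A = "Basis - {b}"
  let ?S = "\<lambda>I r. {f :: 'a \<Rightarrow> real. sqrt (\<Sum>i\<in>I. (f i)\<^sup>2) \<le> r}"
  have B: "Basis = insert b ?A" using b by auto
  have [measurable]: "cball (0::'a) r \<in> sets borel" by simp
  have "(\<integral>\<^sup>+x. indicator (cball 0 r) x * g (x \<bullet> b) \<partial>lborel) =
    (\<integral>\<^sup>+f. indicator (cball 0 r) (\<Sum>i\<in>Basis. f i *\<^sub>R i) * g (f b) \<partial>PiM Basis (\<lambda>_. lborel))"
    by (subst lborel_eq, subst nn_integral_distr)
      (auto intro!: nn_integral_cong simp: b)
  also have "\<dots> = (\<integral>\<^sup>+f. indicator (?S Basis r) f * g (f b) \<partial>PiM Basis (\<lambda>_. lborel))"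
  proof (intro nn_integral_cong)
    fix f :: "'a \<Rightarrow> real"
    have "dist 0 (\<Sum>i\<in>Basis. f i *\<^sub>R i :: 'a) = sqrt (\<Sum>i\<in>Basis. (f i)\<^sup>2)"
      by (subst euclidean_dist_l2) (auto simp: L2_set_def)
    then show "indicator (cball 0 r) (\<Sum>i\<in>Basis. f i *\<^sub>R i) * g (f b) = indicator (?S Basis r) f * g (f b)"
      unfolding indicator_def mem_cball by simp
  qed
  also have "\<dots> = (\<integral>\<^sup>+f. indicator (?S (insert b ?A) r) f * g (f b) \<partial>PiM (insert b ?A) (\<lambda>_. lborel))"
    using B by simp
  also have "\<dots> = (\<integral>\<^sup>+y. \<integral>\<^sup>+f. indicator (?S (insert b ?A) r) (f(b := y)) * g ((f(b := y)) b) \<partial>PiM ?A (\<lambda>_. lborel) \<partial>lborel)"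
    by (rule product_nn_integral_insert_rev) auto
  also have "\<dots> = (\<integral>\<^sup>+y. \<integral>\<^sup>+f. (indicator {-r..r} y * g y) *
      indicator (?S ?A (sqrt (r\<^sup>2 - y\<^sup>2)) \<inter> space (PiM ?A (\<lambda>_. lborel))) f \<partial>PiM ?A (\<lambda>_. lborel) \<partial>lborel)"
  proof (intro nn_integral_cong)
    fix y and f :: "'a \<Rightarrow> real" assume f: "f \<in> space (PiM ?A (\<lambda>_. lborel))"
    have *: "y \<in> {-r..r}" if "y ^ 2 + c \<le> r ^ 2" "c \<ge> 0" for c
    proof -
      have "y ^ 2 \<le> r ^ 2" using that by simp
      then show ?thesis using r by (simp add: power2_le_iff_abs_le abs_if split: if_splits)
    qed
    have sumeq: "(\<Sum>x\<in>insert b ?A. ((f(b := y)) x)\<^sup>2) = y\<^sup>2 + (\<Sum>x\<in>?A. (f x)\<^sup>2)"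
      by (subst sum.insert) (auto intro!: sum.cong)
    have "(sqrt (y\<^sup>2 + (\<Sum>x\<in>?A. (f x)\<^sup>2)) \<le> r) \<longleftrightarrow>
        (y \<in> {-r..r} \<and> sqrt (\<Sum>x\<in>?A. (f x)\<^sup>2) \<le> sqrt (r\<^sup>2 - y\<^sup>2))"
      using r *[of "\<Sum>x\<in>?A. (f x)\<^sup>2"] by (auto simp: sum_nonneg real_sqrt_le_iff')
    then show "indicator (?S (insert b ?A) r) (f(b := y)) * g ((f(b := y)) b) = (indicator {-r..r} y * g y) *
      indicator (?S ?A (sqrt (r\<^sup>2 - y\<^sup>2)) \<inter> space (PiM ?A (\<lambda>_. lborel))) f"
      using f by (simp add: indicator_def sumeq del: insert_Diff_single)
  qed
  also have "\<dots> = (\<integral>\<^sup>+y. (indicator {-r..r} y * g y) *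
     emeasure (PiM ?A (\<lambda>_. lborel)) (?S ?A (sqrt (r\<^sup>2 - y\<^sup>2)) \<inter> space (PiM ?A (\<lambda>_. lborel))) \<partial>lborel)"
  proof (intro nn_integral_cong)
    fix y :: real
    have "?S ?A (sqrt (r\<^sup>2 - y\<^sup>2)) \<inter> space (PiM ?A (\<lambda>_. lborel)) \<in> sets (PiM ?A (\<lambda>_. lborel))"
      by measurable
    then show "(\<integral>\<^sup>+f. (indicator {-r..r} y * g y) *
      indicator (?S ?A (sqrt (r\<^sup>2 - y\<^sup>2)) \<inter> space (PiM ?A (\<lambda>_. lborel))) f \<partial>PiM ?A (\<lambda>_. lborel)) = (indicator {-r..r} y * g y) *
     emeasure (PiM ?A (\<lambda>_. lborel)) (?S ?A (sqrt (r\<^sup>2 - y\<^sup>2)) \<inter> space (PiM ?A (\<lambda>_. lborel)))"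
      by (subst nn_integral_cmult) auto
  qed
  also have "\<dots> = (\<integral>\<^sup>+y. (indicator {-r..r} y * ennreal (unit_ball_vol (DIM('a) - 1) * sqrt (r\<^sup>2 - y\<^sup>2) ^ (DIM('a) - 1))) * g y \<partial>lborel)"
  proof (rule nn_integral_cong_AE)
    have "AE y in lborel. y \<notin> {-r,r}"
      by (intro AE_not_in countable_imp_null_set_lborel) auto
    then show "AE y in lborel. (indicator {-r..r} y * g y) *
       emeasure (PiM ?A (\<lambda>_. lborel)) (?S ?A (sqrt (r\<^sup>2 - y\<^sup>2)) \<inter> space (PiM ?A (\<lambda>_. lborel)))
      = (indicator {-r..r} y * ennreal (unit_ball_vol (DIM('a) - 1) * sqrt (r\<^sup>2 - y\<^sup>2) ^ (DIM('a) - 1))) * g y"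
    proof eventually_elim
      case (elim y)
      show ?case
      proof (cases "y \<in> {-r<..<r}")
        case True
        then have "y\<^sup>2 < r\<^sup>2" by (subst real_sqrt_less_iff [symmetric]) auto
        moreover have "card ?A = DIM('a) - 1" using b by (simp add: card_Diff_singleton)
        ultimately show ?thesis
          using emeasure_cball_aux[of ?A "sqrt (r\<^sup>2 - y\<^sup>2)"] by (simp add: mult_ac)
      qed (use elim in auto)
    qed
  qed
  finally show ?thesis .
qed

text \<open>
  An orthogonal map carries \<open>\<omega>\<close> to a coordinate axis and preserves the ball, so every direction has the
  section function of an axis.
\<close>

lemma ball_projection_distr:
  fixes \<omega> :: "real^'n"
  assumes "norm \<omega> = 1" and r: "r > 0"
  shows "distr (density lborel (indicator (cball 0 r))) borel (\<lambda>x. x \<bullet> \<omega>) =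
    density lborel (\<lambda>y. indicator {-r..r} y *
      ennreal (unit_ball_vol (CARD('n) - 1) * sqrt (r\<^sup>2 - y\<^sup>2) ^ (CARD('n) - 1)))" (is "_ = ?D")
proof -
  obtain b :: "real^'n" where b: "b \<in> Basis" using nonempty_Basis by blast
  obtain T where T: "orthogonal_transformation T" and Tb: "T b = \<omega>"
    using orthogonal_transformation_exists[of b \<omega>] assms b by auto
  have lin: "linear T" using T by (rule orthogonal_transformation_linear)
  have cont: "continuous_on UNIV T"
    using linear_continuous_on[of T] lin by (simp add: linear_conv_bounded_linear)
  then have meas[measurable]: "T \<in> borel_measurable borel" by (rule borel_measurable_continuous_onI)
  have [measurable]: "cball (0::real^'n) r \<in> sets borel" by simp
  show ?thesis
  proof (rule measure_eqI)
    fix A assume "A \<in> sets (distr (density lborel (indicator (cball 0 r))) borel (\<lambda>x. x \<bullet> \<omega>))"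
    then have [measurable]: "A \<in> sets borel" by simp
    have "emeasure (distr (density lborel (indicator (cball 0 r))) borel (\<lambda>x. x \<bullet> \<omega>)) A =
        (\<integral>\<^sup>+x. indicator A x \<partial>distr (density lborel (indicator (cball 0 r))) borel (\<lambda>x. x \<bullet> \<omega>))"
      by (subst nn_integral_indicator) auto
    also have "\<dots> = (\<integral>\<^sup>+x. indicator (cball 0 r) x * indicator A (x \<bullet> \<omega>) \<partial>lborel)"
      by (subst nn_integral_distr, measurable, subst nn_integral_density, auto)
    also have "\<dots> = (\<integral>\<^sup>+x. indicator (cball 0 r) (T x) * indicator A (T x \<bullet> \<omega>) \<partial>lborel)"
      by (subst lborel_distr_orthogonal[OF T, symmetric], subst nn_integral_distr) auto
    also have "\<dots> = (\<integral>\<^sup>+x. indicator (cball 0 r) x * indicator A (x \<bullet> b) \<partial>lborel)"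
      using T by (intro nn_integral_cong)
        (auto simp: Tb[symmetric] orthogonal_transformation_def indicator_def norm_eq_sqrt_inner)
    also have "\<dots> = emeasure ?D A"
      by (subst nn_integral_ball_section[OF b r]) (auto simp: emeasure_density)
    finally show "emeasure (distr (density lborel (indicator (cball 0 r))) borel (\<lambda>x. x \<bullet> \<omega>)) A = emeasure ?D A" .
  qed auto
qed

text \<open>
  After projection to the line spanned by \<open>\<xi>\<close> and rescaling, the transform is a one-dimensional
  oscillatory integral with weight \<open>sqrt (1 - y\<^sup>2) ^ (d - 1)\<close> and frequency \<open>r |\<xi>|\<close>.
\<close>

proposition fourier_ball_decay:
  fixes r :: real
  assumes r: "r > 0"
  shows "\<exists>C\<ge>0. \<forall>\<xi> :: real^'n. \<xi> \<noteq> 0 \<longrightarrow>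
     norm (LINT x|lborel. indicator (cball 0 r) x *\<^sub>R cis (x \<bullet> \<xi>)) \<le> C * norm \<xi> powr (- (real CARD('n) + 1) / 2)"
proof -
  let ?n = "CARD('n) - 1"
  have n: "real ?n / 2 + 1 = (real CARD('n) + 1) / 2"
    using zero_less_card_finite[where 'a='n] by (simp add: of_nat_diff field_simps)
  obtain C where C: "\<And>s. s > 0 \<Longrightarrow> norm (integral {-1..1} (\<lambda>x. of_real (poly 1 x * sqrt (1 - x\<^sup>2) ^ ?n) * cis (s * x)))
     \<le> C * s powr (- (real ?n / 2 + 1))"
    using ball_section_oscillation[of 1 ?n] by blast
  let ?V = "unit_ball_vol (real ?n)"
  have bound: "norm (LINT x|lborel. indicator (cball 0 r) x *\<^sub>R cis (x \<bullet> \<xi>)) \<le>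
     (?V * r ^ CARD('n) * C * r powr (- (real CARD('n) + 1) / 2)) * norm \<xi> powr (- (real CARD('n) + 1) / 2)"
    if \<xi>: "\<xi> \<noteq> 0" for \<xi> :: "real^'n"
  proof -
    define \<omega> where "\<omega> = \<xi> /\<^sub>R norm \<xi>"
    have \<omega>: "norm \<omega> = 1" "\<xi> = norm \<xi> *\<^sub>R \<omega>" using \<xi> by (auto simp: \<omega>_def)
    have c1: "(\<lambda>x. cis (c * x)) \<in> borel_measurable borel" for c :: real
      by (intro borel_measurable_continuous_onI continuous_on_cis continuous_intros)
    have [measurable]: "(\<lambda>x. cis (x \<bullet> \<xi>)) \<in> borel_measurable borel"
      by (intro borel_measurable_continuous_onI continuous_on_cis continuous_intros)
    have cb: "cball (0::real^'n) r \<in> sets borel" by simp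
    note [measurable] = c1 cb
    have "(LINT x|lborel. indicator (cball 0 r) x *\<^sub>R cis (x \<bullet> \<xi>)) =
       (LINT x|density lborel (\<lambda>x. ennreal (indicator (cball 0 r) x)). cis (x \<bullet> \<xi>))"
      by (subst integral_density) auto
    also have "\<dots> = (LINT x|density lborel (indicator (cball 0 r)). cis (norm \<xi> * (x \<bullet> \<omega>)))"
      by (subst \<omega>(2)) (simp add: ennreal_indicator)
    also have "\<dots> = (LINT y|distr (density lborel (indicator (cball 0 r))) borel (\<lambda>x. x \<bullet> \<omega>). cis (norm \<xi> * y))"
      by (subst integral_distr) auto
    also have "\<dots> = (LINT y|density lborel (\<lambda>y. ennreal (indicator {-r..r} y * (?V * sqrt (r\<^sup>2 - y\<^sup>2) ^ ?n))). cis (norm \<xi> * y))"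
      unfolding ball_projection_distr[OF \<omega>(1) r]
      by (intro arg_cong2[where f="integral\<^sup>L"] density_cong AE_I2) (auto simp: indicator_def)
    also have "\<dots> = (LINT y|lborel. (indicator {-r..r} y * (?V * sqrt (r\<^sup>2 - y\<^sup>2) ^ ?n)) *\<^sub>R cis (norm \<xi> * y))"
    proof (subst integral_density)
      show "AE x in lborel. 0 \<le> indicator {- r..r} x * (?V * sqrt (r\<^sup>2 - x\<^sup>2) ^ ?n)"
      proof (rule AE_I2)
        fix x :: real
        have "x\<^sup>2 \<le> r\<^sup>2" if "x \<in> {-r..r}" using that r by (intro abs_le_square_iff[THEN iffD1]) auto
        then show "0 \<le> indicator {- r..r} x * (?V * sqrt (r\<^sup>2 - x\<^sup>2) ^ ?n)"
          by (auto simp: indicator_def)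
      qed
    qed auto
    also have "\<dots> = r *\<^sub>R (LINT y|lborel. (indicator {-r..r} (0 + r * y) * (?V * sqrt (r\<^sup>2 - (0 + r * y)\<^sup>2) ^ ?n)) *\<^sub>R cis (norm \<xi> * (0 + r * y)))"
      using r by (subst lborel_integral_real_affine[where c=r and t=0]) auto
    also have "(LINT y|lborel. (indicator {-r..r} (0 + r * y) * (?V * sqrt (r\<^sup>2 - (0 + r * y)\<^sup>2) ^ ?n)) *\<^sub>R cis (norm \<xi> * (0 + r * y)))
        = (LINT y|lborel. (?V * r ^ ?n) *\<^sub>R (indicator {-1..1} y *\<^sub>R (of_real (poly 1 y * sqrt (1 - y\<^sup>2) ^ ?n) * cis ((norm \<xi> * r) * y))))"
    proof (intro Bochner_Integration.integral_cong refl)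
      fix y :: real
      have "r\<^sup>2 - (0 + r * y)\<^sup>2 = r\<^sup>2 * (1 - y\<^sup>2)" by (simp add: algebra_simps power_mult_distrib)
      then have "sqrt (r\<^sup>2 - (0 + r * y)\<^sup>2) = r * sqrt (1 - y\<^sup>2)" using r by (simp add: real_sqrt_mult)
      moreover have "indicator {-r..r} (0 + r * y) = (indicator {-1..1} y :: real)"
        using r mult_le_cancel_left_pos[OF r, of "-1" y] mult_le_cancel_left_pos[OF r, of y 1] by (auto simp: indicator_def)
      ultimately show "(indicator {-r..r} (0 + r * y) * (?V * sqrt (r\<^sup>2 - (0 + r * y)\<^sup>2) ^ ?n)) *\<^sub>R cis (norm \<xi> * (0 + r * y))
        = (?V * r ^ ?n) *\<^sub>R (indicator {-1..1} y *\<^sub>R (of_real (poly 1 y * sqrt (1 - y\<^sup>2) ^ ?n) * cis ((norm \<xi> * r) * y)))"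
        by (simp add: power_mult_distrib scaleR_conv_of_real mult_ac)
    qed
    also have "\<dots> = (?V * r ^ ?n) *\<^sub>R (LINT y:{-1..1}|lborel. of_real (poly 1 y * sqrt (1 - y\<^sup>2) ^ ?n) * cis ((norm \<xi> * r) * y))"
      unfolding set_lebesgue_integral_def by (rule integral_scaleR_right)
    also have "(LINT y:{-1..1}|lborel. of_real (poly 1 y * sqrt (1 - y\<^sup>2) ^ ?n) * cis ((norm \<xi> * r) * y)) =
        integral {-1..1} (\<lambda>y. of_real (poly 1 y * sqrt (1 - y\<^sup>2) ^ ?n) * cis ((norm \<xi> * r) * y))"
      by (intro set_borel_integral_eq_integral borel_integrable_atLeastAtMost'
        continuous_on_mult continuous_on_of_real continuous_on_cis continuous_intros)
    finally have "norm (LINT x|lborel. indicator (cball 0 r) x *\<^sub>R cis (x \<bullet> \<xi>)) =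
       (?V * r ^ CARD('n)) * norm (integral {-1..1} (\<lambda>y. of_real (poly 1 y * sqrt (1 - y\<^sup>2) ^ ?n) * cis ((norm \<xi> * r) * y)))"
      using r by (simp add: power_eq_if[of r "CARD('n)"])
    also have "\<dots> \<le> (?V * r ^ CARD('n)) * (C * (norm \<xi> * r) powr (- (real ?n / 2 + 1)))"
      using r \<xi> by (intro mult_left_mono C) auto
    also have "\<dots> = (?V * r ^ CARD('n) * C * r powr (- (real CARD('n) + 1) / 2)) * norm \<xi> powr (- (real CARD('n) + 1) / 2)"
      using r \<xi> by (simp only: n powr_mult norm_ge_zero) (simp add: mult_ac minus_divide_left)
    finally show ?thesis .
  qed
  show ?thesis
    by (intro exI[of _ "max 0 (?V * r ^ CARD('n) * C * r powr (- (real CARD('n) + 1) / 2))"] conjI allI impI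
        order.trans[OF bound] mult_right_mono) auto
qed

section \<open>Haar measure on the torus\<close>

lemma torus_rep_add_lattice:
  assumes "k \<in> int_lattice"
  shows "torus_rep (x + k) = torus_rep x"
proof -
  have "frac ((x + k) $ i + 1/2) = frac (x $ i + 1/2)" for i
  proof -
    have "k $ i \<in> \<int>" using assms by (simp add: int_lattice_def)
    then obtain m where "k $ i = of_int m" by (rule Ints_cases)
    then have "(x + k) $ i + 1/2 = (x $ i + 1/2) + of_int m" by simp
    moreover have "frac (y + of_int m) = frac y" for y :: real by (simp add: frac_def)
    ultimately show ?thesis by metis
  qed
  then show ?thesis by (simp add: torus_rep_def vec_eq_iff)
qed

lemma int_lattice_closed:
  "0 \<in> int_lattice" "k \<in> int_lattice \<Longrightarrow> l \<in> int_lattice \<Longrightarrow> k + l \<in> int_lattice"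
  "k \<in> int_lattice \<Longrightarrow> l \<in> int_lattice \<Longrightarrow> k - l \<in> int_lattice"
  "k \<in> int_lattice \<Longrightarrow> - k \<in> int_lattice"
  by (auto simp: int_lattice_def)

lemma lattice_inner_int: "k \<in> int_lattice \<Longrightarrow> l \<in> int_lattice \<Longrightarrow> k \<bullet> l \<in> \<int>"
  unfolding inner_vec_def int_lattice_def by (auto intro!: Ints_sum)

lemma countable_int_lattice: "countable (int_lattice :: (real^'n) set)"
proof (rule countable_subset)
  show "int_lattice \<subseteq> range (\<lambda>f :: 'n \<Rightarrow> int. \<chi> i. of_int (f i))"
  proof
    fix k :: "real^'n" assume "k \<in> int_lattice"
    then have "k = (\<chi> i. of_int ((\<lambda>i. \<lfloor>k $ i\<rfloor>) i))" by (simp add: int_lattice_def vec_eq_iff)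
    then show "k \<in> range (\<lambda>f :: 'n \<Rightarrow> int. \<chi> i. of_int (f i))"
      by - (rule range_eqI[of _ _ "\<lambda>i. \<lfloor>k $ i\<rfloor>"])
  qed
qed simp

lemma measurable_vec_nth [measurable]: "(\<lambda>x. x $ i) \<in> borel_measurable borel"
  by (intro borel_measurable_continuous_onI continuous_intros)

lemma torus_cube_borel [measurable]: "torus_cube \<in> sets borel"
proof -
  have "torus_cube = (\<Inter>i. {x :: real^'n. - 1/2 \<le> x $ i} \<inter> {x. x $ i < 1/2})"
    by (auto simp: torus_cube_def)
  moreover have "{x :: real^'n. - 1/2 \<le> x $ i} \<inter> {x. x $ i < 1/2} \<in> sets borel" for i by measurable
  ultimately show ?thesis by (metis (no_types, lifting) finite sets.countable_INT' sets.finite_INT finite_UNIV UNIV_not_empty)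
qed

lemma measurable_torus_borelD: "f \<in> M \<rightarrow>\<^sub>M torus_borel \<Longrightarrow> f \<in> M \<rightarrow>\<^sub>M borel"
  unfolding torus_borel_def by (simp add: measurable_restrict_space2_iff)

lemma torus_rep_borel [measurable]: "torus_rep \<in> borel \<rightarrow>\<^sub>M borel"
  by (rule measurable_torus_borelD) measurable

text \<open>
  Haar measure of the torus, carried by the cube but defined on all Borel sets of the ambient space, so
  that the maps \<open>t \<mapsto> t + a\<close> need not be reduced into the cube.
\<close>

definition torus_haar :: "(real^'n) measure" where
  "torus_haar = density lborel (indicator torus_cube)"

lemma sets_torus_haar [measurable_cong, simp]: "sets torus_haar = sets borel"
  and space_torus_haar [simp]: "space torus_haar = UNIV"
  by (simp_all add: torus_haar_def)

lemma AE_torus_haar: "AE x in torus_haar. x \<in> torus_cube"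
  unfolding torus_haar_def by (subst AE_density) (auto simp: indicator_def)

lemma integral_torus_haar:
  fixes f :: "real^'n \<Rightarrow> 'b::{banach, second_countable_topology}"
  assumes "f \<in> borel_measurable borel"
  shows "(LINT t|torus_haar. f t) = (LINT t:torus_cube|lborel. f t)"
  unfolding torus_haar_def set_lebesgue_integral_def
  using integral_density[of f lborel "indicator torus_cube"] assms by (simp add: ennreal_indicator)

lemma prob_space_torus_haar: "prob_space (torus_haar :: (real^'n) measure)"
proof
  define u :: "real^'n" where "u = (\<chi> i. 1/2)"
  have ui: "u $ i = 1/2" for i by (simp add: u_def)
  have vol: "(\<Prod>b\<in>Basis. (u - (- u)) \<bullet> b) = 1" "\<And>b. b \<in> Basis \<Longrightarrow> (-u) \<bullet> b \<le> u \<bullet> b"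
    by (auto simp: Basis_vec_def inner_axis ui intro!: prod.neutral)
  have "emeasure lborel (box (- u) u) = 1" using vol by (subst emeasure_lborel_box) auto
  moreover have "emeasure lborel (cbox (- u) u) = 1" using vol by (subst emeasure_lborel_cbox) auto
  moreover have "box (- u) u \<subseteq> torus_cube" "torus_cube \<subseteq> cbox (- u) u"
    by (auto simp: torus_cube_def mem_box_cart ui less_imp_le)
  ultimately have "emeasure lborel (torus_cube :: (real^'n) set) = 1"
    by (metis order_antisym emeasure_mono torus_cube_borel sets_lborel borel_closed closed_cbox)
  then show "emeasure torus_haar (space (torus_haar :: (real^'n) measure)) = 1"
    by (simp add: torus_haar_def emeasure_density)
qed

text \<open>
  The only translate of \<open>y\<close> by a lattice vector that lies in the cube is its representative.
\<close>

lemma lattice_translates_tile: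
  "(\<integral>\<^sup>+k. indicator torus_cube (y + k) \<partial>count_space int_lattice) = (1::ennreal)"
proof -
  have in': "y + k \<in> torus_cube \<longleftrightarrow> k = torus_rep y - y" if "k \<in> int_lattice" for k
    using torus_rep_id[of "y + k"] torus_rep_add_lattice[OF that, of y] torus_rep_in_cube[of y] by auto
  have "(\<integral>\<^sup>+k. indicator torus_cube (y + k) \<partial>count_space int_lattice) =
     (\<integral>\<^sup>+k. indicator {torus_rep y - y} k \<partial>count_space int_lattice)"
    by (intro nn_integral_cong) (auto simp: indicator_def in')
  also have "\<dots> = 1" using torus_rep_diff[of y] by (subst nn_integral_indicator) auto
  finally show ?thesis .
qed

text \<open>
  The cube and its translate are both fundamental domains: cut the translate along
  the lattice tiling by cubes, move each piece by its lattice vector into the cube itself (the integrand does not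
  change), and observe that the pieces fill it.
\<close>

lemma nn_integral_torus_translate:
  fixes f :: "real^'n \<Rightarrow> ennreal"
  assumes [measurable]: "f \<in> borel_measurable borel" and per: "periodic f"
  shows "(\<integral>\<^sup>+t. f (t + a) \<partial>torus_haar) = (\<integral>\<^sup>+t. f t \<partial>torus_haar)"
proof -
  let ?Q = "indicator torus_cube :: real^'n \<Rightarrow> ennreal"
  let ?L = "count_space (int_lattice :: (real^'n) set)"
  have inv_L: "(\<integral>\<^sup>+x. g (x + a) \<partial>lborel) = (\<integral>\<^sup>+x. g x \<partial>lborel)" if [measurable]: "g \<in> borel_measurable borel"
    for g :: "real^'n \<Rightarrow> ennreal" and a
    by (subst (2) lborel_distr_plus[of a, symmetric]) (subst nn_integral_distr, auto simp: add.commute)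
  have "(\<integral>\<^sup>+t. f (t + a) \<partial>torus_haar) = (\<integral>\<^sup>+t. ?Q t * f (t + a) \<partial>lborel)"
    unfolding torus_haar_def by (subst nn_integral_density) auto
  also have "\<dots> = (\<integral>\<^sup>+x. ?Q (x - a) * f x \<partial>lborel)"
    by (subst inv_L[of _ a, symmetric]) auto
  also have "\<dots> = (\<integral>\<^sup>+x. \<integral>\<^sup>+k. ?Q (x - a) * f x * ?Q (x + k) \<partial>?L \<partial>lborel)"
    by (simp add: nn_integral_cmult lattice_translates_tile)
  also have "\<dots> = (\<integral>\<^sup>+k. \<integral>\<^sup>+x. ?Q (x - a) * f x * ?Q (x + k) \<partial>lborel \<partial>?L)"
    by (intro nn_integral_count_space_nn_integral countable_int_lattice) measurable
  also have "\<dots> = (\<integral>\<^sup>+k. \<integral>\<^sup>+x. ?Q ((x - k) - a) * f (x - k) * ?Q x \<partial>lborel \<partial>?L)"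
  proof (rule nn_integral_cong)
    fix k :: "real^'n"
    show "(\<integral>\<^sup>+x. ?Q (x - a) * f x * ?Q (x + k) \<partial>lborel) = (\<integral>\<^sup>+x. ?Q ((x - k) - a) * f (x - k) * ?Q x \<partial>lborel)"
      using inv_L[of "\<lambda>x. ?Q ((x - k) - a) * f (x - k) * ?Q x" k] by simp
  qed
  also have "\<dots> = (\<integral>\<^sup>+x. \<integral>\<^sup>+k. ?Q ((x - k) - a) * f (x - k) * ?Q x \<partial>?L \<partial>lborel)"
    by (intro nn_integral_count_space_nn_integral[symmetric] countable_int_lattice) measurable
  also have "\<dots> = (\<integral>\<^sup>+x. \<integral>\<^sup>+k. (f x * ?Q x) * ?Q ((x - a) + - k) \<partial>?L \<partial>lborel)"
  proof (intro nn_integral_cong)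
    fix x k :: "real^'n" assume "k \<in> space ?L"
    then have "- k \<in> int_lattice" by (simp add: int_lattice_closed)
    then have "f (x + - k) = f x" using per unfolding periodic_def by blast
    then show "?Q ((x - k) - a) * f (x - k) * ?Q x = (f x * ?Q x) * ?Q ((x - a) + - k)"
      by (simp add: algebra_simps)
  qed
  also have "\<dots> = (\<integral>\<^sup>+x. (f x * ?Q x) * (\<integral>\<^sup>+k. ?Q ((x - a) + k) \<partial>?L) \<partial>lborel)"
  proof (rule nn_integral_cong)
    fix x :: "real^'n"
    have bij: "bij_betw uminus (int_lattice :: (real^'n) set) int_lattice"
      by (rule bij_betwI[of _ _ _ uminus]) (auto simp: int_lattice_closed)
    show "(\<integral>\<^sup>+k. (f x * ?Q x) * ?Q ((x - a) + - k) \<partial>?L) = (f x * ?Q x) * (\<integral>\<^sup>+k. ?Q ((x - a) + k) \<partial>?L)"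
      using nn_integral_bij_count_space[OF bij, of "\<lambda>k. ?Q ((x - a) + k)"] by (subst nn_integral_cmult) auto
  qed
  also have "\<dots> = (\<integral>\<^sup>+t. f t \<partial>torus_haar)"
    unfolding torus_haar_def lattice_translates_tile by (subst nn_integral_density) (auto simp: mult.commute)
  finally show ?thesis .
qed

lemma distr_torus_haar_translate:
  "distr torus_haar borel (\<lambda>t. torus_rep (t + a)) = torus_haar"
proof (rule measure_eqI)
  fix A assume "A \<in> sets (distr torus_haar borel (\<lambda>t. torus_rep (t + a)))"
  then have [measurable]: "A \<in> sets borel" by simp
  have "emeasure (distr torus_haar borel (\<lambda>t. torus_rep (t + a))) A =
     (\<integral>\<^sup>+x. indicator A x \<partial>distr torus_haar borel (\<lambda>t. torus_rep (t + a)))"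
    by (subst nn_integral_indicator) auto
  also have "\<dots> = (\<integral>\<^sup>+t. indicator A (torus_rep (t + a)) \<partial>torus_haar)"
    by (subst nn_integral_distr) auto
  also have "\<dots> = (\<integral>\<^sup>+t. indicator A (torus_rep t) \<partial>torus_haar)"
    by (rule nn_integral_torus_translate[where f = "\<lambda>t. indicator A (torus_rep t)"])
      (auto simp: periodic_def torus_rep_add_lattice)
  also have "\<dots> = (\<integral>\<^sup>+t. indicator A t \<partial>torus_haar)"
    using AE_torus_haar by (intro nn_integral_cong_AE) (auto simp: torus_rep_id)
  finally show "emeasure (distr torus_haar borel (\<lambda>t. torus_rep (t + a))) A = emeasure torus_haar A"
    by simp
qed simp

lemma integral_torus_translate:
  fixes f :: "real^'n \<Rightarrow> 'b::{banach, second_countable_topology}"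
  assumes "f \<in> borel_measurable borel" and "periodic f"
  shows "(LINT t|torus_haar. f (t + a)) = (LINT t|torus_haar. f t)"
proof -
  have "(LINT t|torus_haar. f t) = (LINT t|distr torus_haar borel (\<lambda>t. torus_rep (t + a)). f t)"
    by (simp add: distr_torus_haar_translate)
  also have "\<dots> = (LINT t|torus_haar. f (t + a))"
    using assms by (subst integral_distr) (auto simp: periodic_torus_rep)
  finally show ?thesis by simp
qed

section \<open>Characters and Fourier coefficients\<close>

definition torus_char :: "real^'n \<Rightarrow> real^'n \<Rightarrow> complex" where
  "torus_char k x = cis (2 * pi * (k \<bullet> x))"

lemma torus_char_measurable [measurable]: "torus_char k \<in> borel_measurable borel"
  unfolding torus_char_def
  by (intro borel_measurable_continuous_onI continuous_on_cis continuous_intros)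

lemma norm_torus_char [simp]: "norm (torus_char k x) = 1"
  by (simp add: torus_char_def)

lemma torus_char_add: "torus_char k (x + y) = torus_char k x * torus_char k y"
  and torus_char_add_left: "torus_char (k + l) x = torus_char k x * torus_char l x"
  and torus_char_diff_left: "torus_char (k - l) x = torus_char k x * cnj (torus_char l x)"
  and torus_char_uminus: "torus_char k (- x) = cnj (torus_char k x)"
  by (simp_all add: torus_char_def cis_mult inner_add_left inner_add_right inner_diff_left cis_cnj algebra_simps)

lemma torus_char_eq_1_int: "k \<bullet> x \<in> \<int> \<Longrightarrow> torus_char k x = 1"
  by (elim Ints_cases) (simp add: torus_char_def cis_multiple_2pi)

lemma periodic_torus_char: "k \<in> int_lattice \<Longrightarrow> periodic (torus_char k)"
  by (simp add: periodic_def torus_char_add torus_char_eq_1_int lattice_inner_int)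

lemma integrable_torus_haar_bounded:
  fixes f :: "real^'n \<Rightarrow> 'b::{banach, second_countable_topology}"
  assumes [measurable]: "f \<in> borel_measurable borel" and "\<And>x. norm (f x) \<le> B"
  shows "integrable torus_haar f"
proof -
  interpret prob_space "torus_haar :: (real^'n) measure" by (rule prob_space_torus_haar)
  show ?thesis by (rule integrable_const_bound[where B=B]) (use assms in auto)
qed

text \<open>
  Translating by a vector \<open>a\<close> with \<open>k \<bullet> a = 1/2\<close> changes the sign of the character but not its integral.
\<close>

lemma integral_torus_char:
  fixes k :: "real^'n"
  assumes k: "k \<in> int_lattice"
  shows "(LINT x|torus_haar. torus_char k x) = (if k = 0 then 1 else 0)"
proof (cases "k = 0")
  case True
  interpret prob_space "torus_haar :: (real^'n) measure" by (rule prob_space_torus_haar)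
  show ?thesis using True prob_space by (simp add: torus_char_def)
next
  case False
  define a where "a = (1 / (2 * (k \<bullet> k))) *\<^sub>R k"
  have "2 * pi * (k \<bullet> a) = pi" using False by (simp add: a_def)
  then have "torus_char k a = -1" by (simp only: torus_char_def cis_pi)
  then have "(LINT x|torus_haar. torus_char k (x + a)) = - (LINT x|torus_haar. torus_char k x)"
    by (simp add: torus_char_add)
  then show ?thesis
    using integral_torus_translate[OF torus_char_measurable periodic_torus_char[OF k], of a] False by simp
qed

definition fourier_coeff :: "(real^'n \<Rightarrow> real) \<Rightarrow> real^'n \<Rightarrow> complex" where
  "fourier_coeff h k = (LINT x|torus_haar. of_real (h x) * torus_char k x)"

section \<open>The Fejer kernel and an inequality of Parseval type\<close>

definition lattice_box :: "nat \<Rightarrow> (real^'n) set" where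
  "lattice_box n = {j \<in> int_lattice. \<forall>i. 0 \<le> j $ i \<and> j $ i < real n}"

text \<open>
  The Fejer kernel of the torus in the form of a normalised square, which makes positivity evident and
  keeps the Fourier coefficients a matter of counting lattice points.
\<close>

definition fejer_kernel :: "nat \<Rightarrow> real^'n \<Rightarrow> real" where
  "fejer_kernel n x = (norm (\<Sum>j\<in>lattice_box n. torus_char j x))\<^sup>2 / real (n ^ CARD('n))"

text \<open>
  Lattice vectors as integer-valued functions, so that boxes can be counted as finite products.
\<close>

lemma bij_betw_lattice_PiE:
  "bij_betw (\<lambda>f. \<chi> i. of_int (f i)) (PiE UNIV (\<lambda>i::'n. S i))
     {j :: real^'n. j \<in> int_lattice \<and> (\<forall>i. \<lfloor>j $ i\<rfloor> \<in> S i)}"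
proof (rule bij_betwI[where g = "\<lambda>j i. \<lfloor>j $ i\<rfloor>"])
  show "(\<lambda>f. \<chi> i. of_int (f i)) \<in> PiE UNIV (\<lambda>i::'n. S i) \<rightarrow>
     {j :: real^'n. j \<in> int_lattice \<and> (\<forall>i. \<lfloor>j $ i\<rfloor> \<in> S i)}"
    by (auto simp: int_lattice_def PiE_iff)
qed (auto simp: int_lattice_def vec_eq_iff)

lemma lattice_box_floor:
  "(lattice_box n :: (real^'n) set) = {j \<in> int_lattice. \<forall>i. \<lfloor>j $ i\<rfloor> \<in> {0..<int n}}"
proof -
  have "0 \<le> j $ i \<and> j $ i < real n \<longleftrightarrow> \<lfloor>j $ i\<rfloor> \<in> {0..<int n}" for j :: "real^'n" and i
    by (simp add: floor_less_iff)
  then show ?thesis unfolding lattice_box_def by simp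
qed

lemma card_lattice_box: "card (lattice_box n :: (real^'n) set) = n ^ CARD('n)"
  and finite_lattice_box: "finite (lattice_box n :: (real^'n) set)"
proof -
  note b = bij_betw_lattice_PiE[of "\<lambda>_::'n. {0..<int n}", folded lattice_box_floor]
  show "card (lattice_box n :: (real^'n) set) = n ^ CARD('n)"
    using bij_betw_same_card[OF b] by (simp add: card_PiE)
  show "finite (lattice_box n :: (real^'n) set)"
    using bij_betw_finite[OF b] by (simp add: finite_PiE)
qed

lemma card_lattice_box_shift:
  assumes "n > 0"
  shows "card {j \<in> lattice_box n. j + axis i 1 \<in> (lattice_box n :: (real^'n) set)} = (n - 1) * n ^ (CARD('n) - 1)"
proof -
  let ?S = "\<lambda>i'. if i' = i then {0..<int (n - 1)} else {0..<int n}"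
  have "{j \<in> lattice_box n. j + axis i 1 \<in> (lattice_box n :: (real^'n) set)} =
     {j \<in> int_lattice. \<forall>i'. \<lfloor>j $ i'\<rfloor> \<in> ?S i'}" (is "?L = ?R")
  proof (intro set_eqI iffI)
    fix j :: "real^'n"
    assume j: "j \<in> ?L"
    then have 1: "j \<in> int_lattice" "\<And>i'. 0 \<le> \<lfloor>j $ i'\<rfloor> \<and> \<lfloor>j $ i'\<rfloor> < int n"
      by (auto simp: lattice_box_floor)
    from j have "\<lfloor>(j + axis i 1) $ i\<rfloor> < int n"
      by (auto simp: lattice_box_floor simp del: vector_add_component)
    then have "\<lfloor>j $ i\<rfloor> + 1 < int n" by (simp add: axis_def)
    with 1 show "j \<in> ?R" by auto
  next
    fix j :: "real^'n"
    assume j: "j \<in> ?R"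
    then have J: "j \<in> int_lattice" "\<And>i'. 0 \<le> \<lfloor>j $ i'\<rfloor>" "\<And>i'. i' \<noteq> i \<Longrightarrow> \<lfloor>j $ i'\<rfloor> < int n"
       "\<lfloor>j $ i\<rfloor> < int n - 1"
      using assms by (auto split: if_splits dest: spec[of _ i] simp: of_nat_diff)
    have lt: "\<lfloor>j $ i'\<rfloor> < int n" for i' using J(3)[of i'] J(4) by (cases "i' = i") auto
    have "axis i 1 \<in> (int_lattice :: (real^'n) set)" by (auto simp: int_lattice_def axis_def)
    moreover have "\<lfloor>(j + axis i 1) $ i'\<rfloor> = \<lfloor>j $ i'\<rfloor> + (if i' = i then 1 else 0)" for i'
      by (auto simp: axis_def)
    ultimately show "j \<in> ?L"
      using J lt by (auto simp: lattice_box_floor int_lattice_closed axis_def)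
  qed
  then have "card {j \<in> lattice_box n. j + axis i 1 \<in> (lattice_box n :: (real^'n) set)} = card (PiE UNIV ?S)"
    using bij_betw_same_card[OF bij_betw_lattice_PiE[of ?S]] by simp
  also have "\<dots> = (\<Prod>i'\<in>UNIV. if i' = i then n - 1 else n)"
    by (subst card_PiE) (auto intro!: prod.cong)
  also have "\<dots> = (n - 1) * n ^ (CARD('n) - 1)"
    by (simp add: prod.remove[of UNIV i] card_Diff_singleton)
  finally show ?thesis .
qed

lemma fejer_kernel_expand:
  "complex_of_real (fejer_kernel n (x :: real^'n)) =
     (\<Sum>j\<in>lattice_box n. \<Sum>l\<in>lattice_box n. torus_char (j - l) x) / of_nat (n ^ CARD('n))"
  unfolding fejer_kernel_def of_real_divide complex_norm_square
  by (simp add: sum_product torus_char_diff_left)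

lemma lattice_box_lattice: "j \<in> lattice_box n \<Longrightarrow> j \<in> int_lattice"
  by (simp add: lattice_box_def)

lemma fejer_kernel_measurable [measurable]: "fejer_kernel n \<in> borel_measurable borel"
  unfolding fejer_kernel_def by measurable

lemma fejer_kernel_nonneg: "fejer_kernel n (x :: real^'n) \<ge> 0"
  by (simp add: fejer_kernel_def)

lemma fejer_kernel_bound: "fejer_kernel n (x :: real^'n) \<le> (real (n ^ CARD('n)))\<^sup>2 / real (n ^ CARD('n))"
proof -
  have "norm (\<Sum>j\<in>lattice_box n. torus_char j x) \<le> real (n ^ CARD('n))"
    by (rule order.trans[OF norm_sum]) (simp add: card_lattice_box)
  then show ?thesis unfolding fejer_kernel_def by (intro divide_right_mono power_mono) auto
qed

lemma fejer_kernel_fourier_coeff: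
  fixes m :: "real^'n"
  assumes m: "m \<in> int_lattice"
  shows "(LINT x|torus_haar. of_real (fejer_kernel n x) * torus_char m x) =
     of_nat (card {j \<in> lattice_box n. j + m \<in> lattice_box n}) / of_nat (n ^ CARD('n))"
    (is "_ = of_nat (card ?S) / _")
proof -
  let ?J = "lattice_box n :: (real^'n) set"
  have i: "integrable torus_haar (torus_char k)" for k :: "real^'n"
    by (rule integrable_torus_haar_bounded[where B=1]) auto
  have "(LINT x|torus_haar. of_real (fejer_kernel n x) * torus_char m x) =
     (LINT x|torus_haar. (\<Sum>j\<in>?J. \<Sum>l\<in>?J. torus_char (j - l + m) x) / of_nat (n ^ CARD('n)))"
    by (intro Bochner_Integration.integral_cong)
      (simp_all add: fejer_kernel_expand sum_distrib_right torus_char_add_left)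
  also have "\<dots> = (\<Sum>j\<in>?J. \<Sum>l\<in>?J. LINT x|torus_haar. torus_char (j - l + m) x) / of_nat (n ^ CARD('n))"
    by (simp add: Bochner_Integration.integral_sum i)
  also have "(\<Sum>j\<in>?J. \<Sum>l\<in>?J. LINT x|torus_haar. torus_char (j - l + m) x) =
      (\<Sum>j\<in>?J. \<Sum>l\<in>?J. if l = j + m then 1 else 0)"
    by (intro sum.cong refl, subst integral_torus_char)
       (auto simp: int_lattice_closed lattice_box_lattice m algebra_simps)
  also have "\<dots> = (\<Sum>j\<in>?J. if j + m \<in> ?J then 1 else 0)"
    by (intro sum.cong refl) (simp add: finite_lattice_box)
  also have "\<dots> = of_nat (card ?S)"
    by (simp add: finite_lattice_box sum.If_cases Int_def)
  finally show ?thesis .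
qed

lemma fejer_kernel_integral:
  assumes "n > 0" shows "(LINT x|(torus_haar :: (real^'n) measure). fejer_kernel n x) = 1"
proof -
  have "complex_of_real (LINT x|(torus_haar :: (real^'n) measure). fejer_kernel n x) =
     (LINT x|torus_haar. of_real (fejer_kernel n x) * torus_char 0 (x :: real^'n))"
    by (simp add: torus_char_def)
  also have "\<dots> = 1"
    using assms by (subst fejer_kernel_fourier_coeff) (auto simp: int_lattice_closed card_lattice_box)
  finally show ?thesis by simp
qed

lemma integrable_fejer_kernel_mult:
  fixes g :: "real^'n \<Rightarrow> real"
  assumes [measurable]: "g \<in> borel_measurable borel" and "\<And>x. \<bar>g x\<bar> \<le> B"
  shows "integrable torus_haar (\<lambda>x. fejer_kernel n x * g x)"
proof (rule integrable_torus_haar_bounded)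
  fix x
  have "norm (fejer_kernel n x * g x) \<le> ((real (n ^ CARD('n)))\<^sup>2 / real (n ^ CARD('n))) * B"
    using assms(2)[of x] fejer_kernel_bound[of n x] fejer_kernel_nonneg[of n x]
    unfolding norm_mult by (intro mult_mono) auto
  then show "norm (fejer_kernel n x * g x) \<le> ((real (n ^ CARD('n)))\<^sup>2 / real (n ^ CARD('n))) * B" .
qed measurable

text \<open>
  The first Fourier coefficient in each coordinate direction is \<open>1 - 1/n\<close>. As
  \<open>1 - cos (2 \<pi> x\<^sub>i)\<close> vanishes only for \<open>x\<^sub>i = 0\<close> modulo 1, this says that the kernel concentrates at
  the origin; it is all that is used about concentration (as in Korovkin's theorem).
\<close>

lemma fejer_kernel_concentrates:
  assumes n: "n > 0"
  shows "(LINT x|(torus_haar :: (real^'n) measure). fejer_kernel n x * (1 - cos (2 * pi * x $ i))) = 1 / real n"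
proof -
  have ax: "axis i 1 \<in> (int_lattice :: (real^'n) set)" by (auto simp: int_lattice_def axis_def)
  have [measurable]: "(\<lambda>x::real^'n. cos (2 * pi * x $ i)) \<in> borel_measurable borel"
    by (intro borel_measurable_continuous_onI continuous_intros)
  have intc: "integrable torus_haar (\<lambda>x::real^'n. fejer_kernel n x * cos (2 * pi * x $ i))"
    by (rule integrable_fejer_kernel_mult[where B=1]) auto
  have int1: "integrable torus_haar (\<lambda>x::real^'n. fejer_kernel n x * 1)"
    by (rule integrable_fejer_kernel_mult[where B=1]) auto
  have ci: "integrable torus_haar (\<lambda>x::real^'n. of_real (fejer_kernel n x) * torus_char (axis i 1) x)"
    by (rule integrable_torus_haar_bounded[where B="(real (n ^ CARD('n)))\<^sup>2 / real (n ^ CARD('n))"])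
      (use fejer_kernel_bound[of n, where 'n='n] fejer_kernel_nonneg[of n, where 'n='n] in \<open>auto simp: norm_mult\<close>)
  have "(LINT x|(torus_haar :: (real^'n) measure). fejer_kernel n x * cos (2 * pi * x $ i)) =
     Re (LINT x|torus_haar. of_real (fejer_kernel n x) * torus_char (axis i 1) (x :: real^'n))"
    by (subst integral_Re[OF ci, symmetric])
      (simp add: torus_char_def inner_commute[of "axis i 1"] inner_axis)
  also have "\<dots> = real ((n - 1) * n ^ (CARD('n) - 1)) / real (n ^ CARD('n))"
    by (subst fejer_kernel_fourier_coeff[OF ax]) (simp add: card_lattice_box_shift[OF n] Re_divide_of_nat del: of_nat_mult of_nat_power)
  also have "\<dots> = 1 - 1 / real n"
    using n by (simp add: power_eq_if[of n "CARD('n)"] of_nat_diff field_simps)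
  finally show ?thesis
    using int1 intc fejer_kernel_integral[OF n, where 'n='n] by (simp add: right_diff_distrib)
qed

text \<open>
  The autocorrelation \<open>A x = \<integral> h t * h (t + x) dt\<close> has the Fourier coefficients \<open>|fourier_coeff h k|\<^sup>2\<close>
  and the value \<open>A 0 = \<integral> h\<^sup>2\<close>. Its mean against the Fejer kernel is an average of finite sums of
  these coefficients, hence at most \<open>B\<close>, and converges to \<open>A 0\<close> because \<open>A\<close> is continuous at 0. This
  continuity is where the almost everywhere continuity of \<open>h\<close> enters.
\<close>

proposition torus_parseval_le:
  fixes h :: "real^'n \<Rightarrow> real"
  assumes [measurable]: "h \<in> borel_measurable borel" and per: "periodic h"
    and bound: "\<And>x. \<bar>h x\<bar> \<le> S"
    and cont: "AE t in torus_haar. isCont h t"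
    and coeff: "\<And>K. finite K \<Longrightarrow> K \<subseteq> int_lattice \<Longrightarrow> (\<Sum>k\<in>K. (norm (fourier_coeff h k))\<^sup>2) \<le> B"
  shows "(LINT t|torus_haar. (h t)\<^sup>2) \<le> B"
proof -
  interpret prob_space "torus_haar :: (real^'n) measure" by (rule prob_space_torus_haar)
  interpret P: pair_prob_space "torus_haar :: (real^'n) measure" "torus_haar :: (real^'n) measure"
    by unfold_locales
  have S0: "S \<ge> 0" using bound[of 0] by linarith
  define A where "A x = (LINT t|torus_haar. h t * h (t + x))" for x
  have hh: "\<bar>h t * h u\<bar> \<le> S * S" for t u
    unfolding abs_mult using bound S0 by (intro mult_mono) auto
  have Am [measurable]: "A \<in> borel_measurable borel" unfolding A_def by measurable
  have Ab: "\<bar>A x\<bar> \<le> S * S" for x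
  proof -
    have "\<bar>A x\<bar> \<le> (LINT t|(torus_haar :: (real^'n) measure). S * S)"
      unfolding A_def by (rule integral_abs_bound_integral)
        (use hh in \<open>auto intro!: integrable_torus_haar_bounded[where B="S*S"]\<close>)
    then show ?thesis using prob_space by simp
  qed
  have Acont: "isCont A 0"
    unfolding continuous_at_sequentially
  proof (intro allI impI)
    fix X :: "nat \<Rightarrow> real^'n" assume X: "X \<longlonglongrightarrow> 0"
    show "(A \<circ> X) \<longlonglongrightarrow> A 0"
      unfolding A_def o_def
    proof (rule integral_dominated_convergence[where w="\<lambda>_. S * S"])
      show "AE t in torus_haar. (\<lambda>i. h t * h (t + X i)) \<longlonglongrightarrow> h t * h (t + 0)"
        using cont
      proof eventually_elim
        case (elim t)
        have "(\<lambda>i. t + X i) \<longlonglongrightarrow> t" using tendsto_add[OF tendsto_const X, of t] by simp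
        from isCont_tendsto_compose[OF elim this] show ?case by (intro tendsto_mult tendsto_const) simp
      qed
    qed (use hh in auto)
  qed
  have coefA: "(LINT x|torus_haar. of_real (A x) * torus_char k x) = of_real ((norm (fourier_coeff h k))\<^sup>2)"
    if k: "k \<in> int_lattice" for k
  proof -
    have "(LINT x|torus_haar. of_real (A x) * torus_char k x) =
       (LINT x|torus_haar. LINT t|torus_haar. of_real (h t * h (t + x)) * torus_char k x)"
      unfolding A_def by (simp only: integral_mult_left_zero integral_complex_of_real)
    also have "\<dots> = (LINT t|torus_haar. LINT x|torus_haar. of_real (h t * h (t + x)) * torus_char k x)"
    proof (rule P.Fubini_integral)
      show "integrable (torus_haar \<Otimes>\<^sub>M torus_haar) (\<lambda>(t, x). of_real (h t * h (t + x)) * torus_char k x)"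
        by (rule P.P.integrable_const_bound[where B="S * S"])
          (use hh in \<open>auto simp: norm_mult abs_mult\<close>)
    qed
    also have "\<dots> = (LINT t|torus_haar. of_real (h t) * cnj (torus_char k t) * fourier_coeff h k)"
    proof (intro Bochner_Integration.integral_cong refl)
      fix t
      have cc: "torus_char k x = cnj (torus_char k t) * torus_char k (x + t)" for x
        using torus_char_add[of k "- t" "x + t"] torus_char_uminus[of k t] by simp
      have "(LINT x|torus_haar. of_real (h t * h (t + x)) * torus_char k x) =
        (LINT x|torus_haar. of_real (h t) * cnj (torus_char k t) * (of_real (h (x + t)) * torus_char k (x + t)))"
        by (intro Bochner_Integration.integral_cong refl, subst cc) (simp add: add.commute mult_ac)
      also have "\<dots> = of_real (h t) * cnj (torus_char k t) *
         (LINT x|torus_haar. of_real (h (x + t)) * torus_char k (x + t))" by simp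
      also have "(LINT x|torus_haar. of_real (h (x + t)) * torus_char k (x + t)) = fourier_coeff h k"
        unfolding fourier_coeff_def
        by (rule integral_torus_translate[where f="\<lambda>x. of_real (h x) * torus_char k x"])
          (use per periodic_torus_char[OF k] in \<open>auto simp: periodic_def\<close>)
      finally show "(LINT x|torus_haar. of_real (h t * h (t + x)) * torus_char k x) =
         of_real (h t) * cnj (torus_char k t) * fourier_coeff h k" .
    qed
    also have "\<dots> = (LINT t|torus_haar. cnj (of_real (h t) * torus_char k t)) * fourier_coeff h k"
      by simp
    also have "\<dots> = cnj (fourier_coeff h k) * fourier_coeff h k"
      unfolding fourier_coeff_def by (simp only: Bochner_Integration.integral_cnj)
    also have "\<dots> = of_real ((norm (fourier_coeff h k))\<^sup>2)"
      by (simp only: complex_norm_square mult.commute)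
    finally show ?thesis .
  qed
  have KA: "(LINT x|torus_haar. fejer_kernel n x * A x) \<le> B" if n: "n > 0" for n
  proof -
    let ?J = "lattice_box n :: (real^'n) set"
    let ?c = "\<lambda>k. (norm (fourier_coeff h k))\<^sup>2"
    have i: "integrable torus_haar (\<lambda>x. of_real (A x) * torus_char k x)" for k :: "real^'n"
      by (rule integrable_torus_haar_bounded[where B="S*S"]) (use Ab in \<open>auto simp: norm_mult\<close>)
    have "complex_of_real (LINT x|torus_haar. fejer_kernel n x * A x) =
        (LINT x|torus_haar. (\<Sum>j\<in>?J. \<Sum>l\<in>?J. of_real (A x) * torus_char (j - l) x) / of_nat (n ^ CARD('n)))"
      by (subst integral_complex_of_real[symmetric], intro Bochner_Integration.integral_cong refl)
        (simp add: fejer_kernel_expand sum_distrib_left mult.commute)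
    also have "\<dots> = (\<Sum>j\<in>?J. \<Sum>l\<in>?J. LINT x|torus_haar. of_real (A x) * torus_char (j - l) x) / of_nat (n ^ CARD('n))"
      by (simp add: Bochner_Integration.integral_sum i)
    also have "(\<Sum>j\<in>?J. \<Sum>l\<in>?J. LINT x|torus_haar. of_real (A x) * torus_char (j - l) x) =
       (\<Sum>j\<in>?J. \<Sum>l\<in>?J. of_real (?c (j - l)))"
      by (intro sum.cong refl coefA) (auto simp: int_lattice_closed lattice_box_lattice)
    also have "\<dots> / of_nat (n ^ CARD('n)) = of_real ((\<Sum>j\<in>?J. \<Sum>l\<in>?J. ?c (j - l)) / real (n ^ CARD('n)))"
      by simp
    finally have "(LINT x|torus_haar. fejer_kernel n x * A x) = (\<Sum>j\<in>?J. \<Sum>l\<in>?J. ?c (j - l)) / real (n ^ CARD('n))"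
      by (simp only: of_real_eq_iff)
    also have "(\<Sum>j\<in>?J. \<Sum>l\<in>?J. ?c (j - l)) \<le> (\<Sum>j\<in>?J. B)"
    proof (rule sum_mono)
      fix j assume j: "j \<in> ?J"
      have "(\<Sum>l\<in>?J. ?c (j - l)) = (\<Sum>k\<in>(\<lambda>l. j - l) ` ?J. ?c k)"
        by (subst sum.reindex) (auto simp: inj_on_def)
      also have "\<dots> \<le> B" using j
        by (intro coeff) (auto simp: finite_lattice_box int_lattice_closed lattice_box_lattice)
      finally show "(\<Sum>l\<in>?J. ?c (j - l)) \<le> B" .
    qed
    also have "(\<Sum>j\<in>?J. B) / real (n ^ CARD('n)) = B" using n by (simp add: card_lattice_box)
    finally show ?thesis using n by (simp add: divide_right_mono)
  qed
  have "A 0 \<le> B + \<epsilon>" if eps: "\<epsilon> > 0" for \<epsilon>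
  proof -
    obtain \<delta> where \<delta>: "\<delta> > 0" "\<And>x. norm x < \<delta> \<Longrightarrow> \<bar>A x - A 0\<bar> < \<epsilon>"
      using Acont eps unfolding continuous_at_eps_delta by (auto simp: dist_norm)
    define d where "d = real CARD('n)"
    have d: "d > 0" by (simp add: d_def)
    \<comment> \<open>A point of the cube of norm at least \<open>\<delta>\<close> has a coordinate of size at least \<open>\<delta> / d\<close>; the cap \<open>1/2\<close> keeps
      \<open>2 \<pi> \<beta>\<close> in the range where the cosine decreases.\<close>
    define \<beta> where "\<beta> = min (\<delta> / d) (1/2)"
    have "0 < \<beta>" using \<delta>(1) d by (simp add: \<beta>_def)
    moreover have "\<beta> \<le> 1/2" unfolding \<beta>_def by (rule min.cobounded2)
    moreover have "\<beta> \<le> \<delta> / d" unfolding \<beta>_def by (rule min.cobounded1)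
    ultimately have \<beta>: "0 < \<beta>" "\<beta> \<le> 1/2" "\<beta> \<le> \<delta> / d" by auto
    define \<eta> where "\<eta> = 1 - cos (2 * pi * \<beta>)"
    have "2 * pi * \<beta> \<le> 2 * pi * (1/2)" using \<beta> by (intro mult_left_mono) auto
    then have bpi: "2 * pi * \<beta> \<le> pi" by simp
    have "cos (2 * pi * \<beta>) < cos 0" using \<beta> bpi by (intro cos_monotone_0_pi) auto
    then have \<eta>: "\<eta> > 0" by (simp add: \<eta>_def)
    define C where "C = 2 * (S * S) / \<eta>"
    have C0: "C \<ge> 0" using S0 \<eta> by (simp add: C_def)
    have [measurable]: "(\<lambda>x::real^'n. cos (2 * pi * x $ i)) \<in> borel_measurable borel" for i
      by (intro borel_measurable_continuous_onI continuous_intros)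
    have pt: "A 0 \<le> A x + \<epsilon> + C * (\<Sum>i\<in>UNIV. 1 - cos (2 * pi * x $ i))" if x: "x \<in> torus_cube" for x
    proof (cases "norm x < \<delta>")
      case True
      have "0 \<le> C * (\<Sum>i\<in>UNIV. 1 - cos (2 * pi * x $ i))"
        using C0 by (intro mult_nonneg_nonneg sum_nonneg) auto
      then show ?thesis using \<delta>(2)[OF True] by linarith
    next
      case False
      have "\<exists>i. \<beta> \<le> \<bar>x $ i\<bar>"
      proof (rule ccontr)
        assume "\<not> ?thesis"
        then have "\<bar>x $ i\<bar> < \<beta>" for i by (meson not_le)
        then have "(\<Sum>i\<in>UNIV. \<bar>x $ i\<bar>) < (\<Sum>i\<in>(UNIV::'n set). \<beta>)" by (intro sum_strict_mono) auto
        also have "\<dots> = d * \<beta>" by (simp add: d_def)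
        also have "\<dots> \<le> d * (\<delta> / d)" using \<beta>(3) d by (intro mult_left_mono) auto
        also have "\<dots> = \<delta>" using d by simp
        finally show False using False norm_le_l1_cart[of x] by linarith
      qed
      then obtain i where i: "\<beta> \<le> \<bar>x $ i\<bar>" by blast
      have "\<bar>x $ i\<bar> \<le> 1/2" using x by (auto simp: torus_cube_def abs_le_iff dest: spec[of _ i])
      then have "2 * pi * \<bar>x $ i\<bar> \<le> 2 * pi * (1/2)" by (intro mult_left_mono) auto
      then have "cos (2 * pi * \<bar>x $ i\<bar>) \<le> cos (2 * pi * \<beta>)"
        using i \<beta> by (intro cos_monotone_0_pi_le) auto
      moreover have "cos (2 * pi * \<bar>x $ i\<bar>) = cos (2 * pi * x $ i)"
        by (cases "x $ i \<ge> 0") (auto simp: abs_if)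
      ultimately have "\<eta> \<le> 1 - cos (2 * pi * x $ i)" by (simp add: \<eta>_def)
      also have "\<dots> \<le> (\<Sum>i\<in>UNIV. 1 - cos (2 * pi * x $ i))"
        by (rule member_le_sum) auto
      finally have "C * \<eta> \<le> C * (\<Sum>i\<in>UNIV. 1 - cos (2 * pi * x $ i))" using C0 by (rule mult_left_mono)
      moreover have "C * \<eta> = 2 * (S * S)" using \<eta> by (simp add: C_def)
      ultimately show ?thesis using Ab[of x] Ab[of 0] eps by linarith
    qed
    have n_bound: "A 0 \<le> B + \<epsilon> + C * d / real n" if n: "n > 0" for n :: nat
    proof -
      let ?K = "fejer_kernel n :: real^'n \<Rightarrow> real"
      have i1: "integrable torus_haar (\<lambda>x. ?K x * c)" for c
        by (rule integrable_fejer_kernel_mult[where B="\<bar>c\<bar>"]) auto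
      have iA: "integrable torus_haar (\<lambda>x. ?K x * A x)"
        by (rule integrable_fejer_kernel_mult[where B="S*S"]) (use Ab in auto)
      have ic: "integrable torus_haar (\<lambda>x. ?K x * (1 - cos (2 * pi * x $ i)))" for i
      proof (rule integrable_fejer_kernel_mult[where B=2])
        show "\<bar>1 - cos (2 * pi * x $ i)\<bar> \<le> 2" for x :: "real^'n"
          using cos_le_one[of "2 * pi * x $ i"] cos_ge_minus_one[of "2 * pi * x $ i"] by linarith
      qed auto
      have "A 0 = (LINT x|torus_haar. ?K x * A 0)"
        using fejer_kernel_integral[OF n, where 'n='n] by simp
      also have "\<dots> \<le> (LINT x|torus_haar. ?K x * A x + ?K x * \<epsilon> + C * (\<Sum>i\<in>UNIV. ?K x * (1 - cos (2 * pi * x $ i))))"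
      proof (rule integral_mono_AE)
        show "AE x in torus_haar. ?K x * A 0 \<le> ?K x * A x + ?K x * \<epsilon> + C * (\<Sum>i\<in>UNIV. ?K x * (1 - cos (2 * pi * x $ i)))"
          using AE_torus_haar
        proof eventually_elim
          case (elim x)
          show ?case using mult_left_mono[OF pt[OF elim] fejer_kernel_nonneg[of n x]]
            by (simp add: distrib_left sum_distrib_left[symmetric] mult.left_commute)
        qed
      qed (intro i1 iA ic Bochner_Integration.integrable_add integrable_mult_right Bochner_Integration.integrable_sum)+
      also have "\<dots> = (LINT x|torus_haar. ?K x * A x) + (LINT x|torus_haar. ?K x * \<epsilon>) +
          C * (\<Sum>i\<in>(UNIV::'n set). LINT x|torus_haar. ?K x * (1 - cos (2 * pi * x $ i)))"
        by (subst Bochner_Integration.integral_add, intro Bochner_Integration.integrable_add i1 iA,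
            intro integrable_mult_right Bochner_Integration.integrable_sum ic,
            subst Bochner_Integration.integral_add, rule iA, rule i1,
            subst integral_mult_right_zero, subst Bochner_Integration.integral_sum, rule ic, rule refl)
      also have "\<dots> \<le> B + \<epsilon> + C * (\<Sum>i\<in>(UNIV::'n set). 1 / real n)"
        using KA[OF n] fejer_kernel_integral[OF n, where 'n='n] fejer_kernel_concentrates[OF n, where 'n='n] by simp
      finally show ?thesis by (simp add: d_def)
    qed
    show ?thesis
    proof (rule LIMSEQ_le_const)
      show "(\<lambda>n. B + \<epsilon> + C * d / real n) \<longlonglongrightarrow> B + \<epsilon>"
        using tendsto_add[OF tendsto_const lim_const_over_n[of "C * d"], of "B + \<epsilon>"] by simp
      show "\<exists>N. \<forall>n\<ge>N. A 0 \<le> B + \<epsilon> + C * d / real n"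
        by (intro exI[of _ 1]) (auto intro!: n_bound)
    qed
  qed
  then have "A 0 \<le> B" by (rule field_le_epsilon)
  then show ?thesis by (simp add: A_def power2_eq_square)
qed

section \<open>A convergent sum over the integer lattice\<close>

text \<open>
  The norm of a nonzero lattice vector is at least \<open>max 1 |m\<^sub>i|\<close> for every coordinate. Splitting the
  exponent evenly among the \<open>d\<close> coordinates bounds the sum by a product of \<open>d\<close> one-dimensional
  sums with exponent \<open>-(1 + 1/d)\<close>, which converge.
\<close>

lemma lattice_sum_bounded:
  "\<exists>S\<ge>0. \<forall>K. finite K \<longrightarrow> K \<subseteq> int_lattice - {0 :: real^'n} \<longrightarrow>
     (\<Sum>m\<in>K. norm m powr (- (real CARD('n) + 1))) \<le> S"
proof -
  define a where "a = 1 + 1 / real CARD('n)"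
  have a: "a > 1" by (simp add: a_def)
  define w where "w z = max 1 \<bar>z\<bar> powr (- a)" for z :: real
  have w0: "w z \<ge> 0" for z by (simp add: w_def)
  have sum: "summable (\<lambda>n. w (real n))"
  proof (rule summable_cong[THEN iffD1])
    show "summable (\<lambda>n. real n powr (- a))" using a by (simp add: summable_real_powr_iff)
    show "\<forall>\<^sub>F n in sequentially. real n powr (- a) = w (real n)"
      using eventually_ge_at_top[of 1] by eventually_elim (simp add: w_def max_def)
  qed
  define S where "S = (2 * (\<Sum>n. w (real n))) ^ CARD('n)"
  have S0: "S \<ge> 0" unfolding S_def by (intro zero_le_power mult_nonneg_nonneg suminf_nonneg sum w0) auto
  have one_dim: "(\<Sum>z\<in>{-int L..int L}. w (of_int z)) \<le> 2 * (\<Sum>n. w (real n))" for L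
  proof -
    have "{-int L..int L} \<subseteq> int ` {..L} \<union> (\<lambda>n. - int n) ` {..L}"
    proof
      fix z assume "z \<in> {-int L..int L}"
      then have "z = int (nat z) \<and> nat z \<le> L \<or> z = - int (nat (-z)) \<and> nat (-z) \<le> L" by auto
      then show "z \<in> int ` {..L} \<union> (\<lambda>n. - int n) ` {..L}" by blast
    qed
    then have "(\<Sum>z\<in>{-int L..int L}. w (of_int z)) \<le> (\<Sum>z\<in>int ` {..L} \<union> (\<lambda>n. - int n) ` {..L}. w (of_int z))"
      by (intro sum_mono2) (auto simp: w0)
    also have "\<dots> \<le> (\<Sum>z\<in>int ` {..L}. w (of_int z)) + (\<Sum>z\<in>(\<lambda>n. - int n) ` {..L}. w (of_int z))"
      by (subst sum_Un) (auto intro!: sum_nonneg simp: w0)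
    also have "\<dots> = 2 * (\<Sum>n\<le>L. w (real n))"
      by (subst (1 2) sum.reindex) (auto simp: inj_on_def w_def)
    also have "\<dots> \<le> 2 * (\<Sum>n. w (real n))"
      by (intro mult_left_mono sum_le_suminf sum) (auto simp: w0)
    finally show ?thesis .
  qed
  have term_le: "norm m powr (- (real CARD('n) + 1)) \<le> (\<Prod>i\<in>UNIV. w (m $ i))"
    if m: "m \<in> int_lattice - {0}" for m :: "real^'n"
  proof -
    obtain i where i: "m $ i \<noteq> 0" using m by (auto simp: vec_eq_iff)
    have "m $ i \<in> \<int>" using m by (auto simp: int_lattice_def)
    then have "\<bar>m $ i\<bar> \<ge> 1" using i by (rule Ints_nonzero_abs_ge1)
    then have n1: "norm m \<ge> 1" using component_le_norm_cart[of m i] by linarith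
    have "norm m powr (- (real CARD('n) + 1)) = norm m powr (- a * real CARD('n))"
    proof -
      have "a * real CARD('n) = real CARD('n) + 1" by (simp add: a_def distrib_right)
      then show ?thesis by simp
    qed
    also have "\<dots> = (norm m powr (- a)) ^ CARD('n)"
    proof -
      have "(norm m powr (- a)) ^ CARD('n) = (norm m powr (- a)) powr real CARD('n)"
        using n1 by (subst powr_realpow) auto
      then show ?thesis by (simp only: powr_powr)
    qed
    also have "\<dots> = (\<Prod>i\<in>(UNIV :: 'n set). norm m powr (- a))" by simp
    also have "\<dots> \<le> (\<Prod>i\<in>UNIV. w (m $ i))"
    proof (intro prod_mono conjI)
      fix i
      show "norm m powr (- a) \<le> w (m $ i)"
        unfolding w_def using a n1 component_le_norm_cart[of m i] by (intro powr_mono2') auto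
    qed auto
    finally show ?thesis .
  qed
  have "(\<Sum>m\<in>K. norm m powr (- (real CARD('n) + 1))) \<le> S"
    if K: "finite K" "K \<subseteq> int_lattice - {0 :: real^'n}" for K
  proof -
    obtain L where L: "\<And>m. m \<in> K \<Longrightarrow> norm m \<le> real L"
    proof -
      have "bounded K" using K(1) by (rule finite_imp_bounded)
      then obtain b where b: "\<And>m. m \<in> K \<Longrightarrow> norm m \<le> b" by (auto simp: bounded_iff)
      show thesis
        by (rule that[of "nat \<lceil>b\<rceil>"]) (use b real_nat_ceiling_ge[of b] order.trans in blast)
    qed
    let ?v = "\<lambda>f :: 'n \<Rightarrow> int. (\<chi> i. of_int (f i)) :: real^'n"
    let ?P = "PiE UNIV (\<lambda>_::'n. {-int L..int L})"
    have sub: "K \<subseteq> ?v ` ?P"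
    proof
      fix m assume m: "m \<in> K"
      then have mi: "m $ i = of_int \<lfloor>m $ i\<rfloor>" for i using K by (auto simp: int_lattice_def)
      have "\<bar>m $ i\<bar> \<le> real L" for i using L[OF m] component_le_norm_cart[of m i] by linarith
      then have Li: "\<bar>real_of_int \<lfloor>m $ i\<rfloor>\<bar> \<le> real L" for i using mi[of i] by simp
      have "\<lfloor>m $ i\<rfloor> \<in> {-int L..int L}" for i
        using Li[of i] by auto
      then show "m \<in> ?v ` ?P" using mi by (intro image_eqI[where x="\<lambda>i. \<lfloor>m $ i\<rfloor>"]) (auto simp: vec_eq_iff)
    qed
    have "(\<Sum>m\<in>K. norm m powr (- (real CARD('n) + 1))) \<le> (\<Sum>m\<in>K. \<Prod>i\<in>UNIV. w (m $ i))"
      using K by (intro sum_mono term_le) auto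
    also have "\<dots> \<le> (\<Sum>m\<in>?v ` ?P. \<Prod>i\<in>UNIV. w (m $ i))"
      by (intro sum_mono2 sub finite_imageI finite_PiE prod_nonneg) (auto simp: w0)
    also have "\<dots> = (\<Sum>f\<in>?P. \<Prod>i\<in>UNIV. w (of_int (f i)))"
      by (subst sum.reindex) (auto simp: inj_on_def vec_eq_iff)
    also have "\<dots> = (\<Prod>i\<in>(UNIV::'n set). \<Sum>z\<in>{-int L..int L}. w (of_int z))"
      by (subst prod_sum_PiE) auto
    also have "\<dots> \<le> (\<Prod>i\<in>(UNIV::'n set). 2 * (\<Sum>n. w (real n)))"
      by (intro prod_mono conjI sum_nonneg one_dim) (auto simp: w0)
    also have "\<dots> = S" by (simp add: S_def)
    finally show ?thesis .
  qed
  with S0 show ?thesis by blast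
qed

section \<open>The periodic indicator of a ball\<close>

text \<open>
  The representative in the cube has least norm in its class; hence the norm of the representative
  is the distance to the lattice.
\<close>

lemma norm_torus_rep_le:
  assumes "k \<in> int_lattice"
  shows "norm (torus_rep x) \<le> norm (x + k)"
proof -
  have "norm (torus_rep y $ i) \<le> norm (y $ i)" for y :: "real^'n" and i
  proof -
    have "(torus_rep y - y) $ i \<in> \<int>" using torus_rep_diff[of y] by (simp add: int_lattice_def)
    then obtain z where z: "torus_rep y $ i - y $ i = of_int z" by (auto elim: Ints_cases)
    have q: "- 1/2 \<le> torus_rep y $ i" "torus_rep y $ i < 1/2"
      using torus_rep_in_cube[of y] by (auto simp: torus_cube_def)
    have "z = 0 \<or> real_of_int z \<ge> 1 \<or> real_of_int z \<le> -1"
      by linarith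
    then show ?thesis using z q by auto
  qed
  then have "norm (torus_rep (x + k)) \<le> norm (x + k)" by (rule norm_le_componentwise_cart)
  then show ?thesis by (simp add: torus_rep_add_lattice[OF assms])
qed

text \<open>
  Being a distance to a set, the function is 1-Lipschitz, although \<open>torus_rep\<close> itself jumps.
\<close>

lemma continuous_norm_torus_rep: "continuous_on UNIV (\<lambda>x :: real^'n. norm (torus_rep x))"
proof -
  have le: "norm (torus_rep x) \<le> norm (torus_rep y) + dist x y" for x y :: "real^'n"
  proof -
    have "norm (torus_rep x) \<le> norm (x + (torus_rep y - y))"
      by (rule norm_torus_rep_le[OF torus_rep_diff])
    also have "x + (torus_rep y - y) = torus_rep y + (x - y)" by simp
    also have "norm \<dots> \<le> norm (torus_rep y) + dist x y"
      unfolding dist_norm by (rule norm_triangle_ineq)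
    finally show ?thesis .
  qed
  have "dist (norm (torus_rep x)) (norm (torus_rep y)) \<le> dist x y" for x y :: "real^'n"
    using le[of x y] le[of y x] by (simp add: dist_real_def dist_commute abs_le_iff)
  then show ?thesis unfolding continuous_on_iff by (metis le_less_trans)
qed

text \<open>
  The periodic indicator of the ball, through the distance to the lattice rather than through
  a union of balls: measurability and continuity off the sphere are then immediate.
\<close>

definition torus_ball :: "real \<Rightarrow> real^'n \<Rightarrow> real" where
  "torus_ball r x = indicator {..r} (norm (torus_rep x))"

lemma torus_ball_measurable [measurable]: "torus_ball r \<in> borel_measurable borel"
  unfolding torus_ball_def by measurable

lemma torus_ball_range: "0 \<le> torus_ball r x" "torus_ball r x \<le> 1" "\<bar>torus_ball r x\<bar> \<le> 1"
  by (auto simp: torus_ball_def indicator_def)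

lemma torus_ball_add_lattice: "k \<in> int_lattice \<Longrightarrow> torus_ball r (x + k) = torus_ball r x"
  by (simp add: torus_ball_def torus_rep_add_lattice)

lemma periodic_torus_ball_translate: "periodic (\<lambda>x :: real^'n. torus_ball r (x + a))"
  unfolding periodic_def
proof (intro allI ballI)
  fix x k :: "real^'n" assume "k \<in> int_lattice"
  then show "torus_ball r (x + k + a) = torus_ball r (x + a)"
    using torus_ball_add_lattice[of k r "x + a"] by (simp add: ac_simps)
qed

lemma indicator_shifted_ball: "indicator (shifted_ball r t) v = torus_ball r (v + t)"
proof -
  have "(\<exists>k\<in>int_lattice. norm (v + t + k) \<le> r) \<longleftrightarrow> norm (torus_rep (v + t)) \<le> r"
  proof
    assume "norm (torus_rep (v + t)) \<le> r"
    then show "\<exists>k\<in>int_lattice. norm (v + t + k) \<le> r"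
      using torus_rep_diff[of "v + t"] by (intro bexI[of _ "torus_rep (v + t) - (v + t)"]) auto
  qed (use norm_torus_rep_le order.trans in blast)
  then show ?thesis by (auto simp: shifted_ball_def torus_ball_def indicator_def)
qed

lemma isCont_torus_ball:
  assumes "norm (torus_rep x) \<noteq> r"
  shows "isCont (torus_ball r) x"
proof -
  let ?D = "\<lambda>x :: real^'n. norm (torus_rep x)"
  have o: "open {y. ?D y < r}" "open {y. r < ?D y}"
    by (intro open_Collect_less continuous_norm_torus_rep continuous_on_const)+
  have "\<forall>\<^sub>F y in nhds x. torus_ball r y = torus_ball r x"
  proof (cases "?D x < r")
    case True
    then show ?thesis
      by (intro eventually_nhds_in_open[OF o(1), THEN eventually_mono]) (auto simp: torus_ball_def)
  next
    case False
    then show ?thesis using assms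
      by (intro eventually_nhds_in_open[OF o(2), THEN eventually_mono]) (auto simp: torus_ball_def)
  qed
  then show ?thesis by (subst isCont_cong[where g="\<lambda>_. torus_ball r x"]) auto
qed

text \<open>
  The discontinuities lie on countably many spheres.
\<close>

lemma AE_isCont_torus_ball_translate:
  "AE t in torus_haar. isCont (\<lambda>t. torus_ball r (t + a)) (t :: real^'n)"
proof -
  have "AE t in lborel. \<forall>k\<in>int_lattice. (t :: real^'n) \<notin> sphere (k - a) r"
  proof (subst AE_ball_countable[OF countable_int_lattice], intro ballI AE_not_in)
    fix k :: "real^'n"
    show "sphere (k - a) r \<in> null_sets lborel"
      using negligible_sphere[of "k - a" r]
      by (auto simp: null_sets_completion_iff negligible_iff_null_sets)
  qed
  then have "AE t in lborel. isCont (\<lambda>t. torus_ball r (t + a)) (t :: real^'n)"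
  proof eventually_elim
    case (elim t)
    have "t + a - torus_rep (t + a) \<in> int_lattice"
      using int_lattice_closed(4)[OF torus_rep_diff[of "t + a"]] by simp
    then have "t \<notin> sphere ((t + a - torus_rep (t + a)) - a) r" using elim by blast
    then have "norm (torus_rep (t + a)) \<noteq> r" by (simp add: dist_norm norm_minus_commute)
    moreover have "isCont (\<lambda>t. t + a) t" by (intro continuous_intros)
    ultimately show ?case
      using isCont_o2[of t "\<lambda>t. t + a" "torus_ball r"] isCont_torus_ball[of "t + a" r] by blast
  qed
  then show ?thesis unfolding torus_haar_def by (subst AE_density) auto
qed

lemma small_norm_in_torus_cube:
  fixes x :: "real^'n"
  assumes "norm x < 1/2"
  shows "x \<in> torus_cube"
proof -
  have "\<bar>x $ i\<bar> < 1/2" for i using component_le_norm_cart[of x i] assms by linarith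
  then have "- 1/2 \<le> x $ i \<and> x $ i < 1/2" for i
    using abs_less_iff[of "x $ i" "1/2"] by (metis less_imp_le minus_divide_left minus_less_iff)
  then show ?thesis unfolding torus_cube_def by blast
qed

lemma integral_torus_ball:
  fixes g :: "real^'n \<Rightarrow> complex"
  assumes r: "r < 1/2" and [measurable]: "g \<in> borel_measurable borel"
  shows "(LINT t|torus_haar. of_real (torus_ball r t) * g t) = (LINT t|lborel. indicator (cball 0 r) t *\<^sub>R g t)"
proof -
  have "(LINT t|torus_haar. of_real (torus_ball r t) * g t) = (LINT t:torus_cube|lborel. of_real (torus_ball r t) * g t)"
    by (rule integral_torus_haar) measurable
  also have "\<dots> = (LINT t|lborel. indicator (cball 0 r) t *\<^sub>R g t)"
    unfolding set_lebesgue_integral_def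
  proof (intro Bochner_Integration.integral_cong refl)
    fix t :: "real^'n"
    have "t \<in> torus_cube" if "norm t \<le> r" using that r by (intro small_norm_in_torus_cube) simp
    then show "indicator torus_cube t *\<^sub>R (of_real (torus_ball r t) * g t) = indicator (cball 0 r) t *\<^sub>R g t"
      by (auto simp: indicator_def torus_ball_def torus_rep_id)
  qed
  finally show ?thesis .
qed

lemma integral_torus_ball_volume:
  assumes "0 < r" "r < 1/2"
  shows "(LINT t|torus_haar. torus_ball r (t :: real^'n)) = r ^ CARD('n) * measure lborel (cball (0::real^'n) 1)"
proof -
  have "complex_of_real (LINT t|torus_haar. torus_ball r (t :: real^'n)) = (LINT t|torus_haar. of_real (torus_ball r (t :: real^'n)) * 1)"
    by simp
  also have "\<dots> = (LINT t|lborel. complex_of_real (indicator (cball (0::real^'n) r) t))"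
    by (subst integral_torus_ball[OF assms(2)]) (auto simp: scaleR_conv_of_real)
  also have "\<dots> = of_real (measure lborel (cball (0::real^'n) r))"
    by (subst integral_complex_of_real) simp
  also have "measure lborel (cball (0::real^'n) r) = r ^ CARD('n) * measure lborel (cball (0::real^'n) 1)"
    using assms by (simp add: content_cball mult.commute)
  finally show ?thesis by (simp only: of_real_eq_iff)
qed

lemma fourier_coeff_torus_ball_decay:
  assumes r: "0 < r" "r < 1/2"
  shows "\<exists>C\<ge>0. \<forall>k :: real^'n. k \<noteq> 0 \<longrightarrow>
     (norm (fourier_coeff (torus_ball r) k))\<^sup>2 \<le> C * norm k powr (- (real CARD('n) + 1))"
proof -
  let ?e = "(real CARD('n) + 1)"
  obtain C where C: "C \<ge> 0" "\<And>\<xi> :: real^'n. \<xi> \<noteq> 0 \<Longrightarrow>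
     norm (LINT x|lborel. indicator (cball 0 r) x *\<^sub>R cis (x \<bullet> \<xi>)) \<le> C * norm \<xi> powr (- ?e / 2)"
    using fourier_ball_decay[OF r(1)] by blast
  have "(norm (fourier_coeff (torus_ball r) k))\<^sup>2 \<le> C\<^sup>2 * norm k powr (- ?e)" if k: "k \<noteq> 0" for k :: "real^'n"
  proof -
    have "fourier_coeff (torus_ball r) k = (LINT x|lborel. indicator (cball 0 r) x *\<^sub>R torus_char k x)"
      unfolding fourier_coeff_def by (rule integral_torus_ball[OF r(2)]) measurable
    also have "\<dots> = (LINT x|lborel. indicator (cball 0 r) x *\<^sub>R cis (x \<bullet> ((2 * pi) *\<^sub>R k)))"
      by (simp add: torus_char_def inner_commute)
    also have "norm \<dots> \<le> C * norm ((2 * pi) *\<^sub>R k) powr (- ?e / 2)"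
      using k by (intro C) auto
    also have "\<dots> \<le> C * norm k powr (- ?e / 2)"
    proof (intro mult_left_mono C powr_mono2')
      have "1 \<le> 2 * pi" using pi_gt3 by linarith
      then show "norm k \<le> norm ((2 * pi) *\<^sub>R k)"
        using mult_right_mono[of 1 "2 * pi" "norm k"] by simp
    qed (use k in auto)
    finally have "(norm (fourier_coeff (torus_ball r) k))\<^sup>2 \<le> (C * norm k powr (- ?e / 2))\<^sup>2"
      by (intro power_mono) auto
    also have "\<dots> = C\<^sup>2 * norm k powr (- ?e)"
    proof -
      have "(norm k powr (- ?e / 2))\<^sup>2 = norm k powr (- ?e / 2 * real 2)"
        using k by (subst powr_realpow[symmetric]) (simp_all only: powr_powr, simp)
      also have "- ?e / 2 * real 2 = - ?e" by simp
      finally show ?thesis by (simp only: power_mult_distrib)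
    qed
    finally show ?thesis .
  qed
  then show ?thesis by (intro exI[of _ "C\<^sup>2"]) auto
qed

section \<open>Mean square discrepancy of the grid\<close>

lemma finite_grid: "M > 0 \<Longrightarrow> finite (grid M :: (real^'n) set)"
  using card_grid[of M, where 'n='n] by (intro card_ge_0_finite) simp

lemma grid_translate_closed:
  assumes M: "M > 0" and x: "x \<in> grid M" and a: "a \<in> int_lattice"
  shows "torus_rep (x + (1 / real M) *\<^sub>R a) \<in> grid M"
proof -
  obtain k where k: "k \<in> int_lattice" "x = (1 / real M) *\<^sub>R k" using x by (auto simp: grid_def)
  let ?y = "x + (1 / real M) *\<^sub>R a"
  have "torus_rep ?y = (1 / real M) *\<^sub>R (k + a + real M *\<^sub>R (torus_rep ?y - ?y))"
    using M k by (simp add: algebra_simps)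
  moreover have "real M *\<^sub>R (torus_rep ?y - ?y) \<in> int_lattice"
    using torus_rep_diff[of ?y] by (auto simp: int_lattice_def)
  ultimately show ?thesis
    using torus_rep_in_cube k(1) a unfolding grid_def by (blast intro: int_lattice_closed)
qed

text \<open>
  Moving by one grid step permutes the grid modulo the lattice and multiplies the sum by a number different
  from 1 for some coordinate direction.
\<close>

lemma sum_grid_char:
  assumes M: "M > 0" and k: "k \<in> int_lattice" "(1 / real M) *\<^sub>R k \<notin> int_lattice"
  shows "(\<Sum>s\<in>(grid M :: (real^'n) set). torus_char k s) = 0"
proof -
  obtain i where i: "k $ i / real M \<notin> \<int>" using k(2) by (auto simp: int_lattice_def)
  have ax: "axis i 1 \<in> (int_lattice :: (real^'n) set)" by (auto simp: int_lattice_def axis_def)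
  define a where "a = (1 / real M) *\<^sub>R (axis i 1 :: real^'n)"
  have na: "- a = (1 / real M) *\<^sub>R (- axis i 1 :: real^'n)" by (simp add: a_def)
  have rep: "torus_rep (torus_rep (x + b) + c) = torus_rep (x + b + c)" for x b c :: "real^'n"
    using torus_rep_add_lattice[OF torus_rep_diff[of "x + b"], of "x + b + c"] by (simp add: algebra_simps)
  have "bij_betw (\<lambda>x. torus_rep (x + a)) (grid M) (grid M)"
  proof (rule bij_betwI[where g="\<lambda>x. torus_rep (x + - a)"])
    show "(\<lambda>x. torus_rep (x + a)) \<in> grid M \<rightarrow> grid M"
      unfolding a_def using grid_translate_closed[OF M _ ax] by blast
    show "(\<lambda>x. torus_rep (x + - a)) \<in> grid M \<rightarrow> grid M"
      unfolding na using grid_translate_closed[OF M _ int_lattice_closed(4)[OF ax]] by blast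
    show "torus_rep (torus_rep (x + a) + - a) = x" "torus_rep (torus_rep (x + - a) + a) = x" if "x \<in> grid M" for x
      using that torus_rep_id[of x] unfolding rep by (auto simp: grid_def)
  qed
  then have "(\<Sum>s\<in>grid M. torus_char k s) = (\<Sum>s\<in>grid M. torus_char k (torus_rep (s + a)))"
    by (rule sum.reindex_bij_betw[symmetric])
  also have "\<dots> = (\<Sum>s\<in>grid M. torus_char k s) * torus_char k a"
    by (simp add: periodic_torus_rep[OF periodic_torus_char[OF k(1)]] torus_char_add sum_distrib_right)
  finally have eq: "(\<Sum>s\<in>grid M. torus_char k s) * (torus_char k a - 1) = 0" by (simp add: algebra_simps)
  have "torus_char k a \<noteq> 1"
  proof
    assume "torus_char k a = 1"
    then have "cis (2 * pi * (k $ i / real M)) = 1"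
      by (simp add: torus_char_def a_def inner_axis)
    then have "cos (2 * pi * (k $ i / real M)) = 1"
      by (metis cis.simps(1) one_complex.simps(1))
    then obtain z :: int where "2 * pi * (k $ i / real M) = of_int z * 2 * pi"
      by (auto simp: cos_one_2pi_int)
    then have "(2 * pi) * (k $ i / real M) = (2 * pi) * of_int z" by (simp only: mult_ac)
    then have "k $ i / real M = of_int z" by (subst (asm) mult_left_cancel) auto
    then show False using i by simp
  qed
  then show ?thesis using eq by simp
qed

text \<open>
  For a point mass at the origin the random points are the reflected grid points, and this is their discrepancy
  function.
\<close>

definition grid_discrepancy :: "real \<Rightarrow> nat \<Rightarrow> real^'n \<Rightarrow> real" where
  "grid_discrepancy r M t = (\<Sum>s\<in>grid M. torus_ball r (t - s))
     - real (card (grid M :: (real^'n) set)) * r ^ CARD('n) * measure lborel (cball (0::real^'n) 1)"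

lemma grid_discrepancy_measurable [measurable]: "grid_discrepancy r M \<in> borel_measurable borel"
  unfolding grid_discrepancy_def by measurable

lemma periodic_grid_discrepancy: "periodic (grid_discrepancy r M :: real^'n \<Rightarrow> real)"
  unfolding periodic_def grid_discrepancy_def
proof (intro allI ballI arg_cong2[where f="(-)"] sum.cong refl)
  fix x k s :: "real^'n" assume "k \<in> int_lattice"
  then show "torus_ball r (x + k - s) = torus_ball r (x - s)"
    using periodic_torus_ball_translate[of r "- s"] by (simp add: periodic_def)
qed

text \<open>
  By translation invariance the coefficient is that of the ball times the sum of a character over the grid, and
  the constant term removes the coefficient at 0.
\<close>

lemma fourier_coeff_grid_discrepancy:
  fixes k :: "real^'n"
  assumes r: "0 < r" "r < 1/2" and M: "M > 0" and k: "k \<in> int_lattice"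
  shows "fourier_coeff (grid_discrepancy r M) k =
     (if k \<noteq> 0 \<and> (1 / real M) *\<^sub>R k \<in> int_lattice
      then of_nat (M ^ CARD('n)) * fourier_coeff (torus_ball r) k else 0)"
proof -
  let ?p = "r ^ CARD('n) * measure lborel (cball (0::real^'n) 1)"
  let ?G = "grid M :: (real^'n) set"
  have i: "integrable torus_haar (\<lambda>t. of_real (torus_ball r (t - s)) * torus_char k t)" for s
    by (rule integrable_torus_haar_bounded[where B=1])
      (use torus_ball_range in \<open>auto simp: norm_mult\<close>)
  have i1: "integrable torus_haar (torus_char k)"
    by (rule integrable_torus_haar_bounded[where B=1]) auto
  have shift: "(LINT t|torus_haar. of_real (torus_ball r (t - s)) * torus_char k t)
      = torus_char k s * fourier_coeff (torus_ball r) k" for s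
  proof -
    have "(LINT t|torus_haar. of_real (torus_ball r (t - s)) * torus_char k t)
      = (LINT t|torus_haar. of_real (torus_ball r ((t + s) - s)) * torus_char k (t + s))"
      by (rule integral_torus_translate[symmetric])
        (use periodic_torus_ball_translate[of r "-s"] periodic_torus_char[OF k] in \<open>auto simp: periodic_def\<close>)
    also have "\<dots> = (LINT t|torus_haar. torus_char k s * (of_real (torus_ball r t) * torus_char k t))"
      by (simp add: torus_char_add mult_ac)
    finally show ?thesis by (simp add: fourier_coeff_def)
  qed
  have "fourier_coeff (grid_discrepancy r M) k =
     (LINT t|torus_haar. (\<Sum>s\<in>?G. of_real (torus_ball r (t - s)) * torus_char k t) - of_real (real (card ?G) * ?p) * torus_char k t)"
    unfolding fourier_coeff_def grid_discrepancy_def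
    by (intro Bochner_Integration.integral_cong) (simp_all add: sum_distrib_right left_diff_distrib)
  also have "\<dots> = (\<Sum>s\<in>?G. torus_char k s * fourier_coeff (torus_ball r) k)
      - of_real (real (card ?G) * ?p) * (LINT t|torus_haar. torus_char k t)"
    using i i1 by (simp add: Bochner_Integration.integral_diff Bochner_Integration.integral_sum shift)
  also have "\<dots> = (\<Sum>s\<in>?G. torus_char k s) * fourier_coeff (torus_ball r) k
      - of_real (real (card ?G) * ?p) * (if k = 0 then 1 else 0)"
    by (simp add: sum_distrib_right integral_torus_char[OF k])
  finally have main: "fourier_coeff (grid_discrepancy r M) k = (\<Sum>s\<in>?G. torus_char k s) * fourier_coeff (torus_ball r) k
      - of_real (real (card ?G) * ?p) * (if k = 0 then 1 else 0)" .
  show ?thesis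
  proof (cases "k = 0")
    case True
    have "fourier_coeff (torus_ball r) (0 :: real^'n) = of_real ?p"
      unfolding fourier_coeff_def using integral_torus_ball_volume[OF r, where 'n='n]
      by (simp add: torus_char_def)
    then show ?thesis using True main by (simp add: torus_char_def)
  next
    case False
    have "(\<Sum>s\<in>?G. torus_char k s) = of_nat (M ^ CARD('n))" if km: "(1 / real M) *\<^sub>R k \<in> int_lattice"
    proof -
      have "torus_char k s = 1" if s: "s \<in> ?G" for s
      proof -
        obtain l where l: "l \<in> int_lattice" "s = (1 / real M) *\<^sub>R l" using s by (auto simp: grid_def)
        have "k \<bullet> s = ((1 / real M) *\<^sub>R k) \<bullet> l" by (simp add: l)
        then show ?thesis using lattice_inner_int[OF km l(1)] by (intro torus_char_eq_1_int) simp
      qed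
      then show ?thesis by (simp add: card_grid[OF M])
    qed
    then show ?thesis using False sum_grid_char[OF M k] by (auto simp: main)
  qed
qed

text \<open>
  The frequencies are spaced by \<open>M\<close>, so the decay of the coefficients of the ball contributes
  \<open>M powr (-(d + 1))\<close> against the factor \<open>N\<^sup>2\<close>. This is Kendall's variance of order \<open>M ^ (d - 1)\<close> for the lattice points in
  a randomly shifted ball; the last step gives away a factor \<open>M\<close> to compare with the number of points.
\<close>

proposition grid_discrepancy_variance:
  assumes r: "0 < r" "r < 1/2"
  shows "\<exists>C\<ge>0. \<forall>M>0. (LINT t|torus_haar. (grid_discrepancy r M (t :: real^'n))\<^sup>2) \<le> C * real (M ^ CARD('n))"
proof -
  let ?e = "real CARD('n) + 1"
  obtain C where C: "C \<ge> 0" "\<And>k :: real^'n. k \<noteq> 0 \<Longrightarrow>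
     (norm (fourier_coeff (torus_ball r) k))\<^sup>2 \<le> C * norm k powr (- ?e)"
    using fourier_coeff_torus_ball_decay[OF r] by blast
  obtain S where S: "S \<ge> 0" "\<And>K. finite K \<Longrightarrow> K \<subseteq> int_lattice - {0 :: real^'n} \<Longrightarrow>
     (\<Sum>m\<in>K. norm m powr (- ?e)) \<le> S"
    using lattice_sum_bounded by blast
  have "(LINT t|torus_haar. (grid_discrepancy r M (t :: real^'n))\<^sup>2) \<le> (C * S) * real (M ^ CARD('n))"
    if M: "M > 0" for M :: nat
  proof (rule torus_parseval_le[OF grid_discrepancy_measurable periodic_grid_discrepancy])
    let ?N = "real (M ^ CARD('n))" and ?G = "grid M :: (real^'n) set"
    let ?p = "real (card ?G) * r ^ CARD('n) * measure lborel (cball (0::real^'n) 1)"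
    show "\<bar>grid_discrepancy r M x\<bar> \<le> real (card ?G) + \<bar>?p\<bar>" for x :: "real^'n"
    proof -
      have "\<bar>\<Sum>s\<in>?G. torus_ball r (x - s)\<bar> \<le> (\<Sum>s\<in>?G. 1)"
        by (rule order.trans[OF sum_abs]) (intro sum_mono torus_ball_range)
      then show ?thesis unfolding grid_discrepancy_def by (simp add: order.trans[OF abs_triangle_ineq4])
    qed
    have "AE t in torus_haar. \<forall>s\<in>?G. isCont (\<lambda>t. torus_ball r (t - s)) t"
      using AE_isCont_torus_ball_translate[of r "- _"]
      by (intro AE_finite_allI finite_grid M) simp
    then show "AE t in torus_haar. isCont (grid_discrepancy r M :: real^'n \<Rightarrow> real) t"
    proof eventually_elim
      case (elim t)
      then show ?case unfolding grid_discrepancy_def[abs_def]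
        by (intro continuous_diff continuous_sum continuous_const) auto
    qed
    fix K :: "(real^'n) set" assume K: "finite K" "K \<subseteq> int_lattice"
    let ?K = "{k \<in> K. k \<noteq> 0 \<and> (1 / real M) *\<^sub>R k \<in> int_lattice}"
    have fc: "fourier_coeff (grid_discrepancy r M) k =
        (if k \<noteq> 0 \<and> (1 / real M) *\<^sub>R k \<in> int_lattice
         then of_nat (M ^ CARD('n)) * fourier_coeff (torus_ball r) k else 0)" if "k \<in> K" for k
      using fourier_coeff_grid_discrepancy[OF r M] K(2) that by blast
    have "(\<Sum>k\<in>K. (norm (fourier_coeff (grid_discrepancy r M) k))\<^sup>2) =
       (\<Sum>k\<in>?K. ?N\<^sup>2 * (norm (fourier_coeff (torus_ball r) k))\<^sup>2)"
      using K by (intro sum.mono_neutral_cong_right)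
        (auto simp: fc norm_mult power_mult_distrib norm_power)
    also have "\<dots> \<le> (\<Sum>k\<in>?K. ?N\<^sup>2 * (C * norm k powr (- ?e)))"
      by (intro sum_mono mult_left_mono C) auto
    also have "\<dots> = (\<Sum>m\<in>(\<lambda>k. (1 / real M) *\<^sub>R k) ` ?K. ?N\<^sup>2 * (C * norm (real M *\<^sub>R m) powr (- ?e)))"
      using M by (subst sum.reindex) (auto simp: inj_on_def)
    also have "\<dots> = (?N\<^sup>2 * C * real M powr (- ?e)) * (\<Sum>m\<in>(\<lambda>k. (1 / real M) *\<^sub>R k) ` ?K. norm m powr (- ?e))"
      using M unfolding sum_distrib_left by (intro sum.cong refl) (simp add: powr_mult mult_ac)
    also have "\<dots> \<le> (?N\<^sup>2 * C * real M powr (- ?e)) * S"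
      using K(1) M C(1) by (intro mult_left_mono S) auto
    also have "\<dots> \<le> (?N\<^sup>2 * C * (1 / ?N)) * S"
    proof (intro mult_right_mono mult_left_mono S)
      have "real M powr (- ?e) \<le> real M powr (- real CARD('n))" using M by (intro powr_mono) auto
      also have "\<dots> = 1 / ?N" using M by (simp add: powr_minus_divide powr_realpow)
      finally show "real M powr (- ?e) \<le> 1 / ?N" .
    qed (use C in auto)
    also have "\<dots> = (C * S) * ?N" using M by (simp add: power2_eq_square)
    finally show "(\<Sum>k\<in>K. (norm (fourier_coeff (grid_discrepancy r M) k))\<^sup>2) \<le> (C * S) * ?N" .
  qed
  then show ?thesis using C(1) S(1) by (intro exI[of _ "C * S"]) auto
qed

section \<open>Second moments of sums of independent variables\<close>

text \<open>
  Induction on the index set, integrating out one coordinate at a time: the mean of that coordinate is absorbed into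
  the constant \<open>b\<close>, which is why \<open>b\<close> is arbitrary.
\<close>

lemma (in product_prob_space) integral_square_sum_independent:
  fixes f :: "'i \<Rightarrow> 'a \<Rightarrow> real"
  assumes "finite J"
    and meas: "\<And>i. f i \<in> borel_measurable (M i)" and bound: "\<And>i x. \<bar>f i x\<bar> \<le> B"
  shows "(LINT v|PiM J M. ((\<Sum>j\<in>J. f j (v j)) - b)\<^sup>2) =
     (\<Sum>j\<in>J. (LINT x|M j. (f j x)\<^sup>2) - (LINT x|M j. f j x)\<^sup>2) + ((\<Sum>j\<in>J. LINT x|M j. f j x) - b)\<^sup>2"
  using \<open>finite J\<close>
proof (induction J arbitrary: b)
  case empty
  interpret E: prob_space "PiM {} M" by (rule prob_space_PiM) (rule prob_space)
  show ?case using E.prob_space by simp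
next
  case (insert i J)
  note [measurable] = meas
  have B0: "B \<ge> 0" using bound[of undefined undefined] by linarith
  interpret I: prob_space "PiM (insert i J) M" by (rule prob_space_PiM) (rule prob_space)
  interpret J: prob_space "PiM J M" by (rule prob_space_PiM) (rule prob_space)
  have pi: "prob_space (M i)" by (rule prob_space)
  have sb: "\<bar>(\<Sum>j\<in>K. f j (v j)) - b\<bar> \<le> real (card K) * B + \<bar>b\<bar>" for K v b
  proof -
    have "\<bar>\<Sum>j\<in>K. f j (v j)\<bar> \<le> real (card K) * B"
      by (rule order.trans[OF sum_abs], rule order.trans[OF sum_mono[OF bound]]) simp
    then show ?thesis by linarith
  qed
  have sqb: "((\<Sum>j\<in>K. f j (v j)) - b)\<^sup>2 \<le> (real (card K) * B + \<bar>b\<bar>)\<^sup>2" for K v b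
    using power_mono[where n=2, OF sb] by simp
  let ?m = "LINT x|M i. f i x" and ?q = "LINT x|M i. (f i x)\<^sup>2"
  have fi: "integrable (M i) (f i)" by (rule finite_measure.integrable_const_bound[OF prob_space.finite_measure[OF pi], where B=B]) (use bound in auto)
  have fi2: "integrable (M i) (\<lambda>x. (f i x)\<^sup>2)"
    by (rule finite_measure.integrable_const_bound[OF prob_space.finite_measure[OF pi], where B="B\<^sup>2"]) (use power_mono[where n=2, OF bound] in auto)
  have intI: "integrable (PiM (insert i J) M) (\<lambda>v. ((\<Sum>j\<in>insert i J. f j (v j)) - b)\<^sup>2)"
    by (rule I.integrable_const_bound[where B="(real (card (insert i J)) * B + \<bar>b\<bar>)\<^sup>2"]) (use sqb in auto)
  have intJ: "integrable (PiM J M) (\<lambda>v. ((\<Sum>j\<in>J. f j (v j)) - (b - ?m))\<^sup>2)"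
    by (rule J.integrable_const_bound[where B="(real (card J) * B + \<bar>b - ?m\<bar>)\<^sup>2"]) (use sqb in auto)
  have "(LINT v|PiM (insert i J) M. ((\<Sum>j\<in>insert i J. f j (v j)) - b)\<^sup>2) =
      (LINT v|PiM J M. LINT y|M i. ((\<Sum>j\<in>insert i J. f j ((v(i := y)) j)) - b)\<^sup>2)"
    by (rule product_integral_insert[OF insert.hyps intI])
  also have "\<dots> = (LINT v|PiM J M. (?q - ?m\<^sup>2) + ((\<Sum>j\<in>J. f j (v j)) - (b - ?m))\<^sup>2)"
  proof (intro Bochner_Integration.integral_cong refl)
    fix v
    let ?c = "(\<Sum>j\<in>J. f j (v j)) - b"
    have "(\<Sum>j\<in>insert i J. f j ((v(i := y)) j)) = f i y + (\<Sum>j\<in>J. f j (v j))" for y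
      using insert.hyps by (auto intro!: sum.cong)
    then have "(LINT y|M i. ((\<Sum>j\<in>insert i J. f j ((v(i := y)) j)) - b)\<^sup>2) =
        (LINT y|M i. (f i y)\<^sup>2 + (2 * ?c) * f i y + ?c\<^sup>2)"
      by (intro Bochner_Integration.integral_cong refl) (simp add: power2_eq_square algebra_simps)
    also have "\<dots> = ?q + (2 * ?c) * ?m + ?c\<^sup>2"
      using fi fi2 prob_space.prob_space[OF pi] by simp
    also have "\<dots> = (?q - ?m\<^sup>2) + ((\<Sum>j\<in>J. f j (v j)) - (b - ?m))\<^sup>2"
      by (simp add: power2_eq_square algebra_simps)
    finally show "(LINT y|M i. ((\<Sum>j\<in>insert i J. f j ((v(i := y)) j)) - b)\<^sup>2) =
       (?q - ?m\<^sup>2) + ((\<Sum>j\<in>J. f j (v j)) - (b - ?m))\<^sup>2" .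
  qed
  also have "\<dots> = (?q - ?m\<^sup>2) + (LINT v|PiM J M. ((\<Sum>j\<in>J. f j (v j)) - (b - ?m))\<^sup>2)"
    using intJ J.prob_space by (subst Bochner_Integration.integral_add) auto
  also have "\<dots> = (?q - ?m\<^sup>2) + ((\<Sum>j\<in>J. (LINT x|M j. (f j x)\<^sup>2) - (LINT x|M j. f j x)\<^sup>2)
      + ((\<Sum>j\<in>J. LINT x|M j. f j x) - (b - ?m))\<^sup>2)"
    unfolding insert.IH ..
  also have "\<dots> = (\<Sum>j\<in>insert i J. (LINT x|M j. (f j x)\<^sup>2) - (LINT x|M j. f j x)\<^sup>2)
      + ((\<Sum>j\<in>insert i J. LINT x|M j. f j x) - b)\<^sup>2"
    using insert.hyps by (simp add: algebra_simps)
  finally show ?case .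
qed

section \<open>The averaged indicator\<close>

definition mean_torus_ball :: "real \<Rightarrow> (real^'n) measure \<Rightarrow> real^'n \<Rightarrow> real" where
  "mean_torus_ball r \<mu> t = (LINT u|\<mu>. torus_ball r (u + t))"

lemma torus_ball_product_range:
  "0 \<le> torus_ball r x * (1 - torus_ball r y)" "\<bar>torus_ball r x * (1 - torus_ball r y)\<bar> \<le> 1"
  by (auto simp: torus_ball_def indicator_def)

text \<open>
  Let \<open>w\<close> represent the difference \<open>u' - u\<close> in the cube. If \<open>w\<close> is outside the ball, move \<open>u\<close> to the centre. Otherwise
  move \<open>u'\<close> just outside the ball along the ray through \<open>w\<close>, to a radius \<open>\<rho>\<close> slightly above \<open>r\<close>; then
  \<open>u\<close> is at radius \<open>\<rho> - |w| < r\<close>, and \<open>\<rho> < 1/2\<close> ensures that no other lattice point is nearer to the image of \<open>u'\<close>.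
\<close>

lemma torus_ball_separates:
  fixes u u' :: "real^'n"
  assumes r: "0 < r" "r < 1/2" and u: "u \<in> torus_cube" "u' \<in> torus_cube" "u \<noteq> u'"
  obtains t where "norm (torus_rep (u + t)) < r" "r < norm (torus_rep (u' + t))"
proof -
  define w where "w = torus_rep (u' - u)"
  have wL: "w - (u' - u) \<in> int_lattice" unfolding w_def by (rule torus_rep_diff)
  have w0: "w \<noteq> 0"
  proof
    assume "w = 0"
    with wL have "- (u' - u) \<in> int_lattice" by simp
    from torus_rep_add_lattice[OF this, of u'] have "torus_rep u = torus_rep u'" by simp
    then show False using u torus_rep_id by metis
  qed
  have "\<exists>y. norm y < r \<and> r < norm (torus_rep (y + w))"
  proof (cases "norm w > r")
    case True
    have "torus_rep w = w" unfolding w_def by (rule torus_rep_id[OF torus_rep_in_cube])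
    then show ?thesis using True r by (intro exI[of _ 0]) auto
  next
    case False
    define \<rho> where "\<rho> = r + min ((1/2 - r) / 2) (norm w / 2)"
    have nw: "norm w > 0" using w0 by simp
    have \<rho>: "r < \<rho>" "\<rho> < 1/2" "\<rho> - norm w < r"
      using r nw unfolding \<rho>_def by (auto simp: min_def field_simps)
    define y where "y = ((\<rho> - norm w) / norm w) *\<^sub>R w"
    have "norm y = \<rho> - norm w" using nw False \<rho> by (simp add: y_def)
    moreover have yw: "y + w = (\<rho> / norm w) *\<^sub>R w"
      using nw by (simp add: y_def diff_divide_distrib scaleR_diff_left)
    moreover have nyw: "norm (y + w) = \<rho>" using nw \<rho> r unfolding yw by simp
    moreover have "torus_rep (y + w) = y + w"
      using nyw \<rho> by (intro torus_rep_id small_norm_in_torus_cube) simp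
    ultimately show ?thesis using \<rho> by (intro exI[of _ y]) simp
  qed
  then obtain y where y: "norm y < r" "r < norm (torus_rep (y + w))" by blast
  show thesis
  proof (rule that[of "y - u"])
    show "norm (torus_rep (u + (y - u))) < r"
      using norm_torus_rep_le[OF int_lattice_closed(1), of y] y(1) by simp
    have "torus_rep (u' + (y - u)) = torus_rep (u' + (y - u) + (w - (u' - u)))"
      by (rule torus_rep_add_lattice[OF wL, symmetric])
    also have "u' + (y - u) + (w - (u' - u)) = y + w" by simp
    finally show "r < norm (torus_rep (u' + (y - u)))" using y(2) by simp
  qed
qed

text \<open>
  The conditions found in \<open>torus_ball_separates\<close> are open, so they persist on a small ball of translations.
\<close>

lemma integral_torus_ball_difference_pos:
  fixes u u' :: "real^'n"
  assumes r: "0 < r" "r < 1/2" and u: "u \<in> torus_cube" "u' \<in> torus_cube" "u \<noteq> u'"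
  shows "0 < (LINT t|torus_haar. torus_ball r (u + t) * (1 - torus_ball r (u' + t)))"
proof -
  interpret prob_space "torus_haar :: (real^'n) measure" by (rule prob_space_torus_haar)
  let ?g = "\<lambda>t. torus_ball r (u + t) * (1 - torus_ball r (u' + t))"
  obtain t0 where t0: "norm (torus_rep (u + t0)) < r" "r < norm (torus_rep (u' + t0))"
    by (rule torus_ball_separates[OF r u])
  have cont: "continuous_on UNIV (\<lambda>t. norm (torus_rep (v + t)))" for v :: "real^'n"
    by (rule continuous_on_compose2[OF continuous_norm_torus_rep]) (auto intro: continuous_intros)
  have "open ({t. norm (torus_rep (u + t)) < r} \<inter> {t. r < norm (torus_rep (u' + t))})"
    by (intro open_Int open_Collect_less cont continuous_on_const)
  then obtain \<epsilon> where \<epsilon>: "\<epsilon> > 0" "\<And>t. dist t t0 < \<epsilon> \<Longrightarrow> norm (torus_rep (u + t)) < r \<and> r < norm (torus_rep (u' + t))"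
    using t0 unfolding open_dist by blast
  define \<delta> where "\<delta> = min \<epsilon> (1/2)"
  have \<delta>: "\<delta> > 0" using \<epsilon> by (simp add: \<delta>_def)
  have le: "indicator (ball 0 \<delta>) t \<le> ?g (t + t0)" for t :: "real^'n"
  proof (cases "t \<in> ball 0 \<delta>")
    case True
    then have "dist (t + t0) t0 < \<epsilon>" by (simp add: dist_norm \<delta>_def)
    from \<epsilon>(2)[OF this] show ?thesis by (simp add: torus_ball_def)
  next
    case False
    then show ?thesis using torus_ball_product_range(1)[of r "u + (t + t0)" "u' + (t + t0)"] by simp
  qed
  have gb: "\<bar>?g t\<bar> \<le> 1" for t by (rule torus_ball_product_range)
  have [measurable]: "ball (0::real^'n) \<delta> \<in> sets borel" by simp
  have sub: "ball 0 \<delta> \<subseteq> (torus_cube :: (real^'n) set)"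
    by (auto intro!: small_norm_in_torus_cube simp: \<delta>_def)
  have "emeasure torus_haar (ball (0::real^'n) \<delta>) = emeasure lborel (ball (0::real^'n) \<delta>)"
    unfolding torus_haar_def using sub
    by (subst emeasure_density) (auto simp: indicator_inter_arith[symmetric] Int_absorb1 intro!: nn_integral_cong)
  then have "0 < measure torus_haar (ball (0::real^'n) \<delta>)"
    using content_ball[of \<delta> "0::real^'n"] \<delta> by (simp add: measure_def)
  also have "\<dots> = (LINT t|torus_haar. indicator (ball (0::real^'n) \<delta>) t)" by simp
  also have "\<dots> \<le> (LINT t|torus_haar. ?g (t + t0))"
    using le gb by (intro integral_mono integrable_torus_haar_bounded[where B=1]) (auto simp: indicator_def)
  also have "\<dots> = (LINT t|torus_haar. ?g t)"
  proof (rule integral_torus_translate)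
    show "periodic ?g"
      using periodic_torus_ball_translate[of r u] periodic_torus_ball_translate[of r u']
      by (simp add: periodic_def add.commute[of u] add.commute[of u'])
  qed measurable
  finally show ?thesis .
qed

lemma prob_space_AE_exists:
  assumes "prob_space M" "AE x in M. P x"
  shows "\<exists>x. P x"
proof (rule ccontr)
  assume "\<not> ?thesis"
  with assms(2) have "AE x in M. False" by simp
  then show False using prob_space.AE_False[OF assms(1)] by simp
qed

context
  fixes r :: real and \<mu> :: "(real^'n) measure"
  assumes prob_\<mu>: "prob_space \<mu>" and sets_\<mu>: "sets \<mu> = sets borel"
begin

interpretation mu: prob_space \<mu> by (rule prob_\<mu>)
interpretation haar: prob_space "torus_haar :: (real^'n) measure" by (rule prob_space_torus_haar)
interpretation MH: pair_prob_space \<mu> "torus_haar :: (real^'n) measure" by unfold_locales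

declare sets_\<mu> [measurable_cong]

lemma mean_torus_ball_measurable: "mean_torus_ball r \<mu> \<in> borel_measurable borel"
  unfolding mean_torus_ball_def by measurable

lemmas [measurable] = mean_torus_ball_measurable

lemma mean_torus_ball_range: "0 \<le> mean_torus_ball r \<mu> t" "mean_torus_ball r \<mu> t \<le> 1"
proof -
  show "0 \<le> mean_torus_ball r \<mu> t"
    unfolding mean_torus_ball_def by (intro Bochner_Integration.integral_nonneg) (rule torus_ball_range)
  have "mean_torus_ball r \<mu> t \<le> (LINT u|\<mu>. 1)"
    unfolding mean_torus_ball_def
    by (intro integral_mono mu.integrable_const_bound[where B=1]) (auto simp: torus_ball_range)
  then show "mean_torus_ball r \<mu> t \<le> 1" using mu.prob_space by simp
qed

lemma periodic_mean_torus_ball: "periodic (mean_torus_ball r \<mu>)"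
  unfolding periodic_def mean_torus_ball_def
proof (intro allI ballI Bochner_Integration.integral_cong refl)
  fix x k u :: "real^'n" assume "k \<in> int_lattice"
  then show "torus_ball r (u + (x + k)) = torus_ball r (u + x)"
    using torus_ball_add_lattice[of k r "u + x"] by (simp add: add.assoc)
qed

text \<open>
  By Fubini the integral equals the double average over \<open>u\<close>, \<open>u'\<close> of the quantity in
  \<open>integral_torus_ball_difference_pos\<close>. If it vanished, almost every \<open>u'\<close> would coincide with a single \<open>u\<close>.
\<close>

lemma mean_variance_pos:
  assumes r: "0 < r" "r < 1/2" and cube: "AE u in \<mu>. u \<in> torus_cube"
    and not_dirac: "\<And>a. a \<in> torus_cube \<Longrightarrow> \<not> (AE u in \<mu>. u = a)"
  shows "0 < (LINT t|torus_haar. mean_torus_ball r \<mu> t * (1 - mean_torus_ball r \<mu> t))"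
proof (rule ccontr)
  let ?F = "mean_torus_ball r \<mu>"
  let ?c = "\<lambda>(u :: real^'n) t. torus_ball r (u + t) :: real"
  let ?G = "\<lambda>u u'. LINT t|torus_haar. ?c u t * (1 - ?c u' t)"
  assume neg: "\<not> 0 < (LINT t|torus_haar. ?F t * (1 - ?F t))"
  have b1: "\<bar>?c u t * (1 - ?c u' s)\<bar> \<le> 1" for u u' t s
    by (rule torus_ball_product_range)
  have b2: "\<bar>?c u t * (1 - ?F t)\<bar> \<le> 1" for u t
    using torus_ball_range[of r "u + t"] mean_torus_ball_range[of t]
    unfolding abs_mult by (intro mult_le_one) auto
  have ic: "integrable \<mu> (\<lambda>u. ?c u t)" for t
    by (rule mu.integrable_const_bound[where B=1]) (auto simp: torus_ball_range)
  have G0: "?G u u' \<ge> 0" for u u'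
    by (intro Bochner_Integration.integral_nonneg torus_ball_product_range)
  have Gm [measurable]: "(\<lambda>u'. ?G u u') \<in> borel_measurable borel" for u
    by (rule haar.borel_measurable_lebesgue_integral) measurable
  have Gb: "\<bar>?G u u'\<bar> \<le> 1" for u u'
  proof -
    have "\<bar>?G u u'\<bar> \<le> (LINT t|(torus_haar :: (real^'n) measure). 1)"
      by (rule integral_abs_bound_integral)
        (use b1 in \<open>auto intro!: integrable_torus_haar_bounded[where B=1]\<close>)
    then show ?thesis using haar.prob_space by simp
  qed
  have iG: "integrable \<mu> (\<lambda>u'. ?G u u')" for u
    by (rule mu.integrable_const_bound[where B=1]) (use Gb in auto)
  have inner: "(LINT t|torus_haar. ?c u t * (1 - ?F t)) = (LINT u'|\<mu>. ?G u u')" for u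
  proof -
    have "(LINT t|torus_haar. ?c u t * (1 - ?F t)) = (LINT t|torus_haar. LINT u'|\<mu>. ?c u t * (1 - ?c u' t))"
      unfolding mean_torus_ball_def using ic mu.prob_space
      by (intro Bochner_Integration.integral_cong refl) (simp add: Bochner_Integration.integral_diff)
    also have "\<dots> = (LINT u'|\<mu>. ?G u u')"
    proof (rule MH.Fubini_integral)
      show "integrable (\<mu> \<Otimes>\<^sub>M torus_haar) (\<lambda>(u', t). ?c u t * (1 - ?c u' t))"
        by (rule MH.P.integrable_const_bound[where B=1]) (use b1 in auto)
    qed
    finally show ?thesis .
  qed
  have Gm2 [measurable]: "(\<lambda>u. LINT u'|\<mu>. ?G u u') \<in> borel_measurable borel"
    unfolding inner[symmetric] by (rule haar.borel_measurable_lebesgue_integral) measurable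
  have GGb: "\<bar>LINT u'|\<mu>. ?G u u'\<bar> \<le> 1" for u
  proof -
    have "\<bar>LINT u'|\<mu>. ?G u u'\<bar> \<le> (LINT u'|\<mu>. 1)"
      by (rule integral_abs_bound_integral) (use Gb iG in auto)
    then show ?thesis using mu.prob_space by simp
  qed
  have iGG: "integrable \<mu> (\<lambda>u. LINT u'|\<mu>. ?G u u')"
    by (rule mu.integrable_const_bound[where B=1]) (use GGb in auto)
  have "(LINT t|torus_haar. ?F t * (1 - ?F t)) = (LINT t|torus_haar. LINT u|\<mu>. ?c u t * (1 - ?F t))"
    by (intro Bochner_Integration.integral_cong refl) (simp add: mean_torus_ball_def)
  also have "\<dots> = (LINT u|\<mu>. LINT t|torus_haar. ?c u t * (1 - ?F t))"
  proof (rule MH.Fubini_integral)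
    show "integrable (\<mu> \<Otimes>\<^sub>M torus_haar) (\<lambda>(u, t). ?c u t * (1 - ?F t))"
      by (rule MH.P.integrable_const_bound[where B=1]) (use b2 in auto)
  qed
  also have "\<dots> = (LINT u|\<mu>. LINT u'|\<mu>. ?G u u')" by (simp only: inner)
  finally have "(LINT u|\<mu>. LINT u'|\<mu>. ?G u u') \<le> 0" using neg by linarith
  moreover have GG0: "(LINT u'|\<mu>. ?G u u') \<ge> 0" for u
    by (rule Bochner_Integration.integral_nonneg, rule G0)
  ultimately have "(LINT u|\<mu>. LINT u'|\<mu>. ?G u u') = 0" by (intro antisym Bochner_Integration.integral_nonneg[OF GG0]) auto
  then have "AE u in \<mu>. (LINT u'|\<mu>. ?G u u') = 0"
    using integral_nonneg_eq_0_iff_AE[OF iGG] GG0 by simp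
  with cube have "AE u in \<mu>. u \<in> torus_cube \<and> (LINT u'|\<mu>. ?G u u') = 0" by eventually_elim simp
  then obtain u where u: "u \<in> torus_cube" "(LINT u'|\<mu>. ?G u u') = 0"
    using prob_space_AE_exists[OF prob_\<mu>] by blast
  then have "AE u' in \<mu>. ?G u u' = 0"
    using integral_nonneg_eq_0_iff_AE[OF iG] G0 by simp
  with cube have "AE u' in \<mu>. u' = u"
  proof eventually_elim
    case (elim u')
    then show ?case using integral_torus_ball_difference_pos[OF r u(1), of u'] by force
  qed
  with not_dirac u(1) show False by blast
qed

text \<open>
  The function on the left is the \<open>\<mu>\<close>-average of translates of the grid discrepancy: apply Jensen's inequality
  for the square, Fubini, and translation invariance.
\<close>

lemma mean_bias_le:
  "(LINT t|torus_haar. ((\<Sum>s\<in>grid M. mean_torus_ball r \<mu> (t - s))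
       - real (card (grid M :: (real^'n) set)) * r ^ CARD('n) * measure lborel (cball (0::real^'n) 1))\<^sup>2)
    \<le> (LINT t|torus_haar. (grid_discrepancy r M (t :: real^'n))\<^sup>2)"
proof -
  let ?p = "real (card (grid M :: (real^'n) set)) * r ^ CARD('n) * measure lborel (cball (0::real^'n) 1)"
  let ?h = "grid_discrepancy r M :: real^'n \<Rightarrow> real"
  let ?G = "grid M :: (real^'n) set"
  define S where "S = real (card ?G) + \<bar>?p\<bar>"
  have hb: "\<bar>?h x\<bar> \<le> S" for x :: "real^'n"
  proof -
    have "\<bar>\<Sum>s\<in>?G. torus_ball r (x - s)\<bar> \<le> (\<Sum>s\<in>?G. 1)"
      by (rule order.trans[OF sum_abs]) (intro sum_mono torus_ball_range)
    then show ?thesis unfolding grid_discrepancy_def S_def by (simp add: order.trans[OF abs_triangle_ineq4])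
  qed
  have h2b: "(?h x)\<^sup>2 \<le> S\<^sup>2" for x using power_mono[where n=2, OF hb] by simp
  have ih: "integrable \<mu> (\<lambda>u. ?h (u + t))" for t
    by (rule mu.integrable_const_bound[where B=S]) (use hb in auto)
  have ih2: "integrable \<mu> (\<lambda>u. (?h (u + t))\<^sup>2)" for t
    by (rule mu.integrable_const_bound[where B="S\<^sup>2"]) (use h2b in auto)
  have mean: "(\<Sum>s\<in>?G. mean_torus_ball r \<mu> (t - s)) - ?p = (LINT u|\<mu>. ?h (u + t))" for t
  proof -
    have i: "integrable \<mu> (\<lambda>u. torus_ball r (u + t - s))" for s
      by (rule mu.integrable_const_bound[where B=1]) (auto simp: torus_ball_range)
    have "(LINT u|\<mu>. ?h (u + t)) = (\<Sum>s\<in>?G. LINT u|\<mu>. torus_ball r (u + t - s)) - ?p"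
      unfolding grid_discrepancy_def using i mu.prob_space
      by (simp add: Bochner_Integration.integral_diff Bochner_Integration.integral_sum)
    then show ?thesis by (simp add: mean_torus_ball_def algebra_simps)
  qed
  have jensen: "(LINT u|\<mu>. ?h (u + t))\<^sup>2 \<le> (LINT u|\<mu>. (?h (u + t))\<^sup>2)" for t
    using mu.variance_positive[of "\<lambda>u. ?h (u + t)"] mu.variance_eq[OF ih ih2] by simp
  have mb: "\<bar>LINT u|\<mu>. ?h (u + t)\<bar> \<le> S" for t
  proof -
    have "\<bar>LINT u|\<mu>. ?h (u + t)\<bar> \<le> (LINT u|\<mu>. S)"
      by (rule integral_abs_bound_integral) (use hb ih in auto)
    then show ?thesis using mu.prob_space by simp
  qed
  have m2b: "(LINT u|\<mu>. (?h (u + t))\<^sup>2) \<le> S\<^sup>2" for t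
  proof -
    have "(LINT u|\<mu>. (?h (u + t))\<^sup>2) \<le> (LINT u|\<mu>. S\<^sup>2)"
      by (rule integral_mono) (use h2b ih2 in auto)
    then show ?thesis using mu.prob_space by simp
  qed
  have "(LINT t|torus_haar. ((\<Sum>s\<in>?G. mean_torus_ball r \<mu> (t - s)) - ?p)\<^sup>2)
      \<le> (LINT t|torus_haar. LINT u|\<mu>. (?h (u + t))\<^sup>2)"
    unfolding mean
  proof (rule integral_mono)
    show "integrable torus_haar (\<lambda>t. (LINT u|\<mu>. ?h (u + t))\<^sup>2)"
      by (rule integrable_torus_haar_bounded[where B="S\<^sup>2"]) (use power_mono[where n=2, OF mb] in auto)
    show "integrable torus_haar (\<lambda>t. LINT u|\<mu>. (?h (u + t))\<^sup>2)"
      by (rule integrable_torus_haar_bounded[where B="S\<^sup>2"]) (use m2b in auto)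
  qed (rule jensen)
  also have "\<dots> = (LINT u|\<mu>. LINT t|torus_haar. (?h (u + t))\<^sup>2)"
  proof (rule MH.Fubini_integral)
    show "integrable (\<mu> \<Otimes>\<^sub>M torus_haar) (\<lambda>(u, t). (?h (u + t))\<^sup>2)"
      by (rule MH.P.integrable_const_bound[where B="S\<^sup>2"]) (use h2b in auto)
  qed
  also have "\<dots> = (LINT u|\<mu>. LINT t|torus_haar. (?h t)\<^sup>2)"
  proof (rule Bochner_Integration.integral_cong[OF refl])
    fix u :: "real^'n"
    show "(LINT t|torus_haar. (?h (u + t))\<^sup>2) = (LINT t|torus_haar. (?h t)\<^sup>2)"
      using integral_torus_translate[of "\<lambda>t. (?h t)\<^sup>2" u] periodic_grid_discrepancy[of r M, where 'n='n]
      by (simp add: periodic_def add.commute)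
  qed
  also have "\<dots> = (LINT t|torus_haar. (?h t)\<^sup>2)" using mu.prob_space by simp
  finally show ?thesis .
qed

end

section \<open>The generalized discrepancy\<close>

text \<open>
  The measure \<open>\<mu>'\<close> is \<open>\<mu>\<close> regarded as a measure on the Borel sets of the ambient space, to match
  \<open>torus_haar\<close>.
\<close>

lemma gen_discrepancy_bias_variance:
  fixes \<mu> :: "(real^'n) measure"
  assumes prob: "prob_space \<mu>" and sets: "sets \<mu> = sets torus_borel" and M: "M > 0"
  defines "\<mu>' \<equiv> distr \<mu> borel (\<lambda>x. x)"
  shows "(gen_discrepancy r \<mu> M)\<^sup>2 =
     real (M ^ CARD('n)) * (LINT t|torus_haar. mean_torus_ball r \<mu>' t * (1 - mean_torus_ball r \<mu>' t)) +
     (LINT t|torus_haar. ((\<Sum>s\<in>grid M. mean_torus_ball r \<mu>' (t - s))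
       - real (card (grid M :: (real^'n) set)) * r ^ CARD('n) * measure lborel (cball (0::real^'n) 1))\<^sup>2)"
proof -
  interpret mu: prob_space \<mu> by (rule prob)
  have id_m: "(\<lambda>x. x) \<in> \<mu> \<rightarrow>\<^sub>M borel"
    by (rule measurable_torus_borelD) (simp add: measurable_ident_sets[OF sets] )
  have borel_m: "f \<in> borel_measurable \<mu>" if "f \<in> borel_measurable borel" for f :: "real^'n \<Rightarrow> real"
    using measurable_compose[OF id_m that] by simp
  have borel_t: "f \<in> borel_measurable torus_borel" if "f \<in> borel_measurable borel" for f :: "real^'n \<Rightarrow> real"
    unfolding torus_borel_def using that by (rule measurable_restrict_space1)
  have prob': "prob_space \<mu>'" unfolding \<mu>'_def by (rule mu.prob_space_distr[OF id_m])
  have sets': "sets \<mu>' = sets borel" by (simp add: \<mu>'_def)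
  let ?\<nu> = "\<lambda>s. torus_translate s \<mu>"
  let ?G = "grid M :: (real^'n) set"
  let ?p = "real (card ?G) * r ^ CARD('n) * measure lborel (cball (0::real^'n) 1)"
  let ?F = "mean_torus_ball r \<mu>'"
  have sets_\<nu>: "sets (?\<nu> s) = sets torus_borel" for s by (simp add: torus_translate_def)
  have prob_\<nu>: "prob_space (?\<nu> s)" for s
    unfolding torus_translate_def by (intro mu.prob_space_distr torus_translate_measurable sets)
  interpret N: product_prob_space ?\<nu> by (rule product_prob_spaceI[OF prob_\<nu>])
  interpret P: prob_space "PiM ?G ?\<nu>" by (rule prob_space_PiM[OF prob_\<nu>])
  interpret haar: prob_space "torus_haar :: (real^'n) measure" by (rule prob_space_torus_haar)
  interpret PH: pair_prob_space "PiM ?G ?\<nu>" "torus_haar :: (real^'n) measure" by unfold_locales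
  note [measurable] = mean_torus_ball_measurable[OF prob' sets']
  have mean_\<nu>: "(LINT v|?\<nu> s. torus_ball r (v + t)) = ?F (t - s)" for s t
  proof -
    have "(LINT v|?\<nu> s. torus_ball r (v + t)) = (LINT u|\<mu>. torus_ball r (torus_rep (u - s) + t))"
      unfolding torus_translate_def by (rule integral_distr[OF torus_translate_measurable[OF sets] borel_t]) measurable
    also have "\<dots> = (LINT u|\<mu>. torus_ball r (u + (t - s)))"
      using periodic_torus_rep[OF periodic_torus_ball_translate[of r t]]
      by (intro Bochner_Integration.integral_cong refl) (simp add: algebra_simps)
    also have "\<dots> = ?F (t - s)"
      unfolding mean_torus_ball_def \<mu>'_def by (rule integral_distr[OF id_m, symmetric]) measurable
    finally show ?thesis .
  qed
  let ?D = "\<lambda>v t. (\<Sum>s\<in>?G. torus_ball r (v s + t)) - ?p"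
  have disc: "discrepancy r ?G v t = ?D v t" for v and t :: "real^'n"
    by (simp add: discrepancy_def indicator_shifted_ball)
  have comp: "(\<lambda>p. fst p s) \<in> (PiM ?G ?\<nu> \<Otimes>\<^sub>M (torus_haar :: (real^'n) measure)) \<rightarrow>\<^sub>M borel" if "s \<in> ?G" for s
  proof (rule measurable_torus_borelD)
    have "(\<lambda>p. fst p s) \<in> (PiM ?G ?\<nu> \<Otimes>\<^sub>M (torus_haar :: (real^'n) measure)) \<rightarrow>\<^sub>M ?\<nu> s"
      by (rule measurable_compose[OF measurable_fst measurable_component_singleton[OF that]])
    then show "(\<lambda>p. fst p s) \<in> (PiM ?G ?\<nu> \<Otimes>\<^sub>M (torus_haar :: (real^'n) measure)) \<rightarrow>\<^sub>M torus_borel"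
      by (simp cong: measurable_cong_sets add: measurable_cong_sets[OF refl sets_\<nu>])
  qed
  have Dm: "(\<lambda>p. (?D (fst p) (snd p))\<^sup>2) \<in> borel_measurable (PiM ?G ?\<nu> \<Otimes>\<^sub>M (torus_haar :: (real^'n) measure))"
  proof (intro borel_measurable_power borel_measurable_diff borel_measurable_sum borel_measurable_const)
    fix s assume s: "s \<in> ?G"
    have "snd \<in> (PiM ?G ?\<nu> \<Otimes>\<^sub>M (torus_haar :: (real^'n) measure)) \<rightarrow>\<^sub>M borel"
      using measurable_snd[of "PiM ?G ?\<nu>" torus_haar] by (simp cong: measurable_cong_sets)
    from measurable_compose[OF borel_measurable_add[OF comp[OF s] this] torus_ball_measurable]
    show "(\<lambda>p. torus_ball r (fst p s + snd p)) \<in> borel_measurable (PiM ?G ?\<nu> \<Otimes>\<^sub>M (torus_haar :: (real^'n) measure))" .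
  qed
  define S where "S = real (card ?G) + \<bar>?p\<bar>"
  have Db: "\<bar>?D v t\<bar> \<le> S" for v t
  proof -
    have "\<bar>\<Sum>s\<in>?G. torus_ball r (v s + t)\<bar> \<le> (\<Sum>s\<in>?G. 1)"
      by (rule order.trans[OF sum_abs]) (intro sum_mono torus_ball_range)
    then show ?thesis unfolding S_def by (simp add: order.trans[OF abs_triangle_ineq4])
  qed
  have D2b: "(?D v t)\<^sup>2 \<le> S\<^sup>2" for v t using power_mono[where n=2, OF Db] by simp
  have "(gen_discrepancy r \<mu> M)\<^sup>2 = (LINT v|PiM ?G ?\<nu>. (LINT t:torus_cube|lborel. (?D v t)\<^sup>2))"
    unfolding gen_discrepancy_def disc
    by (rule real_sqrt_pow2) (auto intro!: Bochner_Integration.integral_nonneg simp: set_lebesgue_integral_def)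
  also have "\<dots> = (LINT v|PiM ?G ?\<nu>. LINT t|torus_haar. (?D v t)\<^sup>2)"
    by (intro Bochner_Integration.integral_cong refl integral_torus_haar[symmetric]) measurable
  also have "\<dots> = (LINT t|torus_haar. LINT v|PiM ?G ?\<nu>. (?D v t)\<^sup>2)"
  proof (rule PH.Fubini_integral[symmetric])
    show "integrable (PiM ?G ?\<nu> \<Otimes>\<^sub>M (torus_haar :: (real^'n) measure)) (\<lambda>(v, t). (?D v t)\<^sup>2)"
      by (rule PH.P.integrable_const_bound[where B="S\<^sup>2"]) (use D2b Dm in \<open>auto simp: case_prod_beta'\<close>)
  qed
  also have "\<dots> = (LINT t|torus_haar. (\<Sum>s\<in>?G. ?F (t - s) * (1 - ?F (t - s))) + ((\<Sum>s\<in>?G. ?F (t - s)) - ?p)\<^sup>2)"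
  proof (intro Bochner_Integration.integral_cong refl)
    fix t :: "real^'n"
    have "(LINT v|PiM ?G ?\<nu>. (?D v t)\<^sup>2) =
      (\<Sum>s\<in>?G. (LINT x|?\<nu> s. (torus_ball r (x + t))\<^sup>2) - (LINT x|?\<nu> s. torus_ball r (x + t))\<^sup>2)
      + ((\<Sum>s\<in>?G. LINT x|?\<nu> s. torus_ball r (x + t)) - ?p)\<^sup>2"
    proof (rule N.integral_square_sum_independent[where f="\<lambda>s x. torus_ball r (x + t)" and B=1])
      show "(\<lambda>x. torus_ball r (x + t)) \<in> borel_measurable (?\<nu> s)" for s
        unfolding measurable_cong_sets[OF sets_\<nu> refl] by (rule borel_t) measurable
    qed (auto simp: finite_grid M torus_ball_range)
    moreover have sq: "(torus_ball r (x + t))\<^sup>2 = torus_ball r (x + t)" for x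
      by (simp add: torus_ball_def indicator_def)
    have "(LINT x|?\<nu> s. (torus_ball r (x + t))\<^sup>2) - (LINT x|?\<nu> s. torus_ball r (x + t))\<^sup>2 =
        ?F (t - s) * (1 - ?F (t - s))" for s
      unfolding sq mean_\<nu> by (simp add: power2_eq_square right_diff_distrib)
    ultimately show "(LINT v|PiM ?G ?\<nu>. (?D v t)\<^sup>2) =
      (\<Sum>s\<in>?G. ?F (t - s) * (1 - ?F (t - s))) + ((\<Sum>s\<in>?G. ?F (t - s)) - ?p)\<^sup>2"
      by (simp only: mean_\<nu>)
  qed
  also have "\<dots> = (\<Sum>s\<in>?G. LINT t|torus_haar. ?F (t - s) * (1 - ?F (t - s)))
     + (LINT t|torus_haar. ((\<Sum>s\<in>?G. ?F (t - s)) - ?p)\<^sup>2)"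
  proof -
    note Fr = mean_torus_ball_range[OF prob' sets', of r]
    have i1: "integrable torus_haar (\<lambda>t. ?F (t - s) * (1 - ?F (t - s)))" for s
    proof (rule integrable_torus_haar_bounded[where B=1])
      show "norm (?F (t - s) * (1 - ?F (t - s))) \<le> 1" for t
        unfolding norm_mult using Fr[of "t - s"] by (intro mult_le_one) auto
    qed measurable
    have i2: "integrable torus_haar (\<lambda>t. ((\<Sum>s\<in>?G. ?F (t - s)) - ?p)\<^sup>2)"
    proof (rule integrable_torus_haar_bounded[where B="S\<^sup>2"])
      fix t
      have "\<bar>\<Sum>s\<in>?G. ?F (t - s)\<bar> \<le> (\<Sum>s\<in>?G. 1)"
        by (rule order.trans[OF sum_abs], intro sum_mono) (use Fr in auto)
      then have "\<bar>(\<Sum>s\<in>?G. ?F (t - s)) - ?p\<bar> \<le> S"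
        unfolding S_def by (simp add: order.trans[OF abs_triangle_ineq4])
      from power_mono[where n=2, OF this] show "norm (((\<Sum>s\<in>?G. ?F (t - s)) - ?p)\<^sup>2) \<le> S\<^sup>2" by simp
    qed measurable
    show ?thesis
      by (subst Bochner_Integration.integral_add, intro Bochner_Integration.integrable_sum i1, rule i2,
          subst Bochner_Integration.integral_sum, rule i1, rule refl)
  qed
  also have "(\<Sum>s\<in>?G. LINT t|torus_haar. ?F (t - s) * (1 - ?F (t - s))) =
     (\<Sum>s\<in>?G. LINT t|torus_haar. ?F t * (1 - ?F t))"
  proof (rule sum.cong[OF refl])
    fix s :: "real^'n"
    show "(LINT t|torus_haar. ?F (t - s) * (1 - ?F (t - s))) = (LINT t|torus_haar. ?F t * (1 - ?F t))"
      using integral_torus_translate[of "\<lambda>t. ?F t * (1 - ?F t)" "- s"]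
        periodic_mean_torus_ball[OF prob' sets', of r]
      by (simp add: periodic_def)
  qed
  also have "\<dots> = real (M ^ CARD('n)) * (LINT t|torus_haar. ?F t * (1 - ?F t))"
    by (simp add: card_grid[OF M])
  finally show ?thesis .
qed

theorem theorem2:
  fixes r :: real and \<mu> :: "(real^'n) measure"
  assumes "CARD('n) \<ge> 2"
    and "0 < r" and "r < 1/2"
    and "prob_space \<mu>" and "sets \<mu> = sets torus_borel"
    and "\<And>t0. t0 \<in> torus_cube \<Longrightarrow> \<mu> \<noteq> return torus_borel t0"
  shows "\<exists>c1 c2. 0 < c1 \<and> 0 < c2 \<and>
    (\<forall>M::nat. M > 0 \<longrightarrow>
       c1 * real (M ^ CARD('n)) \<le> (gen_discrepancy r \<mu> M)\<^sup>2 \<and>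
       (gen_discrepancy r \<mu> M)\<^sup>2 \<le> c2 * real (M ^ CARD('n)))"
proof -
  note r = \<open>0 < r\<close> \<open>r < 1/2\<close> and sets = \<open>sets \<mu> = sets torus_borel\<close>
  interpret mu: prob_space \<mu> by fact
  have space: "space \<mu> = torus_cube"
    using sets_eq_imp_space_eq[OF sets] by (simp add: space_torus_borel)
  define \<mu>' where "\<mu>' = distr \<mu> borel (\<lambda>x. x)"
  have id_m: "(\<lambda>x. x) \<in> \<mu> \<rightarrow>\<^sub>M borel"
    by (rule measurable_torus_borelD) (simp add: measurable_ident_sets[OF sets])
  have prob': "prob_space \<mu>'" unfolding \<mu>'_def by (rule mu.prob_space_distr[OF id_m])
  have sets': "sets \<mu>' = sets borel" by (simp add: \<mu>'_def)
  let ?F = "mean_torus_ball r \<mu>'"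
  define c where "c = (LINT t|torus_haar. ?F t * (1 - ?F t))"
  have "0 < c" unfolding c_def
  proof (rule mean_variance_pos[OF prob' sets' r])
    show "AE u in \<mu>'. u \<in> torus_cube"
      unfolding \<mu>'_def using torus_cube_borel
      by (subst AE_distr_iff[OF id_m]) (auto simp: space intro!: AE_I2)
  next
    fix a :: "real^'n" assume a: "a \<in> torus_cube"
    show "\<not> (AE u in \<mu>'. u = a)"
    proof
      assume "AE u in \<mu>'. u = a"
      then have ae: "AE u in \<mu>. u = a"
        unfolding \<mu>'_def by (subst (asm) AE_distr_iff[OF id_m]) auto
      have "\<mu> = return torus_borel a"
      proof (rule measure_eqI)
        fix A assume A: "A \<in> sets \<mu>"
        have "emeasure \<mu> A = indicator A a"
        proof (cases "a \<in> A")
          case True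
          from ae have "AE u in \<mu>. u \<in> A" by eventually_elim (use True in simp)
          then show ?thesis using True A mu.emeasure_eq_1_AE by simp
        next
          case False
          from ae have "AE u in \<mu>. u \<notin> A" by eventually_elim (use False in simp)
          then have "emeasure \<mu> A = 0" using A by (simp add: AE_iff_null_sets null_setsD1)
          then show ?thesis using False by simp
        qed
        then show "emeasure \<mu> A = emeasure (return torus_borel a) A" using A sets by simp
      qed (simp add: sets)
      with assms(6)[OF a] show False by simp
    qed
  qed
  have "c \<le> 1"
  proof -
    note Fr = mean_torus_ball_range[OF prob' sets', of r]
    interpret haar: prob_space "torus_haar :: (real^'n) measure" by (rule prob_space_torus_haar)
    note [measurable] = mean_torus_ball_measurable[OF prob' sets']
    have b: "\<bar>?F t * (1 - ?F t)\<bar> \<le> 1" for t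
      unfolding abs_mult using Fr[of t] by (intro mult_le_one) auto
    have "\<bar>c\<bar> \<le> (LINT t|(torus_haar :: (real^'n) measure). 1)"
      unfolding c_def by (rule integral_abs_bound_integral)
        (use b in \<open>auto intro!: integrable_torus_haar_bounded[where B=1]\<close>)
    then show ?thesis using haar.prob_space by simp
  qed
  obtain C where C: "C \<ge> 0" "\<And>M. M > 0 \<Longrightarrow>
      (LINT t|torus_haar. (grid_discrepancy r M (t :: real^'n))\<^sup>2) \<le> C * real (M ^ CARD('n))"
    using grid_discrepancy_variance[OF r] by blast
  show ?thesis
  proof (rule exI[of _ c], rule exI[of _ "1 + C"], intro conjI allI impI)
    fix M :: nat assume M: "M > 0"
    define b where "b = (LINT t|torus_haar. ((\<Sum>s\<in>grid M. ?F (t - s))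
       - real (card (grid M :: (real^'n) set)) * r ^ CARD('n) * measure lborel (cball (0::real^'n) 1))\<^sup>2)"
    have D: "(gen_discrepancy r \<mu> M)\<^sup>2 = real (M ^ CARD('n)) * c + b"
      unfolding b_def c_def \<mu>'_def by (rule gen_discrepancy_bias_variance[OF \<open>prob_space \<mu>\<close> sets M])
    have "b \<ge> 0" unfolding b_def by (intro Bochner_Integration.integral_nonneg) simp
    then show "c * real (M ^ CARD('n)) \<le> (gen_discrepancy r \<mu> M)\<^sup>2" unfolding D by (simp add: mult.commute)
    have "b \<le> C * real (M ^ CARD('n))"
      unfolding b_def by (rule order.trans[OF mean_bias_le[OF prob' sets'] C(2)[OF M]])
    moreover have "real (M ^ CARD('n)) * c \<le> real (M ^ CARD('n)) * 1"
      using \<open>c \<le> 1\<close> by (intro mult_left_mono) auto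
    ultimately show "(gen_discrepancy r \<mu> M)\<^sup>2 \<le> (1 + C) * real (M ^ CARD('n))"
      unfolding D by (simp add: distrib_right)
  qed (use \<open>0 < c\<close> \<open>C \<ge> 0\<close> in auto)
qed

end
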